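(* Let $d\ge1$, let $Q:\mathbb{R}^d\to[0,\infty)$ be continuous with $Q(x) = \gamma |x|^{\alpha} + O(|x|^{\alpha-\varepsilon})$ as $|x|\to\infty$ for some positive constants $\alpha,\gamma,\varepsilon$, and let $\mu^Q$ be its equilibrium measure. For $n>k$ define \[ R_{k,n}(y_1,\dots,y_k) = D_n \int\cdots\int e^{-n\sum_{j=1}^n Q(y_j)} \prod_{1\le i<j\le n}|y_i-y_j|^2\, dy_{k+1}\cdots dy_n , \] where $y_j\in\mathbb{R}^d$ and $D_n$ is chosen so that $D_n\int_{(\mathbb{R}^d)^n} e^{-n\sum_j Q(y_j)}\prod_{i<j}|y_i-y_j|^2\,dy = 1$. Then for every bounded continuous function $\phi$ on $(\mathbb{R}^d)^k$, \[ \lim_{n\to\infty} \int_{(\mathbb{R}^d)^k} \phi(y)\, R_{k,n}(y)\, dy = \int_{(\mathbb{R}^d)^k} \phi(x)\, d\mu^Q(x_1)\cdots d\mu^Q(x_k). \]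
   Context: $|x|$ is the Euclidean norm on $\mathbb{R}^d$. For a probability measure $\mu$ on $\mathbb{R}^d$, $I^Q(\mu) = \iint \log\frac{1}{|x-y|}\,d\mu(x)\,d\mu(y) + \int Q\,d\mu$. The equilibrium measure $\mu^Q$ is the unique probability measure minimizing $I^Q$ (it exists and is compactly supported for such $Q$). *)

theory Defs
  imports "HOL-Probability.Probability" "HOL-Library.Landau_Symbols"
begin

definition wkernel :: "('a::euclidean_space \<Rightarrow> real) \<Rightarrow> 'a \<Rightarrow> 'a \<Rightarrow> ereal" where
  "wkernel Q x y = (if x = y then \<infinity> else ereal (ln (1 / norm (x - y)) + Q x / 2 + Q y / 2))"

text \<open>Weighted energy I^Q(mu) = double integral of log(1/|x-y|) plus integral of Q,
  computed as the (extended real) integral of the weighted kernel w.r.t. mu x mu.\<close>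
definition energyQ :: "('a::euclidean_space \<Rightarrow> real) \<Rightarrow> 'a measure \<Rightarrow> ereal" where
  "energyQ Q \<mu> =
     enn2ereal (\<integral>\<^sup>+ z. e2ennreal (wkernel Q (fst z) (snd z)) \<partial>(\<mu> \<Otimes>\<^sub>M \<mu>))
   - enn2ereal (\<integral>\<^sup>+ z. e2ennreal (- wkernel Q (fst z) (snd z)) \<partial>(\<mu> \<Otimes>\<^sub>M \<mu>))"

definition borel_prob :: "'a::euclidean_space measure \<Rightarrow> bool" where
  "borel_prob \<mu> \<longleftrightarrow> prob_space \<mu> \<and> sets \<mu> = sets borel"

definition equilibrium_measure :: "('a::euclidean_space \<Rightarrow> real) \<Rightarrow> 'a measure \<Rightarrow> bool" where
  "equilibrium_measure Q \<mu> \<longleftrightarrow>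
     borel_prob \<mu> \<and> (\<forall>\<nu>. borel_prob \<nu> \<longrightarrow> energyQ Q \<mu> \<le> energyQ Q \<nu>)"

definition jdens :: "('a::euclidean_space \<Rightarrow> real) \<Rightarrow> nat \<Rightarrow> (nat \<Rightarrow> 'a) \<Rightarrow> real" where
  "jdens Q n y = exp (- real n * (\<Sum>j<n. Q (y j))) *
     (\<Prod>i<n. \<Prod>j\<in>{i<..<n}. (norm (y i - y j))\<^sup>2)"

definition Dn :: "('a::euclidean_space \<Rightarrow> real) \<Rightarrow> nat \<Rightarrow> real" where
  "Dn Q n = 1 / (\<integral> y. jdens Q n y \<partial>(\<Pi>\<^sub>M j\<in>{..<n}. (lborel :: 'a measure)))"

definition Rkn :: "('a::euclidean_space \<Rightarrow> real) \<Rightarrow> nat \<Rightarrow> nat \<Rightarrow> (nat \<Rightarrow> 'a) \<Rightarrow> real" where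
  "Rkn Q k n y = Dn Q n *
     (\<integral> z. jdens Q n (merge {..<k} {k..<n} (y, z)) \<partial>(\<Pi>\<^sub>M j\<in>{k..<n}. (lborel :: 'a measure)))"

end

theory Submission
  imports Defs "HOL-Real_Asymp.Real_Asymp"
begin

text \<open>
  Fix a Gaussian \<open>g(x) = exp(-t|x - z|\<^sup>2)\<close>. The point is that the empirical average of \<open>g\<close> concentrates
  at \<open>\<integral>g d\<mu>\<close>. Its squared discrepancy is controlled by the excess logarithmic energy of the configuration:
  by Frullani's formula the truncated kernel \<open>-\<onehalf> ln(r\<^sup>2 + \<eta>)\<close> is a mixture of Gaussians up to a constant, so its
  energy is positive definite on neutral charges. The equilibrium measure is smoothed at scale \<open>s\<close>; this does not
  increase its logarithmic energy, and it makes the Euler--Lagrange inequality valid at every point. The mean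
  excess energy is \<open>o(n\<^sup>2)\<close>, because a Jensen lower bound for the partition function matches the
  upper bound given by nonnegativity of relative entropy. Exchangeability then factorizes the expectation of
  \<open>g\<^sub>1(y\<^sub>1) ... g\<^sub>k(y\<^sub>k)\<close>, and products of Gaussians determine weak convergence through Scheffe's lemma.\<close>

section \<open>Gaussian kernels\<close>

text \<open>Empirical measures have atoms, hence infinite logarithmic energy, so the kernel is
  truncated at \<open>\<eta> = \<rho>^4\<close>. This costs \<open>- ln \<eta> / (2 * n)\<close>
  through the n diagonal terms, which vanishes for fixed \<rho>, and an error proportional to \<rho>
  on the smoothed measure, controlled by the singularity \<open>1 / sqrt (norm (x - y))\<close>.
  That is the second purpose of smoothing: a bounded density bounds the integral of this singularity
  uniformly in the base point. Since an integral over t does not see a single Gaussian parameter,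
  the discrepancy is tracked on an interval of length \<theta>. All these parameters stay fixed
  while n grows, and their order matters: the singularity bound depends on s, so \<rho> comes after
  s. The density carries n copies of Q per point, of which n - 1 belong to the pair energy; the last
  one gives the entropy a reference measure of finite mass.\<close>

definition gauss :: "real \<Rightarrow> 'a::euclidean_space \<Rightarrow> real" where
  "gauss t x = exp (- t * (norm x)\<^sup>2)"

lemma gauss_pos: "0 < gauss t x" and gauss_nonneg [simp]: "0 \<le> gauss t x"
  and gauss_minus: "gauss t (x - y) = gauss t (y - x)" and gauss_0 [simp]: "gauss t 0 = 1"
  by (simp_all add: gauss_def norm_minus_commute)

lemma gauss_le_1: "t \<ge> 0 \<Longrightarrow> gauss t x \<le> 1"
  by (simp add: gauss_def)

lemma measurable_gauss [measurable]: "gauss t \<in> borel_measurable borel"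
  unfolding gauss_def by measurable

text \<open>An integrable majorant that factorizes over the coordinates, so that its integral over
  R^d is a product of one-dimensional arctangent integrals and no polar coordinates enter.\<close>

definition cauchy_weight :: "'a::euclidean_space \<Rightarrow> real" where
  "cauchy_weight x = (\<Prod>b\<in>Basis. 1 / (1 + (x \<bullet> b)\<^sup>2))"

lemma nn_integral_inverse_1_plus_square:
  "(\<integral>\<^sup>+x. ennreal (1 / (1 + x\<^sup>2)) \<partial>lborel) = ennreal pi"
proof -
  have "(\<integral>\<^sup>+x. ennreal (1 / (1 + x\<^sup>2)) * indicator {0..} x \<partial>lborel) = ennreal (pi/2 - arctan 0)"
  proof (rule nn_integral_FTC_atLeast)
    show "(arctan has_real_derivative 1 / (1 + x\<^sup>2)) (at x)" for x
      using DERIV_arctan[of x] by (simp add: inverse_eq_divide)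
  qed (auto intro: tendsto_arctan_at_top)
  then have A: "(\<integral>\<^sup>+x. ennreal (1 / (1 + x\<^sup>2)) * indicator {0..} x \<partial>lborel) = ennreal (pi/2)"
    by simp
  have B: "(\<integral>\<^sup>+x. ennreal (1 / (1 + x\<^sup>2)) * indicator {..<0} x \<partial>lborel) = ennreal (pi/2)"
  proof -
    have "(\<integral>\<^sup>+x. ennreal (1 / (1 + x\<^sup>2)) * indicator {..<0} x \<partial>lborel) =
      (\<integral>\<^sup>+x. ennreal (1 / (1 + x\<^sup>2)) * indicator {..<0} x \<partial>(distr lborel borel uminus :: real measure))"
      by (simp add: lborel_distr_uminus)
    also have "\<dots> = (\<integral>\<^sup>+x. ennreal (1 / (1 + x\<^sup>2)) * indicator {0..} x \<partial>lborel)"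
      by (subst nn_integral_distr, simp, simp, rule nn_integral_cong_AE, use AE_lborel_singleton[of "0::real"] in eventually_elim)
         (auto split: split_indicator)
    finally show ?thesis using A by simp
  qed
  have "(\<integral>\<^sup>+x. ennreal (1 / (1 + x\<^sup>2)) \<partial>lborel) =
    (\<integral>\<^sup>+x. ennreal (1 / (1 + x\<^sup>2)) * indicator {0..} x + ennreal (1 / (1 + x\<^sup>2)) * indicator {..<0} x \<partial>lborel)"
    by (rule nn_integral_cong) (auto split: split_indicator)
  also have "\<dots> = ennreal (pi/2) + ennreal (pi/2)"
    by (subst nn_integral_add) (auto simp: A B)
  also have "\<dots> = ennreal pi" by (simp flip: ennreal_plus)
  finally show ?thesis .
qed

lemma cauchy_weight_pos: "0 < cauchy_weight x"
  unfolding cauchy_weight_def by (intro prod_pos) (auto intro!: divide_pos_pos add_pos_nonneg)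

lemma measurable_cauchy_weight [measurable]: "cauchy_weight \<in> borel_measurable borel"
  unfolding cauchy_weight_def by measurable

lemma integrable_cauchy_weight: "integrable lborel (cauchy_weight :: 'a::euclidean_space \<Rightarrow> real)"
proof -
  have "(\<integral>\<^sup>+x. ennreal (norm (cauchy_weight x)) \<partial>(lborel :: 'a measure))
    = (\<integral>\<^sup>+x. (\<Prod>b\<in>Basis. ennreal (1 / (1 + (x \<bullet> b)\<^sup>2))) \<partial>(lborel :: 'a measure))"
    using cauchy_weight_pos
    by (intro nn_integral_cong) (auto simp: cauchy_weight_def prod_ennreal less_imp_le prod_nonneg)
  also have "\<dots> = (\<Prod>b\<in>(Basis::'a set). (\<integral>\<^sup>+x. ennreal (1 / (1 + x\<^sup>2)) \<partial>lborel))"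
    using nn_integral_lborel_prod[of "\<lambda>(_::'a) x. 1 / (1 + x\<^sup>2)"] by simp
  also have "\<dots> < \<infinity>"
    by (simp add: nn_integral_inverse_1_plus_square ennreal_power less_top[symmetric])
  finally show ?thesis by (intro integrableI_bounded) auto
qed

text \<open>Every coordinate is at most \<open>norm x\<close> in absolute value, so each of the d
  factors is at least the inverse square of \<open>1 + norm x\<close>. This is the origin of the
  exponent \<open>2 * DIM('a)\<close> in the decay conditions below.\<close>

lemma cauchy_weight_lower: "1 / (1 + norm x) ^ (2 * DIM('a)) \<le> cauchy_weight (x :: 'a::euclidean_space)"
proof -
  have "(\<Prod>b\<in>(Basis::'a set). 1 / (1 + norm x)^2) \<le> cauchy_weight x"
    unfolding cauchy_weight_def
  proof (intro prod_mono conjI)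
    fix b :: 'a assume "b \<in> Basis"
    then have "(x \<bullet> b)\<^sup>2 \<le> (norm x)^2"
      by (metis Basis_le_norm abs_le_square_iff abs_norm_cancel)
    then have "1 + (x \<bullet> b)\<^sup>2 \<le> (1 + norm x)^2" by (simp add: power2_sum add_increasing2)
    then show "1 / (1 + norm x)^2 \<le> 1 / (1 + (x \<bullet> b)\<^sup>2)"
      by (intro divide_left_mono mult_pos_pos zero_less_power add_pos_nonneg) auto
  qed auto
  then show ?thesis by (simp add: power_divide power_mult)
qed

text \<open>Domination by a multiple of \<open>cauchy_weight\<close>. The criterion serves the
  Gaussian, its first moment and, later, \<open>exp (- Q x)\<close>.\<close>

lemma integrable_norm_bounded:
  fixes f :: "'a::euclidean_space \<Rightarrow> real"
  assumes [measurable]: "f \<in> borel_measurable borel"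
    and bd: "\<And>x. \<bar>f x\<bar> * (1 + norm x) ^ (2 * DIM('a)) \<le> C"
  shows "integrable lborel f"
proof (rule Bochner_Integration.integrable_bound)
  show "integrable lborel (\<lambda>x::'a. C * cauchy_weight x)"
    using integrable_cauchy_weight[where 'a='a] by simp
  have C: "C \<ge> 0" using bd[of 0] by simp
  show "AE x in lborel. norm (f x) \<le> norm (C * cauchy_weight x)"
  proof (rule AE_I2)
    fix x :: 'a
    have p: "(1 + norm x) ^ (2 * DIM('a)) > 0" by (simp add: add_pos_nonneg)
    have "\<bar>f x\<bar> \<le> C * (1 / (1 + norm x) ^ (2 * DIM('a)))"
      using bd[of x] p by (simp add: field_simps)
    also have "\<dots> \<le> C * cauchy_weight x" using cauchy_weight_lower C by (intro mult_left_mono)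
    finally show "norm (f x) \<le> norm (C * cauchy_weight x)" by simp
  qed
qed auto

lemma power_exp_bounded:
  fixes c :: real
  assumes "c > 0" shows "\<exists>C. \<forall>r\<ge>0. (1 + r) ^ m * exp (- c * r\<^sup>2) \<le> C"
proof -
  have "((\<lambda>r::real. (1 + r) ^ m * exp (- c * r\<^sup>2)) \<longlongrightarrow> 0) at_top"
    using assms by real_asymp
  then have "\<forall>\<^sub>F r in at_top. (1 + r) ^ m * exp (- c * r\<^sup>2) < (1::real)"
    by (rule order_tendstoD) simp
  then obtain R where R: "\<And>r. r \<ge> R \<Longrightarrow> (1 + r) ^ m * exp (- c * r\<^sup>2) < (1::real)"
    by (auto simp: eventually_at_top_linorder)
  have "(1 + r) ^ m * exp (- c * r\<^sup>2) \<le> max 1 ((1 + \<bar>R\<bar>)^m)" if "r \<ge> 0" for r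
  proof (cases "r \<ge> R")
    case False
    then have "(1 + r) ^ m * exp (- c * r\<^sup>2) \<le> (1 + \<bar>R\<bar>)^m * 1"
      using that assms by (intro mult_mono power_mono) auto
    then show ?thesis by auto
  next
    case True
    show ?thesis using R[OF True] by linarith
  qed
  then show ?thesis by blast
qed

lemma integrable_gauss:
  assumes "t > 0" shows "integrable lborel (gauss t :: 'a::euclidean_space \<Rightarrow> real)"
proof -
  obtain C where "\<And>r. r \<ge> 0 \<Longrightarrow> (1 + r) ^ (2 * DIM('a)) * exp (- t * r\<^sup>2) \<le> C"
    using power_exp_bounded[OF assms] by metis
  then show ?thesis by (intro integrable_norm_bounded[where C=C]) (auto simp: gauss_def mult.commute)
qed

lemma integrable_norm_gauss:
  assumes "t > 0" shows "integrable lborel (\<lambda>x :: 'a::euclidean_space. norm x * gauss t x)"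
proof -
  obtain C where C: "\<And>r. r \<ge> 0 \<Longrightarrow> (1 + r) ^ (Suc (2 * DIM('a))) * exp (- t * r\<^sup>2) \<le> C"
    using power_exp_bounded[OF assms] by metis
  show ?thesis
  proof (rule integrable_norm_bounded[where C=C])
    fix x :: 'a
    have "\<bar>norm x * gauss t x\<bar> * (1 + norm x) ^ (2 * DIM('a)) = norm x * ((1 + norm x) ^ (2 * DIM('a)) * exp (- t * (norm x)\<^sup>2))"
      by (simp add: gauss_def)
    also have "\<dots> \<le> (1 + norm x) * ((1 + norm x) ^ (2 * DIM('a)) * exp (- t * (norm x)\<^sup>2))"
      by (intro mult_right_mono) auto
    also have "\<dots> \<le> C" using C[of "norm x"] by (simp add: mult.assoc)
    finally show "\<bar>norm x * gauss t x\<bar> * (1 + norm x) ^ (2 * DIM('a)) \<le> C" .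
  qed measurable
qed

text \<open>The type argument carries the dimension, on which the value depends.\<close>

definition gauss_mass :: "'a::euclidean_space itself \<Rightarrow> real \<Rightarrow> real" where
  "gauss_mass _ t = (\<integral>x. gauss t (x::'a) \<partial>lborel)"

lemma gauss_mass_pos: "t > 0 \<Longrightarrow> gauss_mass TYPE('a::euclidean_space) t > 0"
proof -
  assume t: "t > 0"
  have "gauss_mass TYPE('a) t \<noteq> 0"
  proof
    assume "gauss_mass TYPE('a) t = 0"
    then have "AE x::'a in lborel. gauss t x = 0"
      using integral_nonneg_eq_0_iff_AE[OF integrable_gauss[OF t, where 'a='a]] by (simp add: gauss_mass_def)
    then have "AE x::'a in lborel. False" using gauss_pos[of t] by (auto simp: less_le)
    then show False using ae_filter_eq_bot_iff[of "lborel::'a measure"]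
      by (simp add: trivial_limit_def)
  qed
  moreover have "gauss_mass TYPE('a) t \<ge> 0" unfolding gauss_mass_def by (rule Bochner_Integration.integral_nonneg) simp
  ultimately show ?thesis by linarith
qed

lemma lborel_shift:
  fixes f :: "'a::euclidean_space \<Rightarrow> 'b::{banach, second_countable_topology}"
  assumes [measurable]: "f \<in> borel_measurable borel"
  shows "(\<integral>x. f (x + a) \<partial>lborel) = (\<integral>x. f x \<partial>lborel)"
    "integrable lborel f \<Longrightarrow> integrable lborel (\<lambda>x. f (x + a))"
proof -
  have e: "lborel = (distr lborel borel (\<lambda>x. x + a) :: 'a measure)"
    unfolding add.commute[of _ a] by (rule lborel_distr_plus[symmetric])
  show "(\<integral>x. f (x + a) \<partial>lborel) = (\<integral>x. f x \<partial>lborel)"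
    by (subst (2) e, subst integral_distr) auto
  show "integrable lborel f \<Longrightarrow> integrable lborel (\<lambda>x. f (x + a))"
    by (subst (asm) e, subst (asm) integrable_distr_eq) auto
qed

lemma nn_lborel_shift:
  fixes f :: "'a::euclidean_space \<Rightarrow> ennreal"
  assumes [measurable]: "f \<in> borel_measurable borel"
  shows "(\<integral>\<^sup>+x. f (x + a) \<partial>lborel) = (\<integral>\<^sup>+x. f x \<partial>lborel)"
proof -
  have e: "lborel = (distr lborel borel (\<lambda>x. x + a) :: 'a measure)"
    unfolding add.commute[of _ a] by (rule lborel_distr_plus[symmetric])
  show ?thesis by (subst (2) e, subst nn_integral_distr) auto
qed

lemma gauss_shift:
  assumes "t > 0"
  shows "integrable lborel (\<lambda>x::'a::euclidean_space. gauss t (x - a))"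
    "(\<integral>x. gauss t (x - a) \<partial>lborel) = gauss_mass TYPE('a) t"
    "(\<integral>\<^sup>+x. gauss t (x - a) \<partial>lborel) = gauss_mass TYPE('a) t"
proof -
  show i: "integrable lborel (\<lambda>x::'a. gauss t (x - a))"
    using lborel_shift(2)[of "gauss t" "-a"] integrable_gauss[OF assms] by simp
  show e: "(\<integral>x. gauss t (x - a) \<partial>lborel) = gauss_mass TYPE('a) t"
    using lborel_shift(1)[of "gauss t" "-a"] by (simp add: gauss_mass_def)
  show "(\<integral>\<^sup>+x. gauss t (x - a) \<partial>lborel) = gauss_mass TYPE('a) t"
    using nn_integral_eq_integral[OF i] e by simp
qed

text \<open>The parallelogram identity around the midpoint of x and y. As a function of w the
  product is a Gaussian about the midpoint, so the kernel of parameter t is, up to a constant, an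
  overlap integral of two kernels of parameter 2 t.\<close>

lemma gauss_product:
  "gauss (2*t) (x - w) * gauss (2*t) (y - w) = gauss t (x - y) * gauss (4*t) (w - (1/2) *\<^sub>R (x + y))"
proof -
  have "2 * (norm (x - w))\<^sup>2 + 2 * (norm (y - w))\<^sup>2 = (norm (x - y))\<^sup>2 + 4 * (norm (w - (1/2) *\<^sub>R (x + y)))\<^sup>2"
    by (simp add: power2_norm_eq_inner algebra_simps inner_commute)
  then have "t * (2 * (norm (x - w))\<^sup>2 + 2 * (norm (y - w))\<^sup>2) = t * ((norm (x - y))\<^sup>2 + 4 * (norm (w - (1/2) *\<^sub>R (x + y)))\<^sup>2)"
    by simp
  then show ?thesis unfolding gauss_def by (simp add: algebra_simps flip: exp_add)
qed

lemma gauss_convolution: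
  fixes x y :: "'a::euclidean_space"
  assumes "t > 0"
  shows "(\<integral>\<^sup>+w. ennreal (gauss (2*t) (x - w)) * ennreal (gauss (2*t) (y - w)) \<partial>lborel)
     = ennreal (gauss t (x - y)) * ennreal (gauss_mass TYPE('a) (4*t))"
proof -
  have "(\<integral>\<^sup>+w. ennreal (gauss (2*t) (x - w)) * ennreal (gauss (2*t) (y - w)) \<partial>lborel)
    = (\<integral>\<^sup>+w. ennreal (gauss t (x - y)) * ennreal (gauss (4*t) (w - (1/2) *\<^sub>R (x + y))) \<partial>lborel)"
    by (simp add: gauss_product flip: ennreal_mult)
  also have "\<dots> = ennreal (gauss t (x - y)) * ennreal (gauss_mass TYPE('a) (4*t))"
    using assms by (subst nn_integral_cmult) (auto simp: gauss_shift)
  finally show ?thesis .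
qed

lemma borel_probD:
  assumes "borel_prob p"
  shows "prob_space p" "sets p = sets borel" "space p = UNIV"
  using assms sets_eq_imp_space_eq[of p borel] by (auto simp: borel_prob_def)

section \<open>Gaussian energies and their positive definiteness\<close>

definition gauss_energy :: "real \<Rightarrow> 'a::euclidean_space measure \<Rightarrow> 'a measure \<Rightarrow> real" where
  "gauss_energy t p q = (\<integral>x. \<integral>y. gauss t (x - y) \<partial>q \<partial>p)"

definition gauss_pot :: "real \<Rightarrow> 'a::euclidean_space measure \<Rightarrow> 'a \<Rightarrow> real" where
  "gauss_pot t p w = (\<integral>x. gauss t (x - w) \<partial>p)"

lemma (in prob_space) integrable_unit_bounded:
  fixes f :: "'a \<Rightarrow> real"
  assumes "f \<in> borel_measurable M" "\<And>x. 0 \<le> f x" "\<And>x. f x \<le> 1"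
  shows "integrable M f" "(\<integral>x. f x \<partial>M) \<le> 1" "0 \<le> (\<integral>x. f x \<partial>M)"
    "(\<integral>\<^sup>+x. ennreal (f x) \<partial>M) = ennreal (\<integral>x. f x \<partial>M)"
proof -
  show i: "integrable M f"
    using assms by (intro integrable_const_bound[where B=1]) auto
  show "(\<integral>x. f x \<partial>M) \<le> 1"
    using integral_mono[OF i, of "\<lambda>_. 1"] assms(3) prob_space by simp
  show "0 \<le> (\<integral>x. f x \<partial>M)" using assms by simp
  show "(\<integral>\<^sup>+x. ennreal (f x) \<partial>M) = ennreal (\<integral>x. f x \<partial>M)"
    using nn_integral_eq_integral[OF i] assms by simp
qed

context
  fixes p :: "'a::euclidean_space measure"
  assumes p: "borel_prob p"
begin

lemma gauss_pot_props:
  assumes "t \<ge> 0"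
  shows "integrable p (\<lambda>x. gauss t (x - w))" "gauss_pot t p w \<le> 1" "0 \<le> gauss_pot t p w"
    "(\<integral>\<^sup>+x. ennreal (gauss t (x - w)) \<partial>p) = ennreal (gauss_pot t p w)"
proof -
  interpret prob_space p using p by (rule borel_probD)
  note [measurable_cong] = borel_probD(2)[OF p]
  have [measurable]: "(\<lambda>x. gauss t (x - w)) \<in> borel_measurable p" by measurable
  show "integrable p (\<lambda>x. gauss t (x - w))" "gauss_pot t p w \<le> 1" "0 \<le> gauss_pot t p w"
    "(\<integral>\<^sup>+x. ennreal (gauss t (x - w)) \<partial>p) = ennreal (gauss_pot t p w)"
    unfolding gauss_pot_def
    using integrable_unit_bounded[of "\<lambda>x. gauss t (x - w)"] gauss_le_1[OF assms] by auto
qed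

lemma measurable_gauss_pot [measurable]: "gauss_pot t p \<in> borel_measurable borel"
proof -
  interpret prob_space p using p by (rule borel_probD)
  note [measurable_cong] = borel_probD(2)[OF p]
  show ?thesis unfolding gauss_pot_def by measurable
qed

lemma gauss_energy_alt: "gauss_energy t p q = (\<integral>x. gauss_pot t q x \<partial>p)"
  unfolding gauss_energy_def gauss_pot_def by (simp add: gauss_minus)

lemma gauss_energy_props:
  assumes "borel_prob q" "t \<ge> 0"
  shows "integrable p (gauss_pot t q)" "gauss_energy t p q \<le> 1" "0 \<le> gauss_energy t p q"
    "(\<integral>\<^sup>+x. \<integral>\<^sup>+y. ennreal (gauss t (x - y)) \<partial>q \<partial>p) = ennreal (gauss_energy t p q)"
proof -
  interpret prob_space p using p by (rule borel_probD)
  note [measurable_cong] = borel_probD(2)[OF p]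
  have [measurable]: "gauss_pot t q \<in> borel_measurable borel"
  proof -
    interpret q: prob_space q using assms by (intro borel_probD)
    note [measurable_cong] = borel_probD(2)[OF assms(1)]
    show ?thesis unfolding gauss_pot_def by measurable
  qed
  have *: "gauss_pot t q w \<le> 1" "0 \<le> gauss_pot t q w"
    "(\<integral>\<^sup>+x. ennreal (gauss t (x - w)) \<partial>q) = ennreal (gauss_pot t q w)" for w
  proof -
    interpret q: prob_space q using assms by (intro borel_probD)
    note [measurable_cong] = borel_probD(2)[OF assms(1)]
    have [measurable]: "(\<lambda>x. gauss t (x - w)) \<in> borel_measurable q" by measurable
    show "gauss_pot t q w \<le> 1" "0 \<le> gauss_pot t q w"
      "(\<integral>\<^sup>+x. ennreal (gauss t (x - w)) \<partial>q) = ennreal (gauss_pot t q w)"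
      unfolding gauss_pot_def
      using q.integrable_unit_bounded[of "\<lambda>x. gauss t (x - w)"] gauss_le_1[OF assms(2)] by auto
  qed
  show "integrable p (gauss_pot t q)" "gauss_energy t p q \<le> 1" "0 \<le> gauss_energy t p q"
    "(\<integral>\<^sup>+x. \<integral>\<^sup>+y. ennreal (gauss t (x - y)) \<partial>q \<partial>p) = ennreal (gauss_energy t p q)"
    unfolding gauss_energy_alt using integrable_unit_bounded[of "gauss_pot t q"] *
    by (auto simp: gauss_minus[of _ "_::'a"])
qed

end

text \<open>An explicit feature map: by \<open>gauss_convolution\<close> and Tonelli the Gaussian
  energy is, up to a positive constant, the L2 inner product of the potentials of parameter 2 t.
  Positive definiteness becomes positivity of an L2 norm, with no Fourier transform.\<close>

lemma gauss_energy_features: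
  fixes p q :: "'a::euclidean_space measure"
  assumes p: "borel_prob p" and q: "borel_prob q" and t: "t > 0"
  shows "integrable lborel (\<lambda>w. gauss_pot (2*t) p w * gauss_pot (2*t) q w)"
    "(\<integral>w. gauss_pot (2*t) p w * gauss_pot (2*t) q w \<partial>lborel) = gauss_mass TYPE('a) (4*t) * gauss_energy t p q"
proof -
  interpret p: prob_space p using p by (rule borel_probD)
  interpret q: prob_space q using q by (rule borel_probD)
  note [measurable_cong] = borel_probD(2)[OF p] borel_probD(2)[OF q]
  have [measurable]: "gauss_pot (2*t) p \<in> borel_measurable borel" "gauss_pot (2*t) q \<in> borel_measurable borel"
    using p q by (auto intro: measurable_gauss_pot)
  interpret pl: pair_sigma_finite p lborel ..
  interpret ql: pair_sigma_finite q lborel ..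
  have "(\<integral>\<^sup>+w. ennreal (gauss_pot (2*t) p w * gauss_pot (2*t) q w) \<partial>lborel)
     = (\<integral>\<^sup>+w. (\<integral>\<^sup>+x. ennreal (gauss (2*t) (x - w)) \<partial>p) * (\<integral>\<^sup>+y. ennreal (gauss (2*t) (y - w)) \<partial>q) \<partial>lborel)"
    using t p q by (simp add: gauss_pot_props ennreal_mult)
  also have "\<dots> = (\<integral>\<^sup>+w. \<integral>\<^sup>+x. ennreal (gauss (2*t) (x - w)) * (\<integral>\<^sup>+y. ennreal (gauss (2*t) (y - w)) \<partial>q) \<partial>p \<partial>lborel)"
    by (subst nn_integral_multc) auto
  also have "\<dots> = (\<integral>\<^sup>+x. \<integral>\<^sup>+w. ennreal (gauss (2*t) (x - w)) * (\<integral>\<^sup>+y. ennreal (gauss (2*t) (y - w)) \<partial>q) \<partial>lborel \<partial>p)"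
    by (rule pl.Fubini') measurable
  also have "\<dots> = (\<integral>\<^sup>+x. \<integral>\<^sup>+w. \<integral>\<^sup>+y. ennreal (gauss (2*t) (x - w)) * ennreal (gauss (2*t) (y - w)) \<partial>q \<partial>lborel \<partial>p)"
    by (subst nn_integral_cmult) auto
  also have "\<dots> = (\<integral>\<^sup>+x. \<integral>\<^sup>+y. \<integral>\<^sup>+w. ennreal (gauss (2*t) (x - w)) * ennreal (gauss (2*t) (y - w)) \<partial>lborel \<partial>q \<partial>p)"
    by (intro nn_integral_cong, rule ql.Fubini') measurable
  also have "\<dots> = (\<integral>\<^sup>+x. \<integral>\<^sup>+y. ennreal (gauss t (x - y)) * ennreal (gauss_mass TYPE('a) (4*t)) \<partial>q \<partial>p)"
    using t by (simp add: gauss_convolution)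
  also have "\<dots> = (\<integral>\<^sup>+x. \<integral>\<^sup>+y. ennreal (gauss t (x - y)) \<partial>q \<partial>p) * ennreal (gauss_mass TYPE('a) (4*t))"
    by (simp add: nn_integral_multc)
  also have "\<dots> = ennreal (gauss_mass TYPE('a) (4*t) * gauss_energy t p q)"
    using t p q gauss_mass_pos[of "4*t", where 'a='a]
    by (simp add: gauss_energy_props mult.commute ennreal_mult)
  finally have *: "(\<integral>\<^sup>+w. ennreal (gauss_pot (2*t) p w * gauss_pot (2*t) q w) \<partial>lborel)
    = ennreal (gauss_mass TYPE('a) (4*t) * gauss_energy t p q)" .
  have "has_bochner_integral lborel (\<lambda>w. gauss_pot (2*t) p w * gauss_pot (2*t) q w) (gauss_mass TYPE('a) (4*t) * gauss_energy t p q)"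
    using p q t gauss_mass_pos[of "4*t", where 'a='a]
    by (intro has_bochner_integral_nn_integral[OF _ _ _ *]) (auto intro!: AE_I2 mult_nonneg_nonneg gauss_pot_props gauss_energy_props)
  then show "integrable lborel (\<lambda>w. gauss_pot (2*t) p w * gauss_pot (2*t) q w)"
    "(\<integral>w. gauss_pot (2*t) p w * gauss_pot (2*t) q w \<partial>lborel) = gauss_mass TYPE('a) (4*t) * gauss_energy t p q"
    by (auto simp: has_bochner_integral_iff)
qed

text \<open>Cauchy--Schwarz in the reproducing kernel space of the Gaussian, obtained by testing
  positive definiteness on \<open>p - q - c \<delta>\<^sub>z\<close> with the optimal \<open>c\<close>.\<close>

lemma gauss_energy_cauchy_schwarz:
  fixes p q :: "'a::euclidean_space measure"
  assumes p: "borel_prob p" and q: "borel_prob q" and t: "t > 0"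
  shows "(gauss_pot t p z - gauss_pot t q z)\<^sup>2 \<le> gauss_energy t p p + gauss_energy t q q - 2 * gauss_energy t p q"
proof -
  define d where "d = return (borel :: 'a measure) z"
  have d: "borel_prob d" by (simp add: d_def borel_prob_def prob_space_return)
  have Ed: "gauss_energy t r d = gauss_pot t r z" if "borel_prob r" for r
    unfolding gauss_energy_def gauss_pot_def d_def by (subst integral_return) auto
  have Edd: "gauss_energy t d d = 1"
    unfolding Ed[OF d] unfolding gauss_pot_def d_def by (subst integral_return) auto
  \<comment> \<open>The kernel is 1 on the diagonal, so a point mass with coefficient b contributes
    b^2 - 2 b c to the quadratic form; the choice b = c minimizes this and gives - c^2.\<close>
  define c where "c = gauss_pot t p z - gauss_pot t q z"
  define F where "F = gauss_pot (2*t) p"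
  define G where "G = gauss_pot (2*t) q"
  define D where "D = gauss_pot (2*t) d"
  define m where "m = gauss_mass TYPE('a) (4*t)"
  have m: "m > 0" using gauss_mass_pos[of "4*t", where 'a='a] t by (simp add: m_def)
  note f = gauss_energy_features[OF _ _ t, folded m_def]
  note fi = f(1)[OF p p, folded F_def] f(1)[OF q q, folded G_def] f(1)[OF d d, folded D_def]
    f(1)[OF p q, folded F_def G_def] f(1)[OF p d, folded F_def D_def] f(1)[OF q d, folded G_def D_def]
  note fe = f(2)[OF p p, folded F_def] f(2)[OF q q, folded G_def] f(2)[OF d d, folded D_def]
    f(2)[OF p q, folded F_def G_def] f(2)[OF p d, folded F_def D_def] f(2)[OF q d, folded G_def D_def]
  have "0 \<le> (\<integral>w. (F w - G w - c * D w)\<^sup>2 \<partial>lborel)" by (rule Bochner_Integration.integral_nonneg) simp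
  also have "\<dots> = (\<integral>w. F w * F w + G w * G w + c\<^sup>2 * (D w * D w) - 2 * (F w * G w)
      - 2 * c * (F w * D w) + 2 * c * (G w * D w) \<partial>lborel)"
    by (rule Bochner_Integration.integral_cong) (auto simp: power2_eq_square algebra_simps)
  also have "\<dots> = m * (gauss_energy t p p + gauss_energy t q q + c\<^sup>2 - 2 * gauss_energy t p q
      - 2 * c * gauss_pot t p z + 2 * c * gauss_pot t q z)"
    unfolding F_def G_def D_def
    by (simp add: fi[unfolded F_def G_def D_def] fe[unfolded F_def G_def D_def] Ed p q Edd)
      (simp add: m_def algebra_simps)
  finally have "0 \<le> gauss_energy t p p + gauss_energy t q q + c\<^sup>2 - 2 * gauss_energy t p q
      - 2 * c * gauss_pot t p z + 2 * c * gauss_pot t q z"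
    using m by (simp add: zero_le_mult_iff)
  also have "\<dots> = gauss_energy t p p + gauss_energy t q q - 2 * gauss_energy t p q - c\<^sup>2"
    by (simp add: c_def power2_eq_square algebra_simps)
  finally show ?thesis by (simp add: c_def)
qed

text \<open>With u the squared distance, exp(-su) - exp(-tu) is at most (t - s) u exp(-su), and r
  exp(-r) \<le> 1 for r = s u removes u. The bound is therefore uniform in the centre and in the
  measure, and a discrepancy found at one parameter persists on an interval of parameters.\<close>

lemma gauss_pot_perturb:
  fixes p :: "'a::euclidean_space measure"
  assumes p: "borel_prob p" and s: "0 < s" "s \<le> t"
  shows "\<bar>gauss_pot t p z - gauss_pot s p z\<bar> \<le> (t - s) / s"
proof -
  interpret prob_space p using p by (rule borel_probD)
  have b: "\<bar>gauss t x - gauss s x\<bar> \<le> (t - s) / s" for x :: 'a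
  proof -
    define u where "u = (norm x)\<^sup>2"
    have u: "u \<ge> 0" by (simp add: u_def)
    have "1 + - ((t - s) * u) \<le> exp (- ((t - s) * u))" by (rule exp_ge_add_one_self)
    then have "exp (- (s * u)) * (1 - exp (- ((t - s) * u))) \<le> exp (- (s * u)) * ((t - s) * u)"
      by (intro mult_left_mono) auto
    also have "\<dots> = (t - s) / s * ((s * u) * exp (- (s * u)))" using s by simp
    also have "\<dots> \<le> (t - s) / s * 1"
    proof (intro mult_left_mono)
      have "s * u \<le> exp (s * u)" using exp_ge_add_one_self[of "s * u"] by linarith
      then show "s * u * exp (- (s * u)) \<le> 1" by (simp add: exp_minus field_simps)
    qed (use s in auto)
    finally have "exp (- (s * u)) - exp (- (t * u)) \<le> (t - s) / s"
      by (simp add: algebra_simps flip: exp_add)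
    moreover have "exp (- (t * u)) \<le> exp (- (s * u))" using s u by (simp add: mult_right_mono)
    ultimately show ?thesis by (simp add: gauss_def u_def)
  qed
  have i: "integrable p (\<lambda>x. gauss t (x - z))" "integrable p (\<lambda>x. gauss s (x - z))"
    using s by (auto intro!: gauss_pot_props[OF p])
  have "\<bar>gauss_pot t p z - gauss_pot s p z\<bar> = \<bar>\<integral>x. gauss t (x - z) - gauss s (x - z) \<partial>p\<bar>"
    unfolding gauss_pot_def using i by simp
  also have "\<dots> \<le> (\<integral>x. \<bar>gauss t (x - z) - gauss s (x - z)\<bar> \<partial>p)" by (rule integral_abs_bound)
  also have "\<dots> \<le> (\<integral>x. (t - s) / s \<partial>p)"
    using i b by (intro integral_mono) auto
  finally show ?thesis using prob_space by simp
qed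

section \<open>Truncated logarithmic energy\<close>

text \<open>The quotient (1 - exp(-tb)) / t is the integral of exp(-tu) over u in [0, b]. After
  exchanging the integrals, the one over t gives 1 / (2 (\<eta> + u)), whose primitive in u is half
  a logarithm.\<close>

lemma frullani:
  fixes b \<eta> :: real
  assumes b: "b \<ge> 0" and \<eta>: "\<eta> > 0"
  shows "(\<integral>\<^sup>+t. ennreal (exp (- t * \<eta>) / (2 * t) * (1 - exp (- t * b))) * indicator {0<..} t \<partial>lborel)
    = ennreal (ln (1 + b / \<eta>) / 2)"
proof -
  have 1: "ennreal (exp (- t * \<eta>) / (2 * t) * (1 - exp (- t * b))) * indicator {0<..} t
    = (\<integral>\<^sup>+u. ennreal (exp (- t * (\<eta> + u)) / 2) * indicator {0<..} t * indicator {0..b} u \<partial>lborel)" for t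
  proof (cases "t > 0")
    case True
    have "(\<integral>\<^sup>+u. ennreal (exp (- t * (\<eta> + u)) / 2) * indicator {0..b} u \<partial>lborel)
      = ennreal ((- exp (- t * (\<eta> + b)) / (2 * t)) - (- exp (- t * (\<eta> + 0)) / (2 * t)))"
      by (rule nn_integral_FTC_Icc) (use True b in \<open>auto intro!: derivative_eq_intros\<close>)
    also have "\<dots> = ennreal (exp (- t * \<eta>) / (2 * t) * (1 - exp (- t * b)))"
      using True by (intro arg_cong[where f=ennreal]) (simp add: field_simps flip: exp_add)
    finally show ?thesis using True by simp
  qed simp
  have 2: "(\<integral>\<^sup>+t. ennreal (exp (- t * (\<eta> + u)) / 2) * indicator {0<..} t * indicator {0..b} u \<partial>lborel)
     = ennreal (1 / (2 * (\<eta> + u))) * indicator {0..b} u" for u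
  proof (cases "u \<in> {0..b}")
    case True
    have "(\<integral>\<^sup>+t. ennreal (exp (- t * (\<eta> + u)) / 2) * indicator {0<..} t \<partial>lborel)
      = (\<integral>\<^sup>+t. ennreal (exp (- t * (\<eta> + u)) / 2) * indicator {0..} t \<partial>lborel)"
      using AE_lborel_singleton[of "0::real"]
      by (intro nn_integral_cong_AE) (auto split: split_indicator)
    also have "\<dots> = ennreal (0 - (- exp (- 0 * (\<eta> + u)) / (2 * (\<eta> + u))))"
    proof (rule nn_integral_FTC_atLeast)
      define a where "a = \<eta> + u"
      have a: "a > 0" using True \<eta> by (auto simp: a_def)
      show "((\<lambda>t. - exp (- t * (\<eta> + u)) / (2 * (\<eta> + u))) \<longlongrightarrow> 0) at_top"
        unfolding a_def[symmetric] using a by real_asymp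
      show "((\<lambda>t. - exp (- t * (\<eta> + u)) / (2 * (\<eta> + u))) has_real_derivative exp (- t * (\<eta> + u)) / 2) (at t)" for t
        unfolding a_def[symmetric] using a by (auto intro!: derivative_eq_intros)
    qed auto
    finally show ?thesis using True by simp
  qed simp
  have "(\<integral>\<^sup>+t. ennreal (exp (- t * \<eta>) / (2 * t) * (1 - exp (- t * b))) * indicator {0<..} t \<partial>lborel)
    = (\<integral>\<^sup>+u. \<integral>\<^sup>+t. ennreal (exp (- t * (\<eta> + u)) / 2) * indicator {0<..} t * indicator {0..b} u \<partial>lborel \<partial>lborel)"
    unfolding 1 by (rule lborel_pair.Fubini') measurable
  also have "\<dots> = (\<integral>\<^sup>+u. ennreal (1 / (2 * (\<eta> + u))) * indicator {0..b} u \<partial>lborel)"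
    unfolding 2 ..
  also have "\<dots> = ennreal (ln (\<eta> + b) / 2 - ln (\<eta> + 0) / 2)"
    by (rule nn_integral_FTC_Icc) (use b \<eta> in \<open>auto intro!: derivative_eq_intros simp: field_simps\<close>)
  also have "ln (\<eta> + b) / 2 - ln (\<eta> + 0) / 2 = ln (1 + b / \<eta>) / 2"
  proof -
    have "1 + b / \<eta> = (\<eta> + b) / \<eta>" using \<eta> by (simp add: field_simps)
    then show ?thesis using b \<eta> by (simp add: ln_div diff_divide_distrib)
  qed
  finally show ?thesis .
qed

text \<open>Subtracting the truncated kernel from its value on the diagonal makes the Frullani integrand
  nonnegative, so that all interchanges below are instances of Tonelli's theorem.\<close>

definition log_energy :: "real \<Rightarrow> 'a::euclidean_space measure \<Rightarrow> 'a measure \<Rightarrow> ennreal" where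
  "log_energy \<eta> p q = (\<integral>\<^sup>+x. \<integral>\<^sup>+y. ennreal (ln (1 + (norm (x - y))\<^sup>2 / \<eta>) / 2) \<partial>q \<partial>p)"

lemma nn_integral_one_minus_gauss:
  fixes p q :: "'a::euclidean_space measure"
  assumes p: "borel_prob p" and q: "borel_prob q" and t: "t \<ge> 0"
  shows "(\<integral>\<^sup>+x. \<integral>\<^sup>+y. ennreal (1 - gauss t (x - y)) \<partial>q \<partial>p) = ennreal (1 - gauss_energy t p q)"
proof -
  interpret p: prob_space p using p by (rule borel_probD)
  interpret q: prob_space q using q by (rule borel_probD)
  note [measurable_cong] = borel_probD(2)[OF p] borel_probD(2)[OF q]
  have 1: "(\<integral>\<^sup>+y. ennreal (1 - gauss t (x - y)) \<partial>q) = ennreal (1 - gauss_pot t q x)" for x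
  proof -
    have "(\<integral>\<^sup>+y. ennreal (1 - gauss t (y - x)) \<partial>q) = ennreal (\<integral>y. 1 - gauss t (y - x) \<partial>q)"
      by (rule q.integrable_unit_bounded) (use gauss_le_1[OF t] in auto)
    also have "(\<integral>y. 1 - gauss t (y - x) \<partial>q) = 1 - gauss_pot t q x"
      using gauss_pot_props(1)[OF q t] q.prob_space by (simp add: gauss_pot_def)
    finally show ?thesis by (simp add: gauss_minus)
  qed
  have "(\<integral>\<^sup>+x. ennreal (1 - gauss_pot t q x) \<partial>p) = ennreal (\<integral>x. 1 - gauss_pot t q x \<partial>p)"
    by (rule p.integrable_unit_bounded)
       (use gauss_pot_props[OF q t] measurable_gauss_pot[OF q] in \<open>auto\<close>)
  also have "(\<integral>x. 1 - gauss_pot t q x \<partial>p) = 1 - gauss_energy t p q"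
    using gauss_energy_props(1)[OF p q t] p.prob_space by (simp add: gauss_energy_alt[OF p])
  finally show ?thesis unfolding 1 .
qed

text \<open>The factor \<open>1 - gauss_energy t p q\<close> decreases with the Gaussian energy, so
  an inequality between Gaussian energies that holds for every t passes, reversed, to
  \<open>log_energy\<close>.\<close>

lemma log_energy_frullani:
  fixes p q :: "'a::euclidean_space measure"
  assumes p: "borel_prob p" and q: "borel_prob q" and \<eta>: "\<eta> > 0"
  shows "log_energy \<eta> p q =
    (\<integral>\<^sup>+t. ennreal (exp (- t * \<eta>) / (2 * t) * (1 - gauss_energy t p q)) * indicator {0<..} t \<partial>lborel)"
proof -
  interpret p: prob_space p using p by (rule borel_probD)
  interpret q: prob_space q using q by (rule borel_probD)
  note [measurable_cong] = borel_probD(2)[OF p] borel_probD(2)[OF q]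
  interpret pl: pair_sigma_finite p lborel ..
  interpret ql: pair_sigma_finite q lborel ..
  let ?f = "\<lambda>t x y. ennreal (exp (- t * \<eta>) / (2 * t) * (1 - gauss t (x - y))) * indicator {0<..} t"
  have [measurable]: "(\<lambda>z. gauss (fst (snd z)) (fst z - snd (snd z))) \<in> borel_measurable (borel \<Otimes>\<^sub>M (borel \<Otimes>\<^sub>M (borel::'a measure)))"
    unfolding gauss_def by measurable
  have "log_energy \<eta> p q = (\<integral>\<^sup>+x. \<integral>\<^sup>+y. \<integral>\<^sup>+t. ?f t x y \<partial>lborel \<partial>q \<partial>p)"
    unfolding log_energy_def gauss_def using \<eta> by (subst frullani[symmetric]) auto
  also have "\<dots> = (\<integral>\<^sup>+x. \<integral>\<^sup>+t. \<integral>\<^sup>+y. ?f t x y \<partial>q \<partial>lborel \<partial>p)"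
    unfolding gauss_def by (intro nn_integral_cong, rule ql.Fubini'[symmetric]) measurable
  also have "\<dots> = (\<integral>\<^sup>+t. \<integral>\<^sup>+x. \<integral>\<^sup>+y. ?f t x y \<partial>q \<partial>p \<partial>lborel)"
    unfolding gauss_def by (rule pl.Fubini'[symmetric]) measurable
  also have "\<dots> = (\<integral>\<^sup>+t. ennreal (exp (- t * \<eta>) / (2 * t) * (1 - gauss_energy t p q)) * indicator {0<..} t \<partial>lborel)"
  proof (rule nn_integral_cong)
    fix t :: real
    show "(\<integral>\<^sup>+x. \<integral>\<^sup>+y. ?f t x y \<partial>q \<partial>p) = ennreal (exp (- t * \<eta>) / (2 * t) * (1 - gauss_energy t p q)) * indicator {0<..} t"
    proof (cases "t > 0")
      case True
      define c where "c = exp (- t * \<eta>) / (2 * t)"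
      have c: "c \<ge> 0" using True by (simp add: c_def)
      have "(\<integral>\<^sup>+x. \<integral>\<^sup>+y. ?f t x y \<partial>q \<partial>p) = (\<integral>\<^sup>+x. \<integral>\<^sup>+y. ennreal c * ennreal (1 - gauss t (x - y)) \<partial>q \<partial>p)"
        using True gauss_le_1[of t] c unfolding c_def[symmetric]
        by (intro nn_integral_cong) (simp add: ennreal_mult'[symmetric])
      also have "\<dots> = ennreal c * (\<integral>\<^sup>+x. \<integral>\<^sup>+y. ennreal (1 - gauss t (x - y)) \<partial>q \<partial>p)"
        by (simp add: nn_integral_cmult)
      also have "\<dots> = ennreal (c * (1 - gauss_energy t p q))"
        using True c gauss_energy_props(2)[OF p q, of t] by (simp add: nn_integral_one_minus_gauss[OF p q] ennreal_mult)
      finally show ?thesis using True by (simp add: c_def)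
    qed simp
  qed
  finally show ?thesis .
qed

lemma measurable_gauss_energy:
  fixes p q :: "'a::euclidean_space measure"
  assumes p: "borel_prob p" and q: "borel_prob q"
  shows "(\<lambda>t. gauss_energy t p q) \<in> borel_measurable borel"
proof -
  interpret p: prob_space p using p by (rule borel_probD)
  interpret q: prob_space q using q by (rule borel_probD)
  note [measurable_cong] = borel_probD(2)[OF p] borel_probD(2)[OF q]
  show ?thesis unfolding gauss_energy_def gauss_def by measurable
qed

text \<open>Formally, twice the mutual term minus the two self terms is the integral over t of a
  positive weight times the squared Gaussian distance between p and q. Parameters in
  [s, s + \<theta>] give the quantitative term, all others are estimated by 0. A sum is stated
  instead of a difference because the values may be infinite; when the bracket is negative,
  \<open>ennreal\<close> turns the extra term into 0.\<close>

lemma log_energy_discrepancy: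
  fixes p q :: "'a::euclidean_space measure"
  assumes p: "borel_prob p" and q: "borel_prob q" and \<eta>: "\<eta> > 0" and \<theta>: "0 < \<theta>" "\<theta> \<le> s"
  shows "log_energy \<eta> p p + log_energy \<eta> q q +
      ennreal (\<theta> * (exp (- (2 * s * \<eta>)) / (4 * s) * ((gauss_pot s p z - gauss_pot s q z)\<^sup>2 / 2 - (2 * \<theta> / s)\<^sup>2)))
    \<le> 2 * log_energy \<eta> p q"
proof -
  define v where "v = (gauss_pot s p z - gauss_pot s q z)\<^sup>2 / 2 - (2 * \<theta> / s)\<^sup>2"
  define w0 where "w0 = exp (- (2 * s * \<eta>)) / (4 * s)"
  define w where "w t = exp (- t * \<eta>) / (2 * t)" for t
  have s: "s > 0" using \<theta> by linarith
  have w0: "w0 > 0" using s by (simp add: w0_def)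
  note [measurable] = measurable_gauss_energy[OF p p] measurable_gauss_energy[OF q q] measurable_gauss_energy[OF p q]
  have [measurable]: "w \<in> borel_measurable borel" unfolding w_def by measurable
  let ?D = "\<lambda>t. gauss_energy t p p + gauss_energy t q q - 2 * gauss_energy t p q"
  have main: "w0 * v \<le> w t * ?D t" if t: "s \<le> t" "t \<le> s + \<theta>" and v: "v \<ge> 0" for t
  proof (rule mult_mono)
    define g where "g r = gauss_pot r p z - gauss_pot r q z" for r
    have "\<bar>gauss_pot t p z - gauss_pot s p z\<bar> \<le> \<theta> / s" "\<bar>gauss_pot t q z - gauss_pot s q z\<bar> \<le> \<theta> / s"
      using gauss_pot_perturb[OF p s t(1), of z] gauss_pot_perturb[OF q s t(1), of z] t s
      by (auto elim!: order_trans intro!: divide_right_mono)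
    then have "\<bar>g s - g t\<bar> \<le> 2 * \<theta> / s" unfolding g_def by linarith
    then have "(g s - g t)\<^sup>2 \<le> (2 * \<theta> / s)\<^sup>2" by (metis abs_ge_zero power2_abs power_mono)
    \<comment> \<open>From a^2 \<le> 2 b^2 + 2 (a - b)^2. The drift of the discrepancy between the
      parameters s and t is what the subtracted \<open>(2 * \<theta> / s)\<^sup>2\<close> pays
      for.\<close>
    moreover have "(g s)\<^sup>2 / 2 \<le> (g t)\<^sup>2 + (g s - g t)\<^sup>2"
      using zero_le_power2[of "g s - 2 * g t"] by (simp add: power2_eq_square algebra_simps)
    ultimately have "v \<le> (g t)\<^sup>2" unfolding v_def g_def by linarith
    also have "\<dots> \<le> ?D t" unfolding g_def using gauss_energy_cauchy_schwarz[OF p q, of t z] t s by simp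
    finally show "v \<le> ?D t" .
    \<comment> \<open>Since \<theta> \<le> s, every t in the interval is at most 2 s; hence the
      exponent 2 s \<eta> and the denominator 4 s.\<close>
    have "exp (- (2 * s * \<eta>)) \<le> exp (- t * \<eta>)" using t \<theta> \<eta> by (simp add: mult_right_mono)
    then show "w0 \<le> w t" unfolding w0_def w_def using t s \<theta> by (intro frac_le) auto
    show "0 \<le> w t" unfolding w_def using t s by auto
  qed (use v in auto)
  have D0: "0 \<le> ?D t" if "t > 0" for t
    by (rule order_trans[OF zero_le_power2 gauss_energy_cauchy_schwarz[OF p q that, of z]])
  have "log_energy \<eta> p p + log_energy \<eta> q q + ennreal (\<theta> * (w0 * v))
    = (\<integral>\<^sup>+t. ennreal (w t * (1 - gauss_energy t p p)) * indicator {0<..} t \<partial>lborel)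
     + (\<integral>\<^sup>+t. ennreal (w t * (1 - gauss_energy t q q)) * indicator {0<..} t \<partial>lborel)
     + (\<integral>\<^sup>+t. ennreal (w0 * v) * indicator {s..s+\<theta>} t \<partial>lborel)"
  proof -
    have "(\<integral>\<^sup>+t. ennreal (w0 * v) * indicator {s..s+\<theta>} t \<partial>lborel) = ennreal (\<theta> * (w0 * v))"
      using \<theta> by (subst nn_integral_cmult_indicator) (auto simp: ennreal_mult' mult.commute)
    then show ?thesis
      unfolding log_energy_frullani[OF p p \<eta>] log_energy_frullani[OF q q \<eta>] w_def by simp
  qed
  also have "\<dots> = (\<integral>\<^sup>+t. ennreal (w t * (1 - gauss_energy t p p)) * indicator {0<..} t
      + ennreal (w t * (1 - gauss_energy t q q)) * indicator {0<..} t
      + ennreal (w0 * v) * indicator {s..s+\<theta>} t \<partial>lborel)"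
    by (simp add: nn_integral_add)
  also have "\<dots> \<le> (\<integral>\<^sup>+t. 2 * (ennreal (w t * (1 - gauss_energy t p q)) * indicator {0<..} t) \<partial>lborel)"
  proof (rule nn_integral_mono)
    fix t :: real
    show "ennreal (w t * (1 - gauss_energy t p p)) * indicator {0<..} t
      + ennreal (w t * (1 - gauss_energy t q q)) * indicator {0<..} t
      + ennreal (w0 * v) * indicator {s..s+\<theta>} t \<le> 2 * (ennreal (w t * (1 - gauss_energy t p q)) * indicator {0<..} t)"
    proof (cases "t > 0")
      case False
      then show ?thesis using s by auto
    next
      case True
      have wt: "w t \<ge> 0" unfolding w_def using True by auto
      have b: "gauss_energy t p p \<le> 1" "gauss_energy t q q \<le> 1" "gauss_energy t p q \<le> 1"
        using gauss_energy_props(2)[OF p p, of t] gauss_energy_props(2)[OF q q, of t]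
          gauss_energy_props(2)[OF p q, of t] True by simp_all
      \<comment> \<open>The additional integrand with its truncation at 0 made explicit, so that the
        three summands can be compared inside the reals.\<close>
      define v' where "v' = (if t \<in> {s..s+\<theta>} then max 0 (w0 * v) else 0)"
      have v': "v' \<le> w t * ?D t" "v' \<ge> 0"
        using main[of t] D0[OF True] wt w0 by (auto simp: v'_def max_def zero_le_mult_iff)
      have "ennreal (w t * (1 - gauss_energy t p p)) + ennreal (w t * (1 - gauss_energy t q q)) + ennreal v'
         = ennreal (w t * (1 - gauss_energy t p p) + w t * (1 - gauss_energy t q q) + v')"
        using wt b v' by (simp add: ennreal_plus)
      also have "\<dots> \<le> ennreal (2 * (w t * (1 - gauss_energy t p q)))"
        using v' by (intro ennreal_leI) (simp add: algebra_simps)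
      also have "\<dots> = 2 * ennreal (w t * (1 - gauss_energy t p q))"
        using wt b by (simp add: ennreal_mult'')
      also have "ennreal v' = ennreal (w0 * v) * indicator {s..s+\<theta>} t"
        by (auto simp: v'_def max_def ennreal_neg)
      finally show ?thesis using True by simp
    qed
  qed
  also have "\<dots> = 2 * log_energy \<eta> p q"
    by (subst nn_integral_cmult) (auto simp: log_energy_frullani[OF p q \<eta>] w_def)
  finally show ?thesis by (simp add: v_def w0_def)
qed

text \<open>The convolution of \<open>p\<close> and \<open>\<kappa>\<close>, encoded as the law of
  the sum of two independent points.\<close>

definition smear :: "'a::euclidean_space measure \<Rightarrow> 'a measure \<Rightarrow> 'a measure" where
  "smear p \<kappa> = distr (p \<Otimes>\<^sub>M \<kappa>) borel (\<lambda>(x, h). x + h)"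

context
  fixes p \<kappa> :: "'a::euclidean_space measure"
  assumes p: "borel_prob p" and \<kappa>: "borel_prob \<kappa>"
begin

lemma borel_prob_smear: "borel_prob (smear p \<kappa>)"
proof -
  interpret p: prob_space p using p by (rule borel_probD)
  interpret \<kappa>: prob_space \<kappa> using \<kappa> by (rule borel_probD)
  interpret pair_prob_space p \<kappa> ..
  note [measurable_cong] = borel_probD(2)[OF p] borel_probD(2)[OF \<kappa>]
  show ?thesis unfolding borel_prob_def smear_def by (auto intro!: prob_space_distr)
qed

lemma nn_integral_smear:
  assumes [measurable]: "f \<in> borel_measurable borel"
  shows "(\<integral>\<^sup>+z. f z \<partial>smear p \<kappa>) = (\<integral>\<^sup>+x. \<integral>\<^sup>+h. f (x + h) \<partial>\<kappa> \<partial>p)"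
    "(\<integral>\<^sup>+z. f z \<partial>smear p \<kappa>) = (\<integral>\<^sup>+h. \<integral>\<^sup>+x. f (x + h) \<partial>p \<partial>\<kappa>)"
proof -
  interpret p: prob_space p using p by (rule borel_probD)
  interpret \<kappa>: prob_space \<kappa> using \<kappa> by (rule borel_probD)
  interpret pair_sigma_finite p \<kappa> ..
  note [measurable_cong] = borel_probD(2)[OF p] borel_probD(2)[OF \<kappa>]
  show 1: "(\<integral>\<^sup>+z. f z \<partial>smear p \<kappa>) = (\<integral>\<^sup>+x. \<integral>\<^sup>+h. f (x + h) \<partial>\<kappa> \<partial>p)"
    unfolding smear_def by (subst nn_integral_distr) (auto simp: \<kappa>.nn_integral_fst[symmetric])
  show "(\<integral>\<^sup>+z. f z \<partial>smear p \<kappa>) = (\<integral>\<^sup>+h. \<integral>\<^sup>+x. f (x + h) \<partial>p \<partial>\<kappa>)"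
    unfolding 1 by (rule Fubini'[symmetric]) measurable
qed

end

definition translate :: "'a::euclidean_space measure \<Rightarrow> 'a \<Rightarrow> 'a measure" where
  "translate p h = distr p borel (\<lambda>x. x + h)"

context
  fixes p :: "'a::euclidean_space measure"
  assumes p: "borel_prob p"
begin

lemma borel_prob_translate: "borel_prob (translate p h)"
proof -
  interpret p: prob_space p using p by (rule borel_probD)
  note [measurable_cong] = borel_probD(2)[OF p]
  show ?thesis unfolding borel_prob_def translate_def by (auto intro!: p.prob_space_distr)
qed

lemma nn_gauss_energy_translate:
  assumes t: "t > 0"
  shows "(\<integral>\<^sup>+x. \<integral>\<^sup>+y. ennreal (gauss t (x + h - (y + h'))) \<partial>p \<partial>p) = ennreal (gauss_energy t (translate p h) (translate p h'))"
proof -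
  interpret p: prob_space p using p by (rule borel_probD)
  note [measurable_cong] = borel_probD(2)[OF p]
  interpret q: prob_space "translate p h'" using borel_prob_translate by (rule borel_probD)
  have [measurable_cong]: "sets (translate p h') = sets borel" by (simp add: translate_def)
  have "ennreal (gauss_energy t (translate p h) (translate p h')) =
     (\<integral>\<^sup>+x. \<integral>\<^sup>+y. ennreal (gauss t (x - y)) \<partial>translate p h' \<partial>translate p h)"
    using t by (intro gauss_energy_props(4)[symmetric] borel_prob_translate) auto
  also have "\<dots> = (\<integral>\<^sup>+x. \<integral>\<^sup>+y. ennreal (gauss t (x + h - y)) \<partial>translate p h' \<partial>p)"
    unfolding translate_def[of p h] by (subst nn_integral_distr) auto
  also have "\<dots> = (\<integral>\<^sup>+x. \<integral>\<^sup>+y. ennreal (gauss t (x + h - (y + h'))) \<partial>p \<partial>p)"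
    unfolding translate_def by (subst nn_integral_distr) auto
  finally show ?thesis by simp
qed

text \<open>All translates share one self-energy, and positive definiteness bounds a mutual energy
  by the mean of the two self-energies. The evaluation point 0 in the Cauchy--Schwarz inequality is
  arbitrary: its square is simply bounded below by 0.\<close>

lemma gauss_energy_translate_le:
  assumes t: "t > 0"
  shows "gauss_energy t (translate p h) (translate p h') \<le> gauss_energy t p p"
proof -
  have same: "gauss_energy t (translate p k) (translate p k) = gauss_energy t p p" for k
  proof -
    have "ennreal (gauss_energy t (translate p k) (translate p k)) = ennreal (gauss_energy t p p)"
      unfolding nn_gauss_energy_translate[OF t, symmetric]
      using gauss_energy_props(4)[OF p p, of t] t by simp
    then show ?thesis
      using gauss_energy_props(3)[OF p p, of t] gauss_energy_props(3)[OF borel_prob_translate borel_prob_translate, of t k k] t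
      by simp
  qed
  show ?thesis
    using gauss_energy_cauchy_schwarz[OF borel_prob_translate[of h] borel_prob_translate[of h'] t, of 0]
      zero_le_power2[of "gauss_pot t (translate p h) 0 - gauss_pot t (translate p h') 0"]
    unfolding same by linarith
qed

text \<open>The self-energy of a convolution is the average, over two independent shifts h and h',
  of the mutual energy of the two translates of p; each of these is at most the self-energy of
  p.\<close>

lemma gauss_energy_smear_le:
  assumes \<kappa>: "borel_prob \<kappa>" and t: "t > 0"
  shows "gauss_energy t (smear p \<kappa>) (smear p \<kappa>) \<le> gauss_energy t p p"
proof -
  interpret p: prob_space p using p by (rule borel_probD)
  interpret \<kappa>: prob_space \<kappa> using \<kappa> by (rule borel_probD)
  interpret p\<kappa>: pair_sigma_finite p \<kappa> ..
  note [measurable_cong] = borel_probD(2)[OF p] borel_probD(2)[OF \<kappa>]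
  note s = borel_prob_smear[OF p \<kappa>]
  interpret s: prob_space "smear p \<kappa>" using s by (rule borel_probD)
  have [measurable_cong]: "sets (smear p \<kappa>) = sets borel" by (simp add: smear_def)
  have "ennreal (gauss_energy t (smear p \<kappa>) (smear p \<kappa>)) =
     (\<integral>\<^sup>+a. \<integral>\<^sup>+b. ennreal (gauss t (a - b)) \<partial>smear p \<kappa> \<partial>smear p \<kappa>)"
    using t by (intro gauss_energy_props(4)[symmetric] s) auto
  also have "\<dots> = (\<integral>\<^sup>+h. \<integral>\<^sup>+x. \<integral>\<^sup>+b. ennreal (gauss t (x + h - b)) \<partial>smear p \<kappa> \<partial>p \<partial>\<kappa>)"
    by (subst nn_integral_smear(2)[OF p \<kappa>]) auto
  also have "\<dots> = (\<integral>\<^sup>+h. \<integral>\<^sup>+x. \<integral>\<^sup>+h'. \<integral>\<^sup>+y. ennreal (gauss t (x + h - (y + h'))) \<partial>p \<partial>\<kappa> \<partial>p \<partial>\<kappa>)"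
    by (subst nn_integral_smear(2)[OF p \<kappa>]) auto
  also have "\<dots> = (\<integral>\<^sup>+h. \<integral>\<^sup>+h'. \<integral>\<^sup>+x. \<integral>\<^sup>+y. ennreal (gauss t (x + h - (y + h'))) \<partial>p \<partial>p \<partial>\<kappa> \<partial>\<kappa>)"
    by (intro nn_integral_cong p\<kappa>.Fubini'[symmetric]) measurable
  also have "\<dots> = (\<integral>\<^sup>+h. \<integral>\<^sup>+h'. ennreal (gauss_energy t (translate p h) (translate p h')) \<partial>\<kappa> \<partial>\<kappa>)"
    by (simp add: nn_gauss_energy_translate[OF t])
  also have "\<dots> \<le> (\<integral>\<^sup>+h. \<integral>\<^sup>+h'. ennreal (gauss_energy t p p) \<partial>\<kappa> \<partial>\<kappa>)"
    by (intro nn_integral_mono ennreal_leI gauss_energy_translate_le t)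
  also have "\<dots> = ennreal (gauss_energy t p p)" by (simp add: \<kappa>.emeasure_space_1)
  finally show ?thesis
    using gauss_energy_props(3)[OF p p, of t] t by (simp add: ennreal_le_iff)
qed

text \<open>\<open>log_energy\<close> is minus the truncated logarithmic energy up to a constant, so
  here smearing increases it.\<close>

lemma log_energy_smear_ge:
  assumes \<kappa>: "borel_prob \<kappa>" and \<eta>: "\<eta> > 0"
  shows "log_energy \<eta> p p \<le> log_energy \<eta> (smear p \<kappa>) (smear p \<kappa>)"
  unfolding log_energy_frullani[OF p p \<eta>] log_energy_frullani[OF borel_prob_smear[OF p \<kappa>] borel_prob_smear[OF p \<kappa>] \<eta>]
proof (intro nn_integral_mono)
  fix t :: real
  show "ennreal (exp (- t * \<eta>) / (2 * t) * (1 - gauss_energy t p p)) * indicator {0<..} t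
    \<le> ennreal (exp (- t * \<eta>) / (2 * t) * (1 - gauss_energy t (smear p \<kappa>) (smear p \<kappa>))) * indicator {0<..} t"
  proof (cases "t > 0")
    case True
    then have "exp (- t * \<eta>) / (2 * t) * (1 - gauss_energy t p p)
      \<le> exp (- t * \<eta>) / (2 * t) * (1 - gauss_energy t (smear p \<kappa>) (smear p \<kappa>))"
      using gauss_energy_smear_le[OF \<kappa>, of t] by (intro mult_left_mono) auto
    then show ?thesis by (intro mult_right_mono ennreal_leI) auto
  qed simp
qed

end

section \<open>Smoothing over small balls\<close>

text \<open>Decompose into shells of ratio 1/4. Where the norm lies between 4^-(k+1) and 4^-k the
  integrand is at most 2^(k+1), while the volume is at most a constant times 4^-k because the
  dimension is at least 1. A geometric series of ratio 1/2 remains, so the exponent one half is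
  integrable in every dimension.\<close>

lemma nn_integral_inverse_sqrt_ball:
  "(\<integral>\<^sup>+x. ennreal (1 / sqrt (norm x)) * indicator (cball 0 1) x \<partial>(lborel :: 'a::euclidean_space measure)) < \<infinity>"
proof -
  define V where "V = unit_ball_vol (real DIM('a))"
  have V: "V \<ge> 0" by (simp add: V_def)
  have "(\<integral>\<^sup>+x. ennreal (1 / sqrt (norm x)) * indicator (cball 0 1) x \<partial>(lborel :: 'a measure))
    \<le> (\<integral>\<^sup>+x. (\<Sum>k. ennreal (2 ^ Suc k) * indicator (cball 0 ((1/4)^k)) x) \<partial>(lborel :: 'a measure))"
  proof (rule nn_integral_mono)
    fix x :: 'a
    let ?f = "\<lambda>k. ennreal (2 ^ Suc k) * indicator (cball 0 ((1/4)^k)) x"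
    show "ennreal (1 / sqrt (norm x)) * indicator (cball 0 1) x \<le> (\<Sum>k. ?f k)"
    proof (cases "x \<noteq> 0 \<and> norm x \<le> 1")
      case True
      obtain m where m: "(1/4)^m < norm x" using real_arch_pow_inv[of "norm x" "1/4"] True by auto
      define n where "n = (LEAST n. (1/4)^n < norm x)"
      have n: "(1/4)^n < norm x" unfolding n_def using m by (rule LeastI)
      have "n \<noteq> 0" using n True by (intro notI) simp
      then obtain k where k: "n = Suc k" using not0_implies_Suc by blast
      have "\<not> (1/4)^k < norm x" using not_less_Least[of k "\<lambda>n. (1/4)^n < norm x"] k by (simp add: n_def)
      then have le: "norm x \<le> (1/4)^k" by simp
      have sq: "sqrt ((1/4)^n) = (1/2)^n" by (simp add: real_sqrt_power real_sqrt_divide)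
      have "(1/2)^n \<le> sqrt (norm x)" using n by (metis sq real_sqrt_le_mono less_imp_le)
      then have "1 / sqrt (norm x) \<le> 1 / (1/2)^n" by (intro divide_left_mono) (use True in auto)
      also have "\<dots> = 2 ^ Suc k" by (simp add: k power_one_over)
      finally have "ennreal (1 / sqrt (norm x)) * indicator (cball 0 1) x \<le> ?f k"
        using True le by (auto intro!: ennreal_leI)
      also have "\<dots> \<le> (\<Sum>k. ?f k)"
      proof -
        have "F k \<le> suminf F" for F :: "nat \<Rightarrow> ennreal" using sum_le_suminf[of F "{k}"] by simp
        then show ?thesis .
      qed
      finally show ?thesis .
    qed auto
  qed
  also have "\<dots> = (\<Sum>k. \<integral>\<^sup>+x. ennreal (2 ^ Suc k) * indicator (cball 0 ((1/4)^k)) x \<partial>(lborel :: 'a measure))"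
    by (rule nn_integral_suminf) (auto intro!: borel_measurable_times_ennreal borel_measurable_indicator)
  also have "\<dots> = (\<Sum>k. ennreal (2 ^ Suc k) * ennreal (V * ((1/4)^k) ^ DIM('a)))"
    by (intro suminf_cong) (subst nn_integral_cmult_indicator, simp, simp add: emeasure_cball V_def)
  also have "\<dots> \<le> (\<Sum>k. ennreal (2 * V * (1/2)^k))"
  proof (intro suminf_le)
    fix k
    have "((1/4::real)^k) ^ DIM('a) \<le> ((1/4)^k) ^ 1"
      by (rule power_decreasing) (auto simp: power_le_one DIM_positive Suc_le_eq)
    then have "2 ^ Suc k * (V * ((1/4)^k) ^ DIM('a)) \<le> 2 ^ Suc k * (V * (1/4)^k)"
      using V by (intro mult_left_mono) auto
    also have "\<dots> = 2 * V * (1/2)^k" by (simp add: power_mult_distrib[symmetric] mult.assoc)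
    finally show "ennreal (2 ^ Suc k) * ennreal (V * ((1/4)^k) ^ DIM('a)) \<le> ennreal (2 * V * (1/2)^k)"
      using V by (simp add: ennreal_mult[symmetric] ennreal_leI)
  qed auto
  also have "\<dots> = ennreal (\<Sum>k. 2 * V * (1/2)^k)"
    using V by (intro suminf_ennreal_eq) (auto intro!: summable_sums summable_mult)
  also have "\<dots> < \<infinity>" by simp
  finally show ?thesis .
qed

text \<open>The measure has a Lebesgue density bounded by c, expressed through integrals so that no
  Radon--Nikodym derivative has to be named.\<close>

definition density_le :: "'a::euclidean_space measure \<Rightarrow> real \<Rightarrow> bool" where
  "density_le p c \<longleftrightarrow> c \<ge> 0 \<and> (\<forall>f\<in>borel_measurable borel. (\<integral>\<^sup>+x. f x \<partial>p) \<le> ennreal c * (\<integral>\<^sup>+x. f x \<partial>lborel))"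

text \<open>Within distance 1 of y the density bound reduces the integral to a Lebesgue integral,
  which does not depend on y by translation invariance; farther away the integrand is at most
  1.\<close>

lemma density_le_singularity:
  fixes p :: "'a::euclidean_space measure"
  assumes p: "borel_prob p" and d: "density_le p c"
  shows "\<exists>B\<ge>0. \<forall>y. (\<integral>\<^sup>+x. ennreal (1 / sqrt (norm (x - y))) \<partial>p) \<le> ennreal B"
proof -
  interpret p: prob_space p using p by (rule borel_probD)
  note [measurable_cong] = borel_probD(2)[OF p]
  have [measurable]: "cball (0::'a) 1 \<in> sets borel" by simp
  define S where "S = (\<integral>\<^sup>+x. ennreal (1 / sqrt (norm x)) * indicator (cball 0 1) x \<partial>(lborel :: 'a measure))"
  have S: "S < \<infinity>" unfolding S_def by (rule nn_integral_inverse_sqrt_ball)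
  define B where "B = enn2real (ennreal c * S + 1)"
  have fin: "ennreal c * S + 1 < \<infinity>" using S by (simp add: ennreal_mult_less_top)
  have "(\<integral>\<^sup>+x. ennreal (1 / sqrt (norm (x - y))) \<partial>p) \<le> ennreal B" for y
  proof -
    have "(\<integral>\<^sup>+x. ennreal (1 / sqrt (norm (x - y))) \<partial>p)
      \<le> (\<integral>\<^sup>+x. ennreal (1 / sqrt (norm (x - y))) * indicator (cball 0 1) (x - y) + 1 \<partial>p)"
    proof (rule nn_integral_mono)
      fix x
      show "ennreal (1 / sqrt (norm (x - y))) \<le> ennreal (1 / sqrt (norm (x - y))) * indicator (cball 0 1) (x - y) + 1"
      proof (cases "norm (x - y) \<le> 1")
        case False
        then have "1 < sqrt (norm (x - y))" by simp
          then have "1 / sqrt (norm (x - y)) \<le> 1" by (subst divide_le_eq) simp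
        then have "ennreal (1 / sqrt (norm (x - y))) \<le> ennreal 1" by (rule ennreal_leI)
          also have "\<dots> \<le> ennreal (1 / sqrt (norm (x - y))) * indicator (cball 0 1) (x - y) + 1"
            by (simp add: add_increasing)
          finally show ?thesis .
      qed (auto simp: indicator_def)
    qed
    also have "\<dots> = (\<integral>\<^sup>+x. ennreal (1 / sqrt (norm (x - y))) * indicator (cball 0 1) (x - y) \<partial>p) + 1"
      by (subst nn_integral_add) (auto simp: p.emeasure_space_1)
    also have "\<dots> \<le> ennreal c * (\<integral>\<^sup>+x. ennreal (1 / sqrt (norm (x - y))) * indicator (cball 0 1) (x - y) \<partial>lborel) + 1"
      using d by (intro add_right_mono) (auto simp: density_le_def)
    also have "(\<integral>\<^sup>+x. ennreal (1 / sqrt (norm (x - y))) * indicator (cball 0 1) (x - y) \<partial>lborel) = S"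
      using nn_lborel_shift[of "\<lambda>x. ennreal (1 / sqrt (norm x)) * indicator (cball 0 1) x" "- y"]
      by (simp add: S_def)
    also have "ennreal c * S + 1 = ennreal B" using fin by (simp add: B_def)
    finally show ?thesis .
  qed
  moreover have "B \<ge> 0" by (simp add: B_def)
  ultimately show ?thesis by blast
qed

lemma lborel_distr_uminus_euclidean: "distr lborel borel uminus = (lborel :: 'a::euclidean_space measure)"
  using lborel_affine[of "-1" "0::'a"] by (simp add: density_1)

definition unif_ball :: "real \<Rightarrow> 'a::euclidean_space measure" where
  "unif_ball s = uniform_measure lborel (cball 0 s)"

context
  fixes s :: real
  assumes s: "s > 0"
begin

lemma emeasure_cball_finite_pos:
  "emeasure lborel (cball (0::'a::euclidean_space) s) = ennreal (measure lborel (cball (0::'a) s))"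
  "measure lborel (cball (0::'a) s) > 0"
proof -
  show "emeasure lborel (cball (0::'a) s) = ennreal (measure lborel (cball (0::'a) s))"
    using emeasure_lborel_cball_finite[of "0::'a" s] by (intro emeasure_eq_ennreal_measure) (simp add: less_le)
  show "measure lborel (cball (0::'a) s) > 0"
    using content_cball_pos[OF s, of "0::'a"] by simp
qed

lemma nn_integral_unif_ball:
  fixes f :: "'a::euclidean_space \<Rightarrow> ennreal"
  assumes [measurable]: "f \<in> borel_measurable borel"
  shows "(\<integral>\<^sup>+h. f h \<partial>unif_ball s) = ennreal (1 / measure lborel (cball (0::'a) s)) * (\<integral>\<^sup>+h. f h * indicator (cball 0 s) h \<partial>lborel)"
proof -
  note v = emeasure_cball_finite_pos[where 'a='a]
  have "(\<integral>\<^sup>+h. f h \<partial>unif_ball s) = (\<integral>\<^sup>+h. f h * indicator (cball 0 s) h \<partial>lborel) / emeasure lborel (cball (0::'a) s)"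
    unfolding unif_ball_def by (rule nn_integral_uniform_measure) auto
  also have "\<dots> = (\<integral>\<^sup>+h. f h * indicator (cball 0 s) h \<partial>lborel) * ennreal (inverse (measure lborel (cball (0::'a) s)))"
    unfolding v(1) divide_ennreal_def inverse_ennreal[OF v(2)] ..
  finally show ?thesis by (simp only: mult.commute inverse_eq_divide)
qed

lemma borel_prob_unif_ball: "borel_prob (unif_ball s :: 'a::euclidean_space measure)"
  unfolding borel_prob_def unif_ball_def
proof (intro conjI prob_space_uniform_measure)
  show "emeasure lborel (cball (0::'a) s) \<noteq> 0" "emeasure lborel (cball (0::'a) s) \<noteq> \<infinity>"
    unfolding emeasure_cball_finite_pos(1) using emeasure_cball_finite_pos(2)[where 'a='a] by auto
qed simp

lemma AE_unif_ball: "AE h in unif_ball s. norm (h :: 'a::euclidean_space) \<le> s"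
  unfolding unif_ball_def by (intro AE_uniform_measureI AE_I2) auto

text \<open>The symmetry that allows the smoothing to move from one argument of the logarithmic
  kernel to the other, see \<open>pot_shift\<close>.\<close>

lemma unif_ball_uminus: "distr (unif_ball s) borel uminus = (unif_ball s :: 'a::euclidean_space measure)"
proof (rule measure_eqI)
  fix A :: "'a set" assume "A \<in> sets (distr (unif_ball s) borel uminus)"
  then have [measurable]: "A \<in> sets borel" by simp
  have [measurable]: "uminus -` A \<in> sets (borel :: 'a measure)"
    using measurable_sets[of uminus borel borel A] by simp
  have "emeasure (distr (unif_ball s) borel uminus) A = emeasure (unif_ball s) (uminus -` A :: 'a set)"
    by (subst emeasure_distr) (auto simp: unif_ball_def)
  also have "\<dots> = emeasure lborel (cball 0 s \<inter> uminus -` A :: 'a set) / emeasure lborel (cball (0::'a) s)"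
    unfolding unif_ball_def by (subst emeasure_uniform_measure) auto
  also have "emeasure lborel (cball 0 s \<inter> uminus -` A :: 'a set) = emeasure (distr lborel borel uminus) (cball (0::'a) s \<inter> A)"
    by (subst emeasure_distr) (auto intro!: arg_cong[where f="emeasure lborel"])
  also have "\<dots> = emeasure lborel (cball (0::'a) s \<inter> A)" by (simp add: lborel_distr_uminus_euclidean)
  also have "\<dots> / emeasure lborel (cball (0::'a) s) = emeasure (unif_ball s) A"
    unfolding unif_ball_def by (subst emeasure_uniform_measure) auto
  finally show "emeasure (distr (unif_ball s) borel uminus) A = emeasure (unif_ball s) A" .
qed (simp add: unif_ball_def)

text \<open>Convolution with a bounded density produces a density with the same bound, whatever the
  other factor is; even a point mass becomes admissible.\<close>

lemma density_le_smear_unif_ball: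
  fixes p :: "'a::euclidean_space measure"
  assumes p: "borel_prob p"
  shows "density_le (smear p (unif_ball s)) (1 / measure lborel (cball (0::'a) s))"
proof -
  interpret p: prob_space p using p by (rule borel_probD)
  note [measurable_cong] = borel_probD(2)[OF p]
  let ?c = "1 / measure lborel (cball (0::'a) s)"
  have "(\<integral>\<^sup>+x. f x \<partial>smear p (unif_ball s)) \<le> ennreal ?c * (\<integral>\<^sup>+x. f x \<partial>lborel)"
    if [measurable]: "f \<in> borel_measurable borel" for f :: "'a \<Rightarrow> ennreal"
  proof -
    have "(\<integral>\<^sup>+x. f x \<partial>smear p (unif_ball s)) = (\<integral>\<^sup>+x. \<integral>\<^sup>+h. f (x + h) \<partial>unif_ball s \<partial>p)"
      by (rule nn_integral_smear(1)[OF p borel_prob_unif_ball]) fact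
    also have "\<dots> \<le> (\<integral>\<^sup>+x. ennreal ?c * (\<integral>\<^sup>+h. f h \<partial>lborel) \<partial>p)"
    proof (rule nn_integral_mono)
      fix x
      have "(\<integral>\<^sup>+h. f (x + h) \<partial>unif_ball s) \<le> ennreal ?c * (\<integral>\<^sup>+h. f (x + h) \<partial>lborel)"
        by (subst nn_integral_unif_ball) (auto intro!: mult_left_mono nn_integral_mono simp: indicator_def)
      also have "(\<integral>\<^sup>+h. f (x + h) \<partial>lborel) = (\<integral>\<^sup>+h. f h \<partial>lborel)"
        using nn_lborel_shift[of f x] by (simp add: add.commute)
      finally show "(\<integral>\<^sup>+h. f (x + h) \<partial>unif_ball s) \<le> ennreal ?c * (\<integral>\<^sup>+h. f h \<partial>lborel)" .
    qed
    also have "\<dots> = ennreal ?c * (\<integral>\<^sup>+x. f x \<partial>lborel)" by (simp add: p.emeasure_space_1)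
    finally show ?thesis .
  qed
  then show ?thesis by (auto simp: density_le_def)
qed

end

text \<open>The value \<open>log_ker x x = 0\<close> is junk; it only ever matters on null sets.\<close>

definition log_ker :: "'a::euclidean_space \<Rightarrow> 'a \<Rightarrow> real" where
  "log_ker x y = - ln (norm (x - y))"

lemma measurable_log_ker [measurable]:
  assumes [measurable]: "f \<in> borel_measurable M" "g \<in> borel_measurable M"
  shows "(\<lambda>x. log_ker (f x) (g x)) \<in> borel_measurable M"
  unfolding log_ker_def by measurable

lemma log_ker_sym: "log_ker x y = log_ker y x"
  by (simp add: log_ker_def norm_minus_commute)

text \<open>The inequality ln u \<le> u at u = r^(-1/2). It replaces the logarithmic singularity by
  a power that is integrable in every dimension. For coinciding points both sides are 0 by the
  conventions for \<open>ln 0\<close> and division by 0.\<close>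

lemma log_ker_le_sqrt: "log_ker x y \<le> 2 * (1 / sqrt (norm (x - y)))"
proof (cases "x = y")
  case False
  then have r: "norm (x - y) > 0" by simp
  have "log_ker x y = 2 * ln (1 / sqrt (norm (x - y)))"
    using r by (simp add: log_ker_def ln_div ln_sqrt)
  moreover have "ln (1 / sqrt (norm (x - y))) \<le> 1 / sqrt (norm (x - y))"
    using r by (intro ln_bound) auto
  ultimately show ?thesis by simp
qed (simp add: log_ker_def)

text \<open>The distance is at most (1 + |x|)(1 + |y|), which separates the variables. Each factor
  can then be absorbed by the external field at its own point.\<close>

lemma log_ker_ge: "- (ln (1 + norm x) + ln (1 + norm y)) \<le> log_ker x y"
proof (cases "x = y")
  case False
  have "norm (x - y) \<le> norm x + norm y" by (rule norm_triangle_ineq4)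
  also have "\<dots> \<le> (1 + norm x) * (1 + norm y)" by (simp add: algebra_simps)
  finally have "ln (norm (x - y)) \<le> ln ((1 + norm x) * (1 + norm y))"
    using False by (subst ln_le_cancel_iff) (auto intro!: mult_pos_pos add_pos_nonneg)
  also have "\<dots> = ln (1 + norm x) + ln (1 + norm y)"
  proof -
    have "1 + norm x > 0" "1 + norm y > 0" by (auto intro: add_pos_nonneg)
    then show ?thesis by (simp add: ln_mult)
  qed
  finally show ?thesis by (simp add: log_ker_def)
qed (simp add: log_ker_def)

lemma half_ln_expand:
  assumes "\<eta> > 0"
  shows "ln (1 + r\<^sup>2 / \<eta>) / 2 = ln (r\<^sup>2 + \<eta>) / 2 - ln \<eta> / (2::real)"
proof -
  have "1 + r\<^sup>2 / \<eta> = (r\<^sup>2 + \<eta>) / \<eta>" using assms by (simp add: field_simps)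
  moreover have "r\<^sup>2 + \<eta> > 0" using assms by (simp add: add_nonneg_pos)
  ultimately show ?thesis using assms by (simp add: ln_div diff_divide_distrib)
qed

lemma regularized_log_ge:
  assumes "\<eta> > 0" "x \<noteq> y"
  shows "- log_ker x y - ln \<eta> / 2 \<le> ln (1 + (norm (x - y))\<^sup>2 / \<eta>) / 2"
proof -
  have r: "norm (x - y) > 0" using assms by simp
  have "2 * ln (norm (x - y)) = ln ((norm (x - y))\<^sup>2)" using r by (simp add: ln_realpow)
  also have "\<dots> \<le> ln ((norm (x - y))\<^sup>2 + \<eta>)"
    using r assms by (subst ln_le_cancel_iff) (auto intro!: add_pos_pos)
  finally show ?thesis unfolding half_ln_expand[OF assms(1)] log_ker_def by simp
qed

text \<open>With r the distance and u = \<rho> / sqrt r one has r^2 u^4 = \<rho>^4, so the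
  truncation error is half of ln(1 + u^4), and 1 + u^4 \<le> (1 + u)^4 bounds it by 2 u. The fourth
  power of \<rho> is chosen to make this error linear in \<rho> with the integrable singularity
  r^(-1/2).\<close>

lemma regularized_log_le:
  assumes \<rho>: "0 < \<rho>" "\<rho> \<le> 1"
  shows "ln (1 + (norm (x - y))\<^sup>2 / \<rho>^4) / 2 \<le> - log_ker x y - ln (\<rho>^4) / 2 + 2 * \<rho> * (1 / sqrt (norm (x - y)))"
proof (cases "x = y")
  case True
  \<comment> \<open>On the diagonal the left side is 0 and \<open>log_ker\<close> has its
    conventional value 0; the claim then rests on \<rho> \<le> 1.\<close>
  have "ln (\<rho>^4) \<le> 0" using \<rho> by (simp add: power_le_one)
  then show ?thesis using True by (simp add: log_ker_def)
next
  case False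
  define r where "r = norm (x - y)"
  have r: "r > 0" using False by (simp add: r_def)
  define u where "u = \<rho> / sqrt r"
  have u: "u > 0" using r \<rho> by (simp add: u_def)
  have u4: "r\<^sup>2 * u^4 = \<rho>^4"
  proof -
    have "(sqrt r)^4 = r^2" using r by (simp add: power4_eq_xxxx power2_eq_square mult.assoc[symmetric])
    then show ?thesis using r by (simp add: u_def power_divide)
  qed
  have "r\<^sup>2 + \<rho>^4 = r\<^sup>2 * (1 + u^4)" unfolding u4[symmetric] by (simp add: algebra_simps)
  then have "ln (r\<^sup>2 + \<rho>^4) = 2 * ln r + ln (1 + u^4)"
  proof -
    have "1 + u^4 > 0" using u by (simp add: add_pos_pos)
    then show ?thesis using r \<open>r\<^sup>2 + \<rho>^4 = r\<^sup>2 * (1 + u^4)\<close> by (simp add: ln_mult ln_realpow)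
  qed
  moreover have "ln (1 + u^4) \<le> 4 * u"
  proof -
    have "1 + u^4 \<le> (1 + u)^4" using u by (simp add: power4_eq_xxxx algebra_simps)
    then have "ln (1 + u^4) \<le> ln ((1 + u)^4)" using u by (subst ln_le_cancel_iff) (auto intro: add_pos_pos)
    also have "\<dots> = 4 * ln (1 + u)" using u by (subst ln_realpow) auto
    also have "\<dots> \<le> 4 * u" using ln_add_one_self_le_self[of u] u by simp
    finally show ?thesis .
  qed
  ultimately have "ln (r\<^sup>2 + \<rho>^4) / 2 \<le> ln r + 2 * u" by simp
  then show ?thesis using half_ln_expand[of "\<rho>^4" r] \<rho> by (simp add: log_ker_def r_def u_def)
qed

section \<open>The equilibrium measure\<close>

lemma ennreal_integral_le_nn_integral:
  fixes f :: "'a \<Rightarrow> real"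
  assumes "integrable M f"
  shows "ennreal (\<integral>x. f x \<partial>M) \<le> (\<integral>\<^sup>+x. ennreal (f x) \<partial>M)"
proof -
  have i: "integrable M (\<lambda>x. max 0 (f x))" using assms by (intro integrable_max) auto
  have "(\<integral>x. f x \<partial>M) \<le> (\<integral>x. max 0 (f x) \<partial>M)" using assms i by (intro integral_mono) auto
  then have "ennreal (\<integral>x. f x \<partial>M) \<le> ennreal (\<integral>x. max 0 (f x) \<partial>M)" by (rule ennreal_leI)
  also have "\<dots> = (\<integral>\<^sup>+x. ennreal (max 0 (f x)) \<partial>M)" using i by (intro nn_integral_eq_integral[symmetric]) auto
  also have "\<dots> = (\<integral>\<^sup>+x. ennreal (f x) \<partial>M)" by (intro nn_integral_cong) (auto simp: max_def ennreal_neg)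
  finally show ?thesis .
qed

lemma density_leD:
  "density_le p c \<Longrightarrow> f \<in> borel_measurable borel \<Longrightarrow> (\<integral>\<^sup>+x. f x \<partial>p) \<le> ennreal c * (\<integral>\<^sup>+x. f x \<partial>lborel)"
  by (simp add: density_le_def)

text \<open>The convex combination (1 - e) p + e q, built as a two-stage experiment: a Bernoulli
  variable selects the law to sample from.\<close>

definition mixture :: "real \<Rightarrow> 'a::euclidean_space measure \<Rightarrow> 'a measure \<Rightarrow> 'a measure" where
  "mixture e p q = measure_pmf (bernoulli_pmf e) \<bind> (\<lambda>b. if b then q else p)"

context
  fixes p q :: "'a::euclidean_space measure" and e :: real
  assumes p: "borel_prob p" and q: "borel_prob q" and e: "0 \<le> e" "e \<le> 1"
begin

lemma measurable_mixture_kernel: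
  "(\<lambda>b. if b then q else p) \<in> measurable (measure_pmf (bernoulli_pmf e)) (subprob_algebra borel)"
  using p q by (auto simp: space_subprob_algebra borel_prob_def prob_space_imp_subprob_space)

lemma borel_prob_mixture: "borel_prob (mixture e p q)"
proof -
  have "prob_space (mixture e p q)" unfolding mixture_def
    by (rule measure_pmf.prob_space_bind[OF _ measurable_mixture_kernel])
       (use p q in \<open>auto simp: borel_prob_def\<close>)
  moreover have "sets (mixture e p q) = sets borel" unfolding mixture_def
    by (rule sets_bind) (use p q in \<open>auto simp: borel_prob_def\<close>)
  ultimately show ?thesis by (simp add: borel_prob_def)
qed

lemma nn_integral_mixture:
  assumes [measurable]: "f \<in> borel_measurable borel"
  shows "(\<integral>\<^sup>+x. f x \<partial>mixture e p q) = ennreal e * (\<integral>\<^sup>+x. f x \<partial>q) + ennreal (1 - e) * (\<integral>\<^sup>+x. f x \<partial>p)"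
  unfolding mixture_def
  by (subst nn_integral_bind[OF _ measurable_mixture_kernel])
     (use e in \<open>auto simp: mult.commute\<close>)

end

text \<open>Two consequences of power growth carry the whole argument. \<open>Q_growth\<close>,
  dominance over every multiple of the logarithm, bounds the weighted kernel from below and makes
  \<open>exp (- Q x)\<close> integrable. \<open>Q_slow\<close>, a modulus of continuity relative to
  1 + Q and uniform in x, limits the cost of smoothing at a small scale.\<close>

locale log_field =
  fixes Q :: "'a::euclidean_space \<Rightarrow> real"
  assumes Q_cont: "continuous_on UNIV Q"
    and Q_nonneg: "\<And>x. 0 \<le> Q x"
    and Q_growth: "\<And>\<eta>. \<eta> > 0 \<Longrightarrow> \<exists>C. \<forall>x. ln (1 + norm x) \<le> \<eta> * Q x + C"
    and Q_slow: "\<And>\<delta>. \<delta> > 0 \<Longrightarrow> \<exists>s>0. \<forall>x h. norm h \<le> s \<longrightarrow> \<bar>Q (x + h) - Q x\<bar> \<le> \<delta> * (1 + Q x)"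
begin

lemma Q_measurable [measurable]: "Q \<in> borel_measurable borel"
  using Q_cont by (rule borel_measurable_continuous_onI)

text \<open>Each of the two variables contributes at most Q / 4 + offset / 2 to the negative part of
  the kernel, so a shift by \<open>offset\<close> leaves (Q x + Q y) / 4 of the field to spare, see
  \<open>wker_ge\<close>.\<close>

definition offset :: real where
  "offset = (SOME C. 0 \<le> C \<and> (\<forall>x. ln (1 + norm x) \<le> Q x / 4 + C / 2))"

lemma offset: "0 \<le> offset" "ln (1 + norm x) \<le> Q x / 4 + offset / 2"
proof -
  obtain C where C: "\<And>x. ln (1 + norm x) \<le> (1/4) * Q x + C" using Q_growth[of "1/4"] by auto
  have "0 \<le> 2 * max 0 C \<and> (\<forall>x. ln (1 + norm x) \<le> Q x / 4 + (2 * max 0 C) / 2)"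
  proof (intro conjI allI)
    show "ln (1 + norm x) \<le> Q x / 4 + (2 * max 0 C) / 2" for x using C[of x] by simp
  qed simp
  then have "0 \<le> offset \<and> (\<forall>x. ln (1 + norm x) \<le> Q x / 4 + offset / 2)"
    unfolding offset_def by (rule someI)
  then show "0 \<le> offset" "ln (1 + norm x) \<le> Q x / 4 + offset / 2" by auto
qed

definition wker :: "'a \<Rightarrow> 'a \<Rightarrow> real" where
  "wker x y = log_ker x y + Q x / 2 + Q y / 2"

lemma measurable_wker [measurable]:
  assumes [measurable]: "f \<in> borel_measurable M" "g \<in> borel_measurable M"
  shows "(\<lambda>x. wker (f x) (g x)) \<in> borel_measurable M"
  unfolding wker_def by measurable

lemma wker_sym: "wker x y = wker y x"
  by (simp add: wker_def log_ker_sym)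

lemma wker_ge: "(Q x + Q y) / 4 \<le> wker x y + offset"
proof -
  have "(Q x + Q y) / 4 = (Q x / 2 + Q y / 2) - (Q x / 4 + Q y / 4)" by simp
  then show ?thesis using log_ker_ge[of x y] offset(2)[of x] offset(2)[of y] unfolding wker_def by linarith
qed

lemma wker_offset_nonneg: "0 \<le> wker x y + offset"
  by (rule order_trans[OF _ wker_ge]) (simp add: Q_nonneg)

text \<open>The shift makes the kernel nonnegative, so that energies are integrals in
  \<open>ennreal\<close> and Tonelli applies. Unlike \<open>wker\<close>, the diagonal carries its
  true value, so a measure with an atom has infinite energy.\<close>

definition nker :: "'a \<Rightarrow> 'a \<Rightarrow> ennreal" where
  "nker x y = (if x = y then \<infinity> else ennreal (wker x y + offset))"

lemma measurable_nker [measurable]: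
  assumes [measurable]: "f \<in> borel_measurable M" "g \<in> borel_measurable M"
  shows "(\<lambda>x. nker (f x) (g x)) \<in> borel_measurable M"
  unfolding nker_def by measurable

lemma nker_sym: "nker x y = nker y x"
  by (simp add: nker_def wker_sym)

lemma wkernel_eq: "wkernel Q x y = (if x = y then \<infinity> else ereal (wker x y))"
  by (simp add: wkernel_def wker_def log_ker_def ln_div)

definition nenergy :: "'a measure \<Rightarrow> 'a measure \<Rightarrow> ennreal" where
  "nenergy p q = (\<integral>\<^sup>+x. \<integral>\<^sup>+y. nker x y \<partial>q \<partial>p)"

text \<open>The negative part of the weighted kernel is at most \<open>offset\<close>, hence has a
  finite integral; the difference in \<open>energyQ\<close> therefore never has the form infinity
  minus infinity, and shifting the kernel shifts the energy.\<close>

lemma nenergy_energyQ: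
  assumes p: "borel_prob p"
  shows "enn2ereal (nenergy p p) = energyQ Q p + ereal offset"
proof -
  interpret p: prob_space p using p by (rule borel_probD)
  interpret pair_prob_space p p ..
  note [measurable_cong] = borel_probD(2)[OF p]
  define f where "f z = e2ennreal (wkernel Q (fst z) (snd z))" for z
  define g where "g z = e2ennreal (- wkernel Q (fst z) (snd z))" for z
  have [measurable]: "f \<in> borel_measurable (p \<Otimes>\<^sub>M p)" "g \<in> borel_measurable (p \<Otimes>\<^sub>M p)"
    unfolding f_def g_def wkernel_eq by measurable
  have fg: "nker (fst z) (snd z) + g z = f z + ennreal offset" for z
  proof (cases "fst z = snd z")
    case False
    define w where "w = wker (fst z) (snd z)"
    have w: "w + offset \<ge> 0" unfolding w_def by (rule wker_offset_nonneg)
    have "ennreal (w + offset) + ennreal (- w) = ennreal w + ennreal offset"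
    proof (cases "w \<ge> 0")
      case True
      then show ?thesis using offset(1) by (simp add: ennreal_neg)
    next
      case False
      then have "ennreal (w + offset) + ennreal (- w) = ennreal ((w + offset) + - w)"
        using w by (intro ennreal_plus[symmetric]) auto
      then show ?thesis using False by (simp add: ennreal_neg)
    qed
    then show ?thesis using False by (simp add: f_def g_def nker_def wkernel_eq w_def)
  qed (simp add: f_def nker_def wkernel_eq)
  have g_le: "g z \<le> ennreal offset" for z
    using wker_offset_nonneg[of "fst z" "snd z"]
    by (auto simp: g_def wkernel_eq e2ennreal_neg intro!: ennreal_leI)
  define G where "G = (\<integral>\<^sup>+z. g z \<partial>(p \<Otimes>\<^sub>M p))"
  define F where "F = (\<integral>\<^sup>+z. f z \<partial>(p \<Otimes>\<^sub>M p))"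
  have "G \<le> (\<integral>\<^sup>+z. ennreal offset \<partial>(p \<Otimes>\<^sub>M p))" unfolding G_def by (intro nn_integral_mono g_le)
  then have "G \<le> ennreal offset" using emeasure_space_1 by simp
  then have Gfin: "G \<noteq> \<infinity>" using neq_top_trans[of "ennreal offset" G] by simp
  have N: "nenergy p p = (\<integral>\<^sup>+z. nker (fst z) (snd z) \<partial>(p \<Otimes>\<^sub>M p))"
    unfolding nenergy_def by (subst p.nn_integral_fst[symmetric]) auto
  have "nenergy p p + G = (\<integral>\<^sup>+z. nker (fst z) (snd z) + g z \<partial>(p \<Otimes>\<^sub>M p))"
    unfolding N G_def by (subst nn_integral_add) auto
  also have "\<dots> = F + ennreal offset"
    unfolding fg F_def by (subst nn_integral_add) (auto simp: emeasure_space_1)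
  finally have eq: "nenergy p p + G = F + ennreal offset" .
  obtain G' where G': "G = ennreal G'" "G' \<ge> 0" using Gfin by (cases G) auto
  have e: "energyQ Q p = enn2ereal F - enn2ereal G"
    unfolding energyQ_def F_def G_def f_def g_def ..
  have "enn2ereal (nenergy p p) + ereal G' = enn2ereal F + ereal offset"
    using arg_cong[OF eq, of enn2ereal] G' offset(1) by (simp add: plus_ennreal.rep_eq)
  then show ?thesis unfolding e using G'
    by (cases "enn2ereal (nenergy p p)"; cases "enn2ereal F") auto
qed

lemma equilibrium_nenergy_le:
  assumes "equilibrium_measure Q \<mu>" "borel_prob \<nu>"
  shows "nenergy \<mu> \<mu> \<le> nenergy \<nu> \<nu>"
proof -
  have \<mu>: "borel_prob \<mu>" "energyQ Q \<mu> \<le> energyQ Q \<nu>" using assms by (auto simp: equilibrium_measure_def)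
  then have "energyQ Q \<mu> + ereal offset \<le> energyQ Q \<nu> + ereal offset" by (intro add_right_mono)
  then show ?thesis
    unfolding nenergy_energyQ[OF \<mu>(1), symmetric] nenergy_energyQ[OF assms(2), symmetric]
    by (simp add: less_eq_ennreal.rep_eq)
qed

lemma nenergy_sym:
  assumes p: "borel_prob p" and q: "borel_prob q"
  shows "nenergy p q = nenergy q p"
proof -
  interpret p: prob_space p using p by (rule borel_probD)
  interpret q: prob_space q using q by (rule borel_probD)
  interpret pair_sigma_finite p q ..
  note [measurable_cong] = borel_probD(2)[OF p] borel_probD(2)[OF q]
  have "nenergy q p = (\<integral>\<^sup>+y. \<integral>\<^sup>+x. nker x y \<partial>p \<partial>q)" unfolding nenergy_def by (simp add: nker_sym)
  also have "\<dots> = nenergy p q" unfolding nenergy_def by (rule Fubini') measurable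
  finally show ?thesis ..
qed

lemma nenergy_mixture:
  assumes p: "borel_prob p" and q: "borel_prob q" and e: "0 \<le> e" "e \<le> 1"
  shows "nenergy (mixture e p q) (mixture e p q) =
    ennreal e * (ennreal e * nenergy q q + ennreal (1 - e) * nenergy q p) +
    ennreal (1 - e) * (ennreal e * nenergy p q + ennreal (1 - e) * nenergy p p)"
proof -
  interpret p: prob_space p using p by (rule borel_probD)
  interpret q: prob_space q using q by (rule borel_probD)
  note [measurable_cong] = borel_probD(2)[OF p] borel_probD(2)[OF q]
  note mix = nn_integral_mixture[OF p q e]
  show ?thesis unfolding nenergy_def
    by (simp add: mix nn_integral_add nn_integral_cmult)
qed

text \<open>Compare \<open>\<mu>\<close> with the mixture \<open>(1 - e) \<mu> + e \<beta>\<close> and let \<open>e\<close> tend to 0.\<close>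

lemma equilibrium_first_variation:
  assumes eq: "equilibrium_measure Q \<mu>" and \<beta>: "borel_prob \<beta>" and fin: "nenergy \<beta> \<beta> < \<infinity>"
  shows "nenergy \<mu> \<mu> \<le> nenergy \<mu> \<beta>"
proof (cases "nenergy \<mu> \<beta> = \<infinity>")
  case False
  have \<mu>: "borel_prob \<mu>" using eq by (simp add: equilibrium_measure_def)
  have finA: "nenergy \<mu> \<mu> < \<infinity>" using equilibrium_nenergy_le[OF eq \<beta>] fin by simp
  obtain A where A: "nenergy \<mu> \<mu> = ennreal A" "A \<ge> 0" using finA by (cases "nenergy \<mu> \<mu>") auto
  obtain B where B: "nenergy \<mu> \<beta> = ennreal B" "B \<ge> 0" using False by (cases "nenergy \<mu> \<beta>") auto
  obtain D where D: "nenergy \<beta> \<beta> = ennreal D" "D \<ge> 0" using fin by (cases "nenergy \<beta> \<beta>") auto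
  have ineq: "A * (2 - e) \<le> e * D + 2 * (1 - e) * B" if e: "0 < e" "e < 1" for e
  proof -
    have "ennreal A \<le> nenergy (mixture e \<mu> \<beta>) (mixture e \<mu> \<beta>)"
      unfolding A(1)[symmetric] using e \<mu> \<beta> by (intro equilibrium_nenergy_le[OF eq] borel_prob_mixture) auto
    also have "\<dots> = ennreal (e * (e * D + (1 - e) * B) + (1 - e) * (e * B + (1 - e) * A))"
      using e A B D \<mu> \<beta>
      by (simp add: nenergy_mixture nenergy_sym[of \<beta> \<mu>] ennreal_mult'[symmetric] flip: ennreal_plus)
    finally have "A \<le> e * (e * D + (1 - e) * B) + (1 - e) * (e * B + (1 - e) * A)"
      by (rule ennreal_le_iff[THEN iffD1, rotated]) (use e A B D in auto)
    \<comment> \<open>From 1 - (1 - e)^2 = e (2 - e): the order-zero terms in e cancel, and division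
      by e isolates the first variation.\<close>
    then have "e * (A * (2 - e)) \<le> e * (e * D + 2 * (1 - e) * B)"
      by (simp add: algebra_simps)
    then show ?thesis using e by simp
  qed
  have "A * (2 - 0) \<le> 0 * D + 2 * (1 - 0) * B"
  proof (rule tendsto_le[of "at_right (0::real)"])
    show "((\<lambda>e. A * (2 - e)) \<longlongrightarrow> A * (2 - 0)) (at_right 0)" by (intro tendsto_intros)
    show "((\<lambda>e. e * D + 2 * (1 - e) * B) \<longlongrightarrow> 0 * D + 2 * (1 - 0) * B) (at_right 0)" by (intro tendsto_intros)
    show "\<forall>\<^sub>F e in at_right 0. A * (2 - e) \<le> e * D + 2 * (1 - e) * B"
      using ineq unfolding eventually_at_right_field by (intro exI[of _ 1]) auto
  qed auto
  then show ?thesis using A B by (simp add: ennreal_leI)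
qed simp

lemma density_le_AE_neq:
  assumes p: "borel_prob p" and d: "density_le p c"
  shows "AE y in p. y \<noteq> x"
proof (rule AE_I'[of "{x}"])
  have "emeasure p {x} = (\<integral>\<^sup>+y. indicator {x} y \<partial>p)"
    using borel_probD(2)[OF p] by (subst nn_integral_indicator) auto
  also have "\<dots> \<le> ennreal c * (\<integral>\<^sup>+y. indicator {x} y \<partial>lborel)"
    by (rule density_leD[OF d]) simp
  also have "\<dots> = 0" by simp
  finally show "{x} \<in> null_sets p" using borel_probD(2)[OF p] by auto
qed auto

text \<open>The kernel is dominated by the inverse square root singularity plus the field at both
  points. The domination holds off the diagonal only, and each diagonal section is a null set
  because the density is bounded.\<close>

lemma nenergy_density_le_finite:
  assumes p: "borel_prob p" and d: "density_le p c" and q: "(\<integral>\<^sup>+x. ennreal (Q x) \<partial>p) < \<infinity>"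
  shows "nenergy p p < \<infinity>"
proof -
  interpret p: prob_space p using p by (rule borel_probD)
  note [measurable_cong] = borel_probD(2)[OF p]
  obtain B where B: "B \<ge> 0" "\<And>y. (\<integral>\<^sup>+x. ennreal (1 / sqrt (norm (x - y))) \<partial>p) \<le> ennreal B"
    using density_le_singularity[OF p d] by blast
  have "nenergy p p \<le> (\<integral>\<^sup>+x. \<integral>\<^sup>+y. 2 * ennreal (1 / sqrt (norm (y - x))) + ennreal (Q x) + ennreal (Q y) + ennreal offset \<partial>p \<partial>p)"
    unfolding nenergy_def
  proof (rule nn_integral_mono, rule nn_integral_mono_AE)
    fix x
    show "AE y in p. nker x y \<le> 2 * ennreal (1 / sqrt (norm (y - x))) + ennreal (Q x) + ennreal (Q y) + ennreal offset"
      using density_le_AE_neq[OF p d, of x]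
    proof eventually_elim
      case (elim y)
      have "wker x y + offset \<le> 2 * (1 / sqrt (norm (y - x))) + Q x + Q y + offset"
        using log_ker_le_sqrt[of y x] Q_nonneg[of x] Q_nonneg[of y] unfolding wker_def log_ker_sym[of x] by linarith
      then have "nker x y \<le> ennreal (2 * (1 / sqrt (norm (y - x))) + Q x + Q y + offset)"
        using elim by (simp add: nker_def ennreal_leI)
      also have "\<dots> = 2 * ennreal (1 / sqrt (norm (y - x))) + ennreal (Q x) + ennreal (Q y) + ennreal offset"
      proof -
        have "ennreal (2 * a) = 2 * ennreal a" for a by (simp add: ennreal_mult')
        then show ?thesis using Q_nonneg offset(1) by (simp del: times_divide_eq_right)
      qed
      finally show ?case .
    qed
  qed
  also have "\<dots> = (\<integral>\<^sup>+x. 2 * (\<integral>\<^sup>+y. ennreal (1 / sqrt (norm (y - x))) \<partial>p) + ennreal (Q x) + (\<integral>\<^sup>+y. ennreal (Q y) \<partial>p) + ennreal offset \<partial>p)"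
    by (simp add: nn_integral_add nn_integral_cmult p.emeasure_space_1)
  also have "\<dots> \<le> (\<integral>\<^sup>+x. 2 * ennreal B + ennreal (Q x) + (\<integral>\<^sup>+y. ennreal (Q y) \<partial>p) + ennreal offset \<partial>p)"
    by (intro nn_integral_mono add_mono mult_left_mono B) auto
  also have "\<dots> = 2 * ennreal B + (\<integral>\<^sup>+x. ennreal (Q x) \<partial>p) + (\<integral>\<^sup>+y. ennreal (Q y) \<partial>p) + ennreal offset"
    by (simp add: nn_integral_add p.emeasure_space_1)
  also have "\<dots> < \<infinity>" using q by (simp add: ennreal_mult_less_top)
  finally show ?thesis .
qed

lemma Q_le_smear:
  assumes sl: "\<And>x h. norm h \<le> s \<Longrightarrow> \<bar>Q (x + h) - Q x\<bar> \<le> \<delta> * (1 + Q x)" and s: "s > 0" and p: "borel_prob p"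
  shows "(\<integral>\<^sup>+z. ennreal (Q z) \<partial>smear p (unif_ball s)) \<le> (\<integral>\<^sup>+x. ennreal (Q x + \<delta> * (1 + Q x)) \<partial>p)"
proof -
  interpret u: prob_space "unif_ball s :: 'a measure" using borel_prob_unif_ball[OF s] by (rule borel_probD)
  note [measurable_cong] = borel_probD(2)[OF p]
  have "(\<integral>\<^sup>+z. ennreal (Q z) \<partial>smear p (unif_ball s)) = (\<integral>\<^sup>+x. \<integral>\<^sup>+h. ennreal (Q (x + h)) \<partial>unif_ball s \<partial>p)"
    by (rule nn_integral_smear(1)[OF p borel_prob_unif_ball[OF s]]) measurable
  also have "\<dots> \<le> (\<integral>\<^sup>+x. \<integral>\<^sup>+h. ennreal (Q x + \<delta> * (1 + Q x)) \<partial>(unif_ball s :: 'a measure) \<partial>p)"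
  proof (rule nn_integral_mono, rule nn_integral_mono_AE)
    fix x
    show "AE h in unif_ball s. ennreal (Q (x + h)) \<le> ennreal (Q x + \<delta> * (1 + Q x))"
      using AE_unif_ball[OF s]
    proof eventually_elim
      case (elim h)
      then show ?case using sl[of h x] by (intro ennreal_leI) linarith
    qed
  qed
  also have "\<dots> = (\<integral>\<^sup>+x. ennreal (Q x + \<delta> * (1 + Q x)) \<partial>p)" by (simp add: u.emeasure_space_1)
  finally show ?thesis .
qed

text \<open>The uniform law on a ball around y is an admissible competitor. The centre 0 shows that
  the minimal energy is finite; a general centre gives the Euler--Lagrange inequality.\<close>

lemma smear_return_finite:
  assumes sl: "\<And>x h. norm h \<le> s \<Longrightarrow> \<bar>Q (x + h) - Q x\<bar> \<le> \<delta> * (1 + Q x)" and s: "s > 0"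
  shows "borel_prob (smear (return borel y) (unif_ball s))" "nenergy (smear (return borel y) (unif_ball s)) (smear (return borel y) (unif_ball s)) < \<infinity>"
proof -
  have r: "borel_prob (return borel y)" by (simp add: borel_prob_def prob_space_return)
  show b: "borel_prob (smear (return borel y) (unif_ball s))" by (rule borel_prob_smear[OF r borel_prob_unif_ball[OF s]])
  have "(\<integral>\<^sup>+z. ennreal (Q z) \<partial>smear (return borel y) (unif_ball s)) \<le> (\<integral>\<^sup>+x. ennreal (Q x + \<delta> * (1 + Q x)) \<partial>return borel y)"
    by (rule Q_le_smear[OF sl s r])
  also have "\<dots> < \<infinity>" by (subst nn_integral_return) auto
  finally show "nenergy (smear (return borel y) (unif_ball s)) (smear (return borel y) (unif_ball s)) < \<infinity>"
    by (rule nenergy_density_le_finite[OF b density_le_smear_unif_ball[OF s r]])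
qed

end

lemma pair_marginals:
  fixes f :: "'a \<Rightarrow> real" and g :: "'b \<Rightarrow> real"
  assumes p: "prob_space p" and q: "prob_space q"
  shows "integrable p f \<Longrightarrow> integrable (p \<Otimes>\<^sub>M q) (\<lambda>z. f (fst z))"
    "integrable p f \<Longrightarrow> (\<integral>z. f (fst z) \<partial>(p \<Otimes>\<^sub>M q)) = (\<integral>x. f x \<partial>p)"
    "integrable q g \<Longrightarrow> integrable (p \<Otimes>\<^sub>M q) (\<lambda>z. g (snd z))"
    "integrable q g \<Longrightarrow> (\<integral>z. g (snd z) \<partial>(p \<Otimes>\<^sub>M q)) = (\<integral>x. g x \<partial>q)"
proof -
  interpret p: prob_space p by fact
  interpret q: prob_space q by fact
  interpret pair_prob_space p q ..
  have 1: "distr (p \<Otimes>\<^sub>M q) p fst = p" by (rule q.distr_pair_fst)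
  have 2: "distr (p \<Otimes>\<^sub>M q) q snd = q"
    by (subst distr_pair_swap) (simp add: distr_distr comp_def case_prod_unfold p.distr_pair_fst[of q, unfolded])
  show "integrable (p \<Otimes>\<^sub>M q) (\<lambda>z. f (fst z))" if "integrable p f"
    using that by (subst (asm) 1[symmetric], subst (asm) integrable_distr_eq) auto
  show "(\<integral>z. f (fst z) \<partial>(p \<Otimes>\<^sub>M q)) = (\<integral>x. f x \<partial>p)" if "integrable p f"
    using that by (subst (2) 1[symmetric], subst integral_distr) auto
  show "integrable (p \<Otimes>\<^sub>M q) (\<lambda>z. g (snd z))" if "integrable q g"
    using that by (subst (asm) 2[symmetric], subst (asm) integrable_distr_eq) auto
  show "(\<integral>z. g (snd z) \<partial>(p \<Otimes>\<^sub>M q)) = (\<integral>x. g x \<partial>q)" if "integrable q g"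
    using that by (subst (2) 2[symmetric], subst integral_distr) auto
qed

text \<open>The bound B on the singularity, uniform in the base point, controls both the logarithmic
  potential near its pole and the truncation error; integrability of Q controls the far
  field.\<close>

locale regular_measure = log_field Q for Q :: "'a::euclidean_space \<Rightarrow> real" +
  fixes p :: "'a measure" and B :: real
  assumes p: "borel_prob p"
    and B: "0 \<le> B" "\<And>y. (\<integral>\<^sup>+x. ennreal (1 / sqrt (norm (x - y))) \<partial>p) \<le> ennreal B"
    and Q_int: "integrable p Q"
begin

sublocale p: prob_space p using p by (rule borel_probD)
sublocale pp: pair_prob_space p p ..

lemmas [measurable_cong] = borel_probD(2)[OF p]

lemma sing_integrable: "integrable p (\<lambda>x. 1 / sqrt (norm (x - y)))"
  using B(2)[of y] by (intro integrableI_bounded) (auto intro: le_less_trans)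

lemma sing_integral_le: "(\<integral>x. 1 / sqrt (norm (x - y)) \<partial>p) \<le> B"
proof -
  have "ennreal (\<integral>x. 1 / sqrt (norm (x - y)) \<partial>p) \<le> ennreal B"
    using B(2)[of y] nn_integral_eq_integral[OF sing_integrable[of y]] by simp
  then show ?thesis using B(1) by (simp add: ennreal_le_iff)
qed

lemma pair_sing: "integrable (p \<Otimes>\<^sub>M p) (\<lambda>z. 1 / sqrt (norm (fst z - snd z)))"
  "(\<integral>z. 1 / sqrt (norm (fst z - snd z)) \<partial>(p \<Otimes>\<^sub>M p)) \<le> B"
proof -
  have "(\<integral>\<^sup>+z. ennreal (1 / sqrt (norm (fst z - snd z))) \<partial>(p \<Otimes>\<^sub>M p))
    = (\<integral>\<^sup>+x. \<integral>\<^sup>+y. ennreal (1 / sqrt (norm (y - x))) \<partial>p \<partial>p)"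
    by (subst p.nn_integral_fst[symmetric]) (auto simp: norm_minus_commute)
  also have "\<dots> \<le> (\<integral>\<^sup>+x. ennreal B \<partial>p)" by (intro nn_integral_mono B)
  finally have le: "(\<integral>\<^sup>+z. ennreal (1 / sqrt (norm (fst z - snd z))) \<partial>(p \<Otimes>\<^sub>M p)) \<le> ennreal B"
    by (simp add: p.emeasure_space_1)
  show i: "integrable (p \<Otimes>\<^sub>M p) (\<lambda>z. 1 / sqrt (norm (fst z - snd z)))"
    by (rule integrableI_bounded) (use le in \<open>auto intro: le_less_trans\<close>)
  show "(\<integral>z. 1 / sqrt (norm (fst z - snd z)) \<partial>(p \<Otimes>\<^sub>M p)) \<le> B"
    using le nn_integral_eq_integral[OF i] B(1) by (simp add: ennreal_le_iff)
qed

lemma abs_log_ker_le: "\<bar>log_ker x y\<bar> \<le> 2 * (1 / sqrt (norm (x - y))) + Q x + Q y + offset"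
proof -
  define S where "S = 1 / sqrt (norm (x - y))"
  have "0 \<le> S" by (simp add: S_def)
  moreover have "log_ker x y \<le> 2 * S" unfolding S_def by (rule log_ker_le_sqrt)
  ultimately show ?thesis
    using wker_ge[of x y] Q_nonneg[of x] Q_nonneg[of y] offset(1)
    unfolding wker_def abs_le_iff S_def[symmetric] by (simp add: add_divide_distrib)
qed

lemma pot_integrable: "integrable p (\<lambda>x. log_ker x y)"
proof (rule Bochner_Integration.integrable_bound)
  show "integrable p (\<lambda>x. 2 * (1 / sqrt (norm (x - y))) + Q x + Q y + offset)"
    using sing_integrable[of y] Q_int by (intro Bochner_Integration.integrable_add integrable_mult_right) auto
  show "AE x in p. norm (log_ker x y) \<le> norm (2 * (1 / sqrt (norm (x - y))) + Q x + Q y + offset)"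
    using abs_log_ker_le by (intro AE_I2) (auto intro: order_trans[OF _ abs_ge_self])
qed measurable

lemma energy_integrable: "integrable (p \<Otimes>\<^sub>M p) (\<lambda>z. log_ker (fst z) (snd z))"
proof (rule Bochner_Integration.integrable_bound)
  show "integrable (p \<Otimes>\<^sub>M p) (\<lambda>z. 2 * (1 / sqrt (norm (fst z - snd z))) + Q (fst z) + Q (snd z) + offset)"
    using pair_sing(1) pair_marginals[OF p.prob_space_axioms p.prob_space_axioms] Q_int
    by (intro Bochner_Integration.integrable_add integrable_mult_right) auto
  show "AE z in p \<Otimes>\<^sub>M p. norm (log_ker (fst z) (snd z)) \<le> norm (2 * (1 / sqrt (norm (fst z - snd z))) + Q (fst z) + Q (snd z) + offset)"
    using abs_log_ker_le by (intro AE_I2) (auto intro: order_trans[OF _ abs_ge_self])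
qed measurable

text \<open>\<open>regularized_log_le\<close> integrated against p. Nonnegativity of the bound is
  recorded as well, since only then can the inequality be read back from \<open>ennreal\<close> to
  the reals.\<close>

lemma regularized_pot_le:
  assumes \<rho>: "0 < \<rho>" "\<rho> \<le> 1"
  shows "(\<integral>\<^sup>+x. ennreal (ln (1 + (norm (y - x))\<^sup>2 / \<rho>^4) / 2) \<partial>p)
    \<le> ennreal (- (\<integral>x. log_ker x y \<partial>p) - ln (\<rho>^4) / 2 + 2 * \<rho> * B)"
    "0 \<le> - (\<integral>x. log_ker x y \<partial>p) - ln (\<rho>^4) / 2 + 2 * \<rho> * B"
proof -
  let ?f = "\<lambda>x. - log_ker x y - ln (\<rho>^4) / 2 + 2 * \<rho> * (1 / sqrt (norm (x - y)))"
  have le: "ln (1 + (norm (x - y))\<^sup>2 / \<rho>^4) / 2 \<le> ?f x" for x by (rule regularized_log_le[OF \<rho>])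
  have nn: "0 \<le> ?f x" for x
    by (rule order_trans[OF _ le]) (use \<rho> in \<open>auto intro!: ln_ge_zero\<close>)
  have i: "integrable p ?f"
    using pot_integrable[of y] sing_integrable[of y]
    by (intro Bochner_Integration.integrable_add Bochner_Integration.integrable_diff integrable_mult_right integrable_minus) auto
  have "(\<integral>x. ?f x \<partial>p) = - (\<integral>x. log_ker x y \<partial>p) - ln (\<rho>^4) / 2 + 2 * \<rho> * (\<integral>x. 1 / sqrt (norm (x - y)) \<partial>p)"
    using pot_integrable[of y] sing_integrable[of y]
    by (subst Bochner_Integration.integral_add; (subst Bochner_Integration.integral_diff)?) (auto simp: p.prob_space simp del: times_divide_eq_right)
  also have "\<dots> \<le> - (\<integral>x. log_ker x y \<partial>p) - ln (\<rho>^4) / 2 + 2 * \<rho> * B"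
    using sing_integral_le[of y] \<rho> by (intro add_mono mult_left_mono) auto
  finally have le2: "(\<integral>x. ?f x \<partial>p) \<le> - (\<integral>x. log_ker x y \<partial>p) - ln (\<rho>^4) / 2 + 2 * \<rho> * B" .
  then show "0 \<le> - (\<integral>x. log_ker x y \<partial>p) - ln (\<rho>^4) / 2 + 2 * \<rho> * B"
    by (rule order_trans[rotated]) (intro Bochner_Integration.integral_nonneg nn)
  have "(\<integral>\<^sup>+x. ennreal (ln (1 + (norm (y - x))\<^sup>2 / \<rho>^4) / 2) \<partial>p) \<le> (\<integral>\<^sup>+x. ennreal (?f x) \<partial>p)"
    using le by (intro nn_integral_mono ennreal_leI) (simp add: norm_minus_commute)
  also have "\<dots> = ennreal (\<integral>x. ?f x \<partial>p)" by (rule nn_integral_eq_integral[OF i]) (use nn in auto)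
  also have "\<dots> \<le> ennreal (- (\<integral>x. log_ker x y \<partial>p) - ln (\<rho>^4) / 2 + 2 * \<rho> * B)"
    by (intro ennreal_leI le2)
  finally show "(\<integral>\<^sup>+x. ennreal (ln (1 + (norm (y - x))\<^sup>2 / \<rho>^4) / 2) \<partial>p)
    \<le> ennreal (- (\<integral>x. log_ker x y \<partial>p) - ln (\<rho>^4) / 2 + 2 * \<rho> * B)" .
qed

lemma regularized_energy_le:
  assumes \<rho>: "0 < \<rho>" "\<rho> \<le> 1"
  shows "log_energy (\<rho>^4) p p \<le> ennreal (- (\<integral>z. log_ker (fst z) (snd z) \<partial>(p \<Otimes>\<^sub>M p)) - ln (\<rho>^4) / 2 + 2 * \<rho> * B)"
    "0 \<le> - (\<integral>z. log_ker (fst z) (snd z) \<partial>(p \<Otimes>\<^sub>M p)) - ln (\<rho>^4) / 2 + 2 * \<rho> * B"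
proof -
  let ?f = "\<lambda>z. - log_ker (fst z) (snd z) - ln (\<rho>^4) / 2 + 2 * \<rho> * (1 / sqrt (norm (fst z - snd z)))"
  have le: "ln (1 + (norm (fst z - snd z))\<^sup>2 / \<rho>^4) / 2 \<le> ?f z" for z :: "'a \<times> 'a" by (rule regularized_log_le[OF \<rho>])
  have nn: "0 \<le> ?f z" for z :: "'a \<times> 'a"
    by (rule order_trans[OF _ le]) (use \<rho> in \<open>auto intro!: ln_ge_zero\<close>)
  have i: "integrable (p \<Otimes>\<^sub>M p) ?f"
    using energy_integrable pair_sing(1)
    by (intro Bochner_Integration.integrable_add Bochner_Integration.integrable_diff integrable_mult_right integrable_minus) auto
  have e: "(\<integral>z. ?f z \<partial>(p \<Otimes>\<^sub>M p)) = - (\<integral>z. log_ker (fst z) (snd z) \<partial>(p \<Otimes>\<^sub>M p)) - ln (\<rho>^4) / 2 + 2 * \<rho> * (\<integral>z. 1 / sqrt (norm (fst z - snd z)) \<partial>(p \<Otimes>\<^sub>M p))"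
    using energy_integrable pair_sing(1)
    by (subst Bochner_Integration.integral_add; (subst Bochner_Integration.integral_diff)?) (auto simp: pp.prob_space simp del: times_divide_eq_right)
  also have "\<dots> \<le> - (\<integral>z. log_ker (fst z) (snd z) \<partial>(p \<Otimes>\<^sub>M p)) - ln (\<rho>^4) / 2 + 2 * \<rho> * B"
    using pair_sing(2) \<rho> by (intro add_mono mult_left_mono) auto
  finally have le2: "(\<integral>z. ?f z \<partial>(p \<Otimes>\<^sub>M p)) \<le> - (\<integral>z. log_ker (fst z) (snd z) \<partial>(p \<Otimes>\<^sub>M p)) - ln (\<rho>^4) / 2 + 2 * \<rho> * B" .
  then show "0 \<le> - (\<integral>z. log_ker (fst z) (snd z) \<partial>(p \<Otimes>\<^sub>M p)) - ln (\<rho>^4) / 2 + 2 * \<rho> * B"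
    by (rule order_trans[rotated]) (intro Bochner_Integration.integral_nonneg nn)
  have "log_energy (\<rho>^4) p p = (\<integral>\<^sup>+z. ennreal (ln (1 + (norm (fst z - snd z))\<^sup>2 / \<rho>^4) / 2) \<partial>(p \<Otimes>\<^sub>M p))"
    unfolding log_energy_def by (subst p.nn_integral_fst[symmetric]) auto
  also have "\<dots> \<le> (\<integral>\<^sup>+z. ennreal (?f z) \<partial>(p \<Otimes>\<^sub>M p))"
    using le by (intro nn_integral_mono ennreal_leI) auto
  also have "\<dots> = ennreal (\<integral>z. ?f z \<partial>(p \<Otimes>\<^sub>M p))" by (rule nn_integral_eq_integral[OF i]) (use nn in auto)
  also have "\<dots> \<le> ennreal (- (\<integral>z. log_ker (fst z) (snd z) \<partial>(p \<Otimes>\<^sub>M p)) - ln (\<rho>^4) / 2 + 2 * \<rho> * B)"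
    by (intro ennreal_leI le2)
  finally show "log_energy (\<rho>^4) p p \<le> ennreal (- (\<integral>z. log_ker (fst z) (snd z) \<partial>(p \<Otimes>\<^sub>M p)) - ln (\<rho>^4) / 2 + 2 * \<rho> * B)" .
qed

end

section \<open>Finite energy of the equilibrium measure\<close>

locale log_equilibrium = log_field Q for Q :: "'a::euclidean_space \<Rightarrow> real" +
  fixes \<mu> :: "'a measure"
  assumes equilibrium: "equilibrium_measure Q \<mu>"
begin

lemma \<mu>: "borel_prob \<mu>" using equilibrium by (simp add: equilibrium_measure_def)

sublocale \<mu>: prob_space \<mu> using \<mu> by (rule borel_probD)
sublocale \<mu>\<mu>: pair_prob_space \<mu> \<mu> ..

lemmas \<mu>_cong [measurable_cong] = borel_probD(2)[OF \<mu>]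

lemma nenergy_\<mu>_finite: "nenergy \<mu> \<mu> < \<infinity>"
proof -
  obtain s where "s > 0" "\<And>x h. norm h \<le> s \<Longrightarrow> \<bar>Q (x + h) - Q x\<bar> \<le> 1 * (1 + Q x)"
    using Q_slow[of 1] by auto
  from smear_return_finite[OF this(2,1), of 0] equilibrium_nenergy_le[OF equilibrium]
  show ?thesis by (meson le_less_trans)
qed

lemma nenergy_pair: "nenergy \<mu> \<mu> = (\<integral>\<^sup>+z. nker (fst z) (snd z) \<partial>(\<mu> \<Otimes>\<^sub>M \<mu>))"
  unfolding nenergy_def by (subst \<mu>.nn_integral_fst[symmetric]) auto

text \<open>Finite energy forbids mass on the diagonal, where \<open>nker\<close> is infinite; from
  here on the conventional value of \<open>log_ker\<close> there is harmless.\<close>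

lemma AE_offdiag: "AE z in \<mu> \<Otimes>\<^sub>M \<mu>. fst z \<noteq> snd z"
proof -
  have "AE z in \<mu> \<Otimes>\<^sub>M \<mu>. nker (fst z) (snd z) \<noteq> \<infinity>"
    using nenergy_\<mu>_finite nenergy_pair by (intro nn_integral_PInf_AE) auto
  then show ?thesis by eventually_elim (auto simp: nker_def)
qed

lemma nenergy_wker: "nenergy \<mu> \<mu> = (\<integral>\<^sup>+z. ennreal (wker (fst z) (snd z) + offset) \<partial>(\<mu> \<Otimes>\<^sub>M \<mu>))"
  unfolding nenergy_pair
  by (rule nn_integral_cong_AE) (use AE_offdiag in eventually_elim, simp add: nker_def)

lemma wker_offset_integrable: "integrable (\<mu> \<Otimes>\<^sub>M \<mu>) (\<lambda>z. wker (fst z) (snd z) + offset)"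
  using nenergy_\<mu>_finite nenergy_wker by (intro integrableI_bounded) (auto simp: wker_offset_nonneg)

text \<open>The share (Q x + Q y) / 4 kept in reserve by \<open>wker_ge\<close> turns finite energy
  into a finite field integral, so the logarithmic part can be split off without infinities.\<close>

lemma Q_integrable: "integrable \<mu> Q"
proof -
  have "(\<integral>\<^sup>+x. ennreal (Q x / 4) \<partial>\<mu>) = (\<integral>\<^sup>+x. \<integral>\<^sup>+y. ennreal (Q x / 4) \<partial>\<mu> \<partial>\<mu>)"
    by (simp add: \<mu>.emeasure_space_1)
  also have "\<dots> \<le> nenergy \<mu> \<mu>" unfolding nenergy_def
  proof (intro nn_integral_mono)
    fix x y
    have "Q x / 4 \<le> (Q x + Q y) / 4" using Q_nonneg[of y] by simp
    then have "Q x / 4 \<le> wker x y + offset" using wker_ge[of x y] by linarith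
    then show "ennreal (Q x / 4) \<le> nker x y" by (auto simp: nker_def ennreal_leI)
  qed
  finally have "(\<integral>\<^sup>+x. ennreal (Q x / 4) \<partial>\<mu>) < \<infinity>" using nenergy_\<mu>_finite by (rule le_less_trans)
  then have "integrable \<mu> (\<lambda>x. Q x / 4)" by (intro integrableI_bounded) (auto simp: Q_nonneg)
  then have "integrable \<mu> (\<lambda>x. 4 * (Q x / 4))" by (rule integrable_mult_right)
  then show ?thesis by simp
qed

text \<open>The logarithmic and the field part of the minimal energy are kept apart: smoothing
  lowers the first but may raise the second, and the Euler--Lagrange inequality weights them
  differently.\<close>

definition L\<mu> :: real where "L\<mu> = (\<integral>z. log_ker (fst z) (snd z) \<partial>(\<mu> \<Otimes>\<^sub>M \<mu>))"
definition q\<mu> :: real where "q\<mu> = (\<integral>x. Q x \<partial>\<mu>)"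

lemma q\<mu>_nonneg: "q\<mu> \<ge> 0" unfolding q\<mu>_def by (intro Bochner_Integration.integral_nonneg Q_nonneg)

lemma L\<mu>_integrable: "integrable (\<mu> \<Otimes>\<^sub>M \<mu>) (\<lambda>z. log_ker (fst z) (snd z))"
proof -
  note m = pair_marginals[OF \<mu>.prob_space_axioms \<mu>.prob_space_axioms]
  have "integrable (\<mu> \<Otimes>\<^sub>M \<mu>) (\<lambda>z. (wker (fst z) (snd z) + offset) - Q (fst z) / 2 - Q (snd z) / 2 - offset)"
    using wker_offset_integrable m(1,3)[OF Q_integrable]
    by (intro Bochner_Integration.integrable_diff) auto
  then show ?thesis by (simp add: wker_def)
qed

lemma nenergy_L\<mu>: "nenergy \<mu> \<mu> = ennreal (L\<mu> + q\<mu> + offset)"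
proof -
  note m = pair_marginals[OF \<mu>.prob_space_axioms \<mu>.prob_space_axioms]
  have "nenergy \<mu> \<mu> = ennreal (\<integral>z. wker (fst z) (snd z) + offset \<partial>(\<mu> \<Otimes>\<^sub>M \<mu>))"
    unfolding nenergy_wker by (rule nn_integral_eq_integral[OF wker_offset_integrable]) (simp add: wker_offset_nonneg)
  also have "(\<integral>z. wker (fst z) (snd z) + offset \<partial>(\<mu> \<Otimes>\<^sub>M \<mu>)) = L\<mu> + q\<mu> / 2 + q\<mu> / 2 + offset"
    unfolding wker_def L\<mu>_def q\<mu>_def m(2)[OF Q_integrable, symmetric]
    using L\<mu>_integrable m(1,3)[OF Q_integrable] m(2,4)[OF Q_integrable]
    by (simp add: \<mu>\<mu>.prob_space)
  finally show ?thesis by (simp add: algebra_simps)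
qed

lemma log_energy_\<mu>_ge:
  assumes "\<eta> > 0" shows "ennreal (- L\<mu> - ln \<eta> / 2) \<le> log_energy \<eta> \<mu> \<mu>"
proof -
  have "ennreal (- L\<mu> - ln \<eta> / 2) = ennreal (\<integral>z. - log_ker (fst z) (snd z) - ln \<eta> / 2 \<partial>(\<mu> \<Otimes>\<^sub>M \<mu>))"
    using L\<mu>_integrable by (simp add: L\<mu>_def \<mu>\<mu>.prob_space)
  also have "\<dots> \<le> (\<integral>\<^sup>+z. ennreal (- log_ker (fst z) (snd z) - ln \<eta> / 2) \<partial>(\<mu> \<Otimes>\<^sub>M \<mu>))"
    by (rule ennreal_integral_le_nn_integral) (use L\<mu>_integrable in simp)
  also have "\<dots> \<le> (\<integral>\<^sup>+z. ennreal (ln (1 + (norm (fst z - snd z))\<^sup>2 / \<eta>) / 2) \<partial>(\<mu> \<Otimes>\<^sub>M \<mu>))"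
    by (rule nn_integral_mono_AE, use AE_offdiag in eventually_elim) (auto intro!: ennreal_leI regularized_log_ge assms)
  also have "\<dots> = log_energy \<eta> \<mu> \<mu>"
    unfolding log_energy_def by (subst \<mu>.nn_integral_fst[symmetric]) auto
  finally show ?thesis .
qed

end

section \<open>The smoothed equilibrium measure\<close>

locale smoothed_equilibrium = log_equilibrium Q \<mu> for Q :: "'a::euclidean_space \<Rightarrow> real" and \<mu> +
  fixes s \<delta> :: real
  assumes s: "s > 0" and \<delta>: "\<delta> \<ge> 0"
    and slow: "\<And>x h. norm h \<le> s \<Longrightarrow> \<bar>Q (x + h) - Q x\<bar> \<le> \<delta> * (1 + Q x)"
begin

definition \<mu>s :: "'a measure" where "\<mu>s = smear \<mu> (unif_ball s)"

lemma \<mu>s: "borel_prob \<mu>s"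
  unfolding \<mu>s_def by (rule borel_prob_smear[OF \<mu> borel_prob_unif_ball[OF s]])

lemma density_le_\<mu>s: "density_le \<mu>s (1 / measure lborel (cball (0::'a) s))"
  unfolding \<mu>s_def by (rule density_le_smear_unif_ball[OF s \<mu>])

definition Bs :: real where
  "Bs = (SOME B. 0 \<le> B \<and> (\<forall>y. (\<integral>\<^sup>+x. ennreal (1 / sqrt (norm (x - y))) \<partial>\<mu>s) \<le> ennreal B))"

lemma Bs: "0 \<le> Bs \<and> (\<forall>y. (\<integral>\<^sup>+x. ennreal (1 / sqrt (norm (x - y))) \<partial>\<mu>s) \<le> ennreal Bs)"
  unfolding Bs_def by (rule someI_ex) (use density_le_singularity[OF \<mu>s density_le_\<mu>s] in auto)

lemma nn_Q_\<mu>s: "(\<integral>\<^sup>+x. ennreal (Q x) \<partial>\<mu>s) \<le> ennreal (q\<mu> + \<delta> * (1 + q\<mu>))"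
proof -
  have "(\<integral>\<^sup>+x. ennreal (Q x) \<partial>\<mu>s) \<le> (\<integral>\<^sup>+x. ennreal (Q x + \<delta> * (1 + Q x)) \<partial>\<mu>)"
    unfolding \<mu>s_def by (rule Q_le_smear[OF slow s \<mu>])
  also have "\<dots> = ennreal (\<integral>x. Q x + \<delta> * (1 + Q x) \<partial>\<mu>)"
    using Q_integrable \<delta> Q_nonneg by (intro nn_integral_eq_integral) auto
  also have "(\<integral>x. Q x + \<delta> * (1 + Q x) \<partial>\<mu>) = q\<mu> + \<delta> * (1 + q\<mu>)"
    using Q_integrable by (simp add: q\<mu>_def \<mu>.prob_space)
  finally show ?thesis .
qed

lemma Q_integrable_\<mu>s: "integrable \<mu>s Q"
  using nn_Q_\<mu>s borel_probD(2)[OF \<mu>s] by (intro integrableI_bounded) (auto simp: Q_nonneg intro: le_less_trans cong: measurable_cong_sets)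

sublocale \<mu>s: regular_measure Q \<mu>s Bs
  by unfold_locales (use Bs \<mu>s Q_integrable_\<mu>s in auto)

lemma Q_\<mu>s_le: "(\<integral>x. Q x \<partial>\<mu>s) \<le> q\<mu> + \<delta> * (1 + q\<mu>)"
proof -
  have "ennreal (\<integral>x. Q x \<partial>\<mu>s) \<le> ennreal (q\<mu> + \<delta> * (1 + q\<mu>))"
    using nn_Q_\<mu>s nn_integral_eq_integral[OF Q_integrable_\<mu>s] by (simp add: Q_nonneg)
  then show ?thesis using q\<mu>_nonneg \<delta> by (simp del: ennreal_plus add: ennreal_le_iff)
qed

text \<open>Monotonicity under smearing is available for the truncated kernel. On the side of \<mu>
  the truncation is removed for free, on the side of \<open>\<mu>s\<close> it costs 2 \<rho>
  \<open>Bs\<close>; the terms in ln \<rho> cancel and \<rho> tends to 0.\<close>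

lemma energy_\<mu>s_le: "(\<integral>z. log_ker (fst z) (snd z) \<partial>(\<mu>s \<Otimes>\<^sub>M \<mu>s)) \<le> L\<mu>"
proof -
  let ?L = "\<integral>z. log_ker (fst z) (snd z) \<partial>(\<mu>s \<Otimes>\<^sub>M \<mu>s)"
  have *: "?L \<le> L\<mu> + 2 * \<rho> * Bs" if \<rho>: "0 < \<rho>" "\<rho> < 1" for \<rho>
  proof -
    have "ennreal (- L\<mu> - ln (\<rho>^4) / 2) \<le> log_energy (\<rho>^4) \<mu> \<mu>"
      by (rule log_energy_\<mu>_ge) (use \<rho> in auto)
    also have "\<dots> \<le> log_energy (\<rho>^4) \<mu>s \<mu>s"
      unfolding \<mu>s_def by (rule log_energy_smear_ge[OF \<mu> borel_prob_unif_ball[OF s]]) (use \<rho> in auto)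
    also have "\<dots> \<le> ennreal (- ?L - ln (\<rho>^4) / 2 + 2 * \<rho> * Bs)"
      by (rule \<mu>s.regularized_energy_le(1)) (use \<rho> in auto)
    finally have "- L\<mu> - ln (\<rho>^4) / 2 \<le> - ?L - ln (\<rho>^4) / 2 + 2 * \<rho> * Bs"
      using \<mu>s.regularized_energy_le(2)[of \<rho>] \<rho> by (simp add: ennreal_le_iff)
    then show ?thesis by simp
  qed
  have "?L \<le> L\<mu> + 2 * 0 * Bs"
  proof (rule tendsto_le[of "at_right (0::real)"])
    show "((\<lambda>\<rho>. L\<mu> + 2 * \<rho> * Bs) \<longlongrightarrow> L\<mu> + 2 * 0 * Bs) (at_right 0)" by (intro tendsto_intros)
    show "\<forall>\<^sub>F \<rho> in at_right 0. ?L \<le> L\<mu> + 2 * \<rho> * Bs"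
      using * unfolding eventually_at_right_field by (intro exI[of _ 1]) auto
  qed auto
  then show ?thesis by simp
qed

definition pot :: "'a \<Rightarrow> real" where "pot y = (\<integral>x. log_ker x y \<partial>\<mu>s)"

text \<open>By symmetry of the ball, the potential of the smoothed measure at y is the mutual
  logarithmic energy of the unsmoothed \<mu> and the uniform law on the ball around y. This links
  \<open>pot\<close> to variations of \<mu>.\<close>

lemma pot_shift:
  "integrable (\<mu> \<Otimes>\<^sub>M unif_ball s) (\<lambda>z. log_ker (fst z) (y + snd z))"
  "(\<integral>z. log_ker (fst z) (y + snd z) \<partial>(\<mu> \<Otimes>\<^sub>M unif_ball s)) = pot y"
proof -
  let ?P = "\<mu> \<Otimes>\<^sub>M (unif_ball s :: 'a measure)"
  interpret u: prob_space "unif_ball s :: 'a measure" using borel_prob_unif_ball[OF s] by (rule borel_probD)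
  interpret pair_prob_space \<mu> "unif_ball s :: 'a measure" ..
  have [measurable_cong]: "sets (unif_ball s :: 'a measure) = sets borel" by (simp add: unif_ball_def)
  have flip: "distr ?P (\<mu> \<Otimes>\<^sub>M borel) (\<lambda>(x, h). (x, - h)) = ?P"
  proof -
    have "distr \<mu> \<mu> (\<lambda>x. x) \<Otimes>\<^sub>M distr (unif_ball s :: 'a measure) borel uminus = distr ?P (\<mu> \<Otimes>\<^sub>M borel) (\<lambda>(x, h). (x, - h))"
      by (rule pair_measure_distr) (auto simp: unif_ball_uminus[OF s] intro: u.sigma_finite_measure_axioms)
    then show ?thesis by (simp add: unif_ball_uminus[OF s] distr_id[unfolded id_def])
  qed
  have eq: "log_ker x (y - h) = log_ker (x + h) y" for x h
    by (simp add: log_ker_def algebra_simps)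
  have i: "integrable ?P (\<lambda>z. log_ker (fst z + snd z) y)"
    using \<mu>s.pot_integrable[of y] unfolding \<mu>s_def smear_def
    by (subst (asm) integrable_distr_eq) (auto simp: case_prod_unfold)
  have e: "(\<integral>z. log_ker (fst z + snd z) y \<partial>?P) = pot y"
    unfolding pot_def \<mu>s_def smear_def by (subst integral_distr) (auto simp: case_prod_unfold)
  show "integrable ?P (\<lambda>z. log_ker (fst z) (y + snd z))"
    by (subst flip[symmetric], subst integrable_distr_eq) (use i in \<open>auto simp: case_prod_unfold eq\<close>)
  show "(\<integral>z. log_ker (fst z) (y + snd z) \<partial>?P) = pot y"
    by (subst flip[symmetric], subst integral_distr) (use e in \<open>auto simp: case_prod_unfold eq\<close>)
qed

text \<open>The unsmoothed inequality may fail on exceptional points; the variation towards the uniform law on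
  the ball around \<open>y\<close> gives it everywhere for the smoothed potential.\<close>

lemma euler_lagrange: "2 * L\<mu> + q\<mu> - Q y - \<delta> * (1 + Q y) \<le> 2 * pot y"
proof -
  let ?P = "\<mu> \<Otimes>\<^sub>M (unif_ball s :: 'a measure)"
  interpret u: prob_space "unif_ball s :: 'a measure" using borel_prob_unif_ball[OF s] by (rule borel_probD)
  interpret pair_prob_space \<mu> "unif_ball s :: 'a measure" ..
  have [measurable_cong]: "sets (unif_ball s :: 'a measure) = sets borel" by (simp add: unif_ball_def)
  have r: "borel_prob (return borel y)" by (simp add: borel_prob_def prob_space_return)
  define \<beta> where "\<beta> = smear (return borel y) (unif_ball s)"
  have \<beta>: "borel_prob \<beta>" "nenergy \<beta> \<beta> < \<infinity>" unfolding \<beta>_def by (rule smear_return_finite[OF slow s]; assumption)+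
  \<comment> \<open>Half of the bound Q (y + h) \<le> Q y + \<delta> (1 + Q y), plus the shift of
    the kernel: everything in the weighted kernel that becomes constant once the field near y is
    replaced by this bound.\<close>
  define c where "c = Q y / 2 + \<delta> / 2 * (1 + Q y) + offset"
  define F where "F z = log_ker (fst z) (y + snd z) + Q (fst z) / 2 + c" for z
  have [measurable]: "F \<in> borel_measurable ?P" unfolding F_def by measurable
  have wF: "wker x (y + h) + offset \<le> F (x, h)" if "norm h \<le> s" for x h
  proof -
    have "Q (y + h) \<le> Q y + \<delta> * (1 + Q y)" using slow[OF that, of y] by linarith
    then show ?thesis by (simp add: F_def c_def wker_def)
  qed
  have AEs: "AE z in ?P. norm (snd z) \<le> s"
    using AE_unif_ball[OF s] by (intro AE_pair_measure) auto
  have iF: "integrable ?P F"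
    unfolding F_def using pot_shift(1)[of y] pair_marginals(1)[OF \<mu>.prob_space_axioms u.prob_space_axioms Q_integrable]
    by (intro Bochner_Integration.integrable_add) auto
  have eF: "(\<integral>z. F z \<partial>?P) = pot y + q\<mu> / 2 + c"
    unfolding F_def using pot_shift[of y] pair_marginals(1,2)[OF \<mu>.prob_space_axioms u.prob_space_axioms Q_integrable]
    by (simp add: q\<mu>_def prob_space)
  have nnF: "AE z in ?P. 0 \<le> F z"
    using AEs
  proof eventually_elim
    case (elim z)
    then show ?case using wF[of "snd z" "fst z"] wker_offset_nonneg[of "fst z" "y + snd z"] by simp
  qed
  have "nenergy \<mu> \<beta> = (\<integral>\<^sup>+x. \<integral>\<^sup>+z. ennreal (wker x z + offset) \<partial>\<beta> \<partial>\<mu>)"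
    unfolding nenergy_def
  proof (rule nn_integral_cong, rule nn_integral_cong_AE)
    fix x
    show "AE z in \<beta>. nker x z = ennreal (wker x z + offset)"
      using density_le_AE_neq[OF \<beta>(1) density_le_smear_unif_ball[OF s r, folded \<beta>_def], of x]
      by eventually_elim (auto simp: nker_def)
  qed
  also have "\<dots> = (\<integral>\<^sup>+x. \<integral>\<^sup>+h. ennreal (wker x (y + h) + offset) \<partial>unif_ball s \<partial>\<mu>)"
    unfolding \<beta>_def by (subst nn_integral_smear(1)[OF r borel_prob_unif_ball[OF s]]) (auto simp: nn_integral_return)
  also have "\<dots> = (\<integral>\<^sup>+z. ennreal (wker (fst z) (y + snd z) + offset) \<partial>?P)"
    by (subst u.nn_integral_fst[symmetric]) auto
  also have "\<dots> \<le> (\<integral>\<^sup>+z. ennreal (F z) \<partial>?P)"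
    by (rule nn_integral_mono_AE, use AEs in eventually_elim) (use wF in \<open>auto intro!: ennreal_leI\<close>)
  also have "\<dots> = ennreal (pot y + q\<mu> / 2 + c)"
    unfolding eF[symmetric] by (rule nn_integral_eq_integral[OF iF nnF])
  finally have "ennreal (L\<mu> + q\<mu> + offset) \<le> ennreal (pot y + q\<mu> / 2 + c)"
    using equilibrium_first_variation[OF equilibrium \<beta>] unfolding nenergy_L\<mu> by (rule order_trans[rotated])
  moreover have "0 \<le> pot y + q\<mu> / 2 + c" unfolding eF[symmetric] by (rule integral_nonneg_AE[OF nnF])
  ultimately have "L\<mu> + q\<mu> + offset \<le> pot y + q\<mu> / 2 + c" by (simp add: ennreal_le_iff)
  then show ?thesis unfolding c_def by (simp add: field_simps)
qed

end

section \<open>Energy of configurations\<close>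

text \<open>The image of the uniform law on the indices, so coinciding points are counted with
  multiplicity.\<close>

definition empirical :: "nat \<Rightarrow> (nat \<Rightarrow> 'a::euclidean_space) \<Rightarrow> 'a measure" where
  "empirical n y = distr (measure_pmf (pmf_of_set {..<n})) borel y"

context
  fixes n :: nat and y :: "nat \<Rightarrow> 'a::euclidean_space"
  assumes n: "n > 0"
begin

lemma borel_prob_empirical: "borel_prob (empirical n y)"
  unfolding borel_prob_def empirical_def by (auto intro!: measure_pmf.prob_space_distr)

lemma nn_integral_empirical:
  assumes [measurable]: "f \<in> borel_measurable borel" and f: "\<And>x. f x = ennreal (g x)" "\<And>x. g x \<ge> 0"
  shows "(\<integral>\<^sup>+x. f x \<partial>empirical n y) = ennreal ((\<Sum>i<n. g (y i)) / n)"
proof -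
  have "(\<integral>\<^sup>+x. f x \<partial>empirical n y) = (\<Sum>i<n. f (y i)) / ennreal n"
    unfolding empirical_def using n
    by (subst nn_integral_distr) (auto simp: nn_integral_pmf_of_set lessThan_empty_iff ennreal_of_nat_eq_real_of_nat)
  also have "\<dots> = ennreal ((\<Sum>i<n. g (y i)) / n)"
    using n f(2) by (simp add: f(1) sum_ennreal divide_ennreal sum_nonneg)
  finally show ?thesis .
qed

lemma integral_empirical:
  fixes f :: "'a \<Rightarrow> real"
  assumes [measurable]: "f \<in> borel_measurable borel"
  shows "(\<integral>x. f x \<partial>empirical n y) = (\<Sum>i<n. f (y i)) / n"
  unfolding empirical_def using n
  by (subst integral_distr) (auto simp: integral_pmf_of_set lessThan_empty_iff)

end

text \<open>Every index occurs in n - 1 pairs on each side, and each occurrence contributes one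
  half.\<close>

lemma sum_offdiag_add:
  fixes a :: "nat \<Rightarrow> real"
  shows "(\<Sum>i<n. \<Sum>j\<in>{..<n}-{i}. a i / 2 + a j / 2) = (real n - 1) * (\<Sum>i<n. a i)"
proof -
  have "(\<Sum>j\<in>{..<n}-{i}. a i / 2 + a j / 2) = (\<Sum>j<n. a i / 2 + a j / 2) - a i" if "i < n" for i
    using that by (subst sum_diff1) auto
  then have "(\<Sum>i<n. \<Sum>j\<in>{..<n}-{i}. a i / 2 + a j / 2) = (\<Sum>i<n. (\<Sum>j<n. a i / 2 + a j / 2) - a i)"
    by (intro sum.cong) auto
  also have "\<dots> = (real n - 1) * (\<Sum>i<n. a i)"
    by (simp add: sum.distrib sum_subtractf sum_distrib_left[symmetric] sum_divide_distrib[symmetric] algebra_simps)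
  finally show ?thesis .
qed

lemma sum_offdiag_sym:
  fixes f :: "nat \<Rightarrow> nat \<Rightarrow> real"
  assumes sym: "\<And>i j. f i j = f j i"
  shows "(\<Sum>i<n. \<Sum>j\<in>{..<n}-{i}. f i j) = (\<Sum>i<n. \<Sum>j\<in>{i<..<n}. 2 * f i j)"
proof (induction n)
  case (Suc n)
  have 1: "{..<Suc n} - {i} = insert n ({..<n} - {i})" "{i<..<Suc n} = insert n {i<..<n}" if "i < n" for i
    using that by auto
  have 2: "{..<Suc n} - {n} = {..<n}" "{n<..<Suc n} = {}" by auto
  have "(\<Sum>i<Suc n. \<Sum>j\<in>{..<Suc n}-{i}. f i j) = (\<Sum>i<n. f i n + (\<Sum>j\<in>{..<n}-{i}. f i j)) + (\<Sum>j<n. f n j)"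
    by (simp add: 1 2)
  also have "\<dots> = (\<Sum>i<n. \<Sum>j\<in>{..<n}-{i}. f i j) + (\<Sum>i<n. 2 * f i n)"
    by (simp add: sum.distrib sym[of n] sum_distrib_left[symmetric])
  also have "\<dots> = (\<Sum>i<Suc n. \<Sum>j\<in>{i<..<Suc n}. 2 * f i j)"
    by (simp add: 1 2 Suc sum.distrib)
  finally show ?case .
qed simp

context log_field
begin

text \<open>The sum runs over ordered pairs, which accounts for the square in the interaction
  factor. It contains n - 1 copies of the field; the remaining copy of the n in \<open>jdens\<close>
  goes into \<open>weight\<close>.\<close>

definition hamiltonian :: "nat \<Rightarrow> (nat \<Rightarrow> 'a) \<Rightarrow> real" where
  "hamiltonian n y = (\<Sum>i<n. \<Sum>j\<in>{..<n}-{i}. wker (y i) (y j))"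

lemma hamiltonian_split:
  "hamiltonian n y = (\<Sum>i<n. \<Sum>j\<in>{..<n}-{i}. log_ker (y i) (y j)) + (real n - 1) * (\<Sum>i<n. Q (y i))"
proof -
  have "hamiltonian n y = (\<Sum>i<n. \<Sum>j\<in>{..<n}-{i}. log_ker (y i) (y j)) + (\<Sum>i<n. \<Sum>j\<in>{..<n}-{i}. Q (y i) / 2 + Q (y j) / 2)"
    by (simp add: hamiltonian_def wker_def sum.distrib add.assoc)
  then show ?thesis by (simp only: sum_offdiag_add)
qed

text \<open>Confinement: the reserve in \<open>wker_ge\<close>, summed over pairs, controls the
  field by the energy. It later bounds the mean field per point under the Gibbs measure.\<close>

lemma sum_Q_le_hamiltonian:
  assumes "n \<ge> 1"
  shows "(real n - 1) / 2 * (\<Sum>i<n. Q (y i)) \<le> hamiltonian n y + offset * (real n * (real n - 1))"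
proof -
  have "(real n - 1) / 2 * (\<Sum>i<n. Q (y i)) = (1/2) * (\<Sum>i<n. \<Sum>j\<in>{..<n}-{i}. Q (y i) / 2 + Q (y j) / 2)"
    unfolding sum_offdiag_add by simp
  also have "\<dots> = (\<Sum>i<n. \<Sum>j\<in>{..<n}-{i}. (Q (y i) + Q (y j)) / 4)"
    by (simp add: sum_distrib_left add_divide_distrib)
  also have "\<dots> \<le> (\<Sum>i<n. \<Sum>j\<in>{..<n}-{i}. wker (y i) (y j) + offset)"
    by (intro sum_mono wker_ge)
  also have "\<dots> = hamiltonian n y + offset * (real n * (real n - 1))"
    using assms by (simp add: hamiltonian_def sum.distrib of_nat_diff mult.commute mult.left_commute)
  finally show ?thesis .
qed

end

context smoothed_equilibrium
begin

text \<open>Positive definiteness of the logarithmic kernel on neutral charges, applied to the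
  difference of the empirical measure and \<open>\<mu>s\<close>, together with the Euler--Lagrange inequality.\<close>

lemma configuration_bound:
  assumes n: "n > 0" and inj: "inj_on y {..<n}" and \<rho>: "0 < \<rho>" "\<rho> \<le> 1" and \<theta>: "0 < \<theta>" "\<theta> \<le> t"
  shows "\<theta> * (exp (- (2 * t * \<rho>^4)) / (4 * t) *
      (((\<Sum>i<n. gauss t (y i - z)) / n - gauss_pot t \<mu>s z)\<^sup>2 / 2 - (2 * \<theta> / t)\<^sup>2))
    \<le> hamiltonian n y / (real n)\<^sup>2 - (L\<mu> + q\<mu>) + \<delta> + (\<delta> + 1 / n) * ((\<Sum>i<n. Q (y i)) / n)
      + 4 * \<rho> * Bs - ln (\<rho>^4) / (2 * n)"
    (is "?X \<le> _")
proof -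
  define N where "N = real n"
  have N: "N > 0" using n by (simp add: N_def)
  define \<eta> where "\<eta> = \<rho>^4"
  have \<eta>: "\<eta> > 0" using \<rho> by (simp add: \<eta>_def)
  note e = borel_prob_empirical[OF n, of y]
  interpret e: prob_space "empirical n y" using e by (rule borel_probD)
  define k where "k x x' = ln (1 + (norm (x - x'))\<^sup>2 / \<eta>) / 2" for x x' :: 'a
  have k0: "k x x' \<ge> 0" for x x' using \<eta> by (simp add: k_def)
  have [measurable]: "k x \<in> borel_measurable borel" for x unfolding k_def by measurable
  define EE where "EE = (\<Sum>i<n. (\<Sum>j<n. k (y i) (y j)) / N) / N"
  have EE0: "EE \<ge> 0" unfolding EE_def using N k0 by (intro divide_nonneg_nonneg sum_nonneg) auto
  have EE: "log_energy \<eta> (empirical n y) (empirical n y) = ennreal EE"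
  proof -
    have "(\<integral>\<^sup>+x'. ennreal (k x x') \<partial>empirical n y) = ennreal ((\<Sum>j<n. k x (y j)) / N)" for x
      unfolding N_def by (rule nn_integral_empirical[OF n]) (auto simp: k0)
    then show ?thesis unfolding log_energy_def k_def[symmetric] EE_def
      using N k0 by (subst nn_integral_empirical[OF n, where g="\<lambda>x. (\<Sum>j<n. k x (y j)) / N"])
        (auto simp: N_def intro!: sum_nonneg divide_nonneg_nonneg, unfold k_def, measurable)
  qed
  define a where "a x = - pot x - ln \<eta> / 2 + 2 * \<rho> * Bs" for x
  have a0: "a x \<ge> 0" for x
    unfolding a_def pot_def \<eta>_def by (rule \<mu>s.regularized_pot_le(2)[OF \<rho>])
  define A where "A = (\<Sum>i<n. a (y i)) / N"
  have A0: "A \<ge> 0" unfolding A_def using N a0 by (intro divide_nonneg_nonneg sum_nonneg) auto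
  have [measurable]: "pot \<in> borel_measurable borel" unfolding pot_def by measurable
  have A: "log_energy \<eta> (empirical n y) \<mu>s \<le> ennreal A"
  proof -
    have "log_energy \<eta> (empirical n y) \<mu>s \<le> (\<integral>\<^sup>+x. ennreal (a x) \<partial>empirical n y)"
      unfolding log_energy_def a_def pot_def \<eta>_def
      by (intro nn_integral_mono \<mu>s.regularized_pot_le(1)[OF \<rho>])
    also have "\<dots> = ennreal A" unfolding A_def N_def
      by (rule nn_integral_empirical[OF n]) (auto simp: a0, unfold a_def, measurable)
    finally show ?thesis .
  qed
  have M: "ennreal (- L\<mu> - ln \<eta> / 2) \<le> log_energy \<eta> \<mu>s \<mu>s"
    using log_energy_\<mu>_ge[OF \<eta>] log_energy_smear_ge[OF \<mu> borel_prob_unif_ball[OF s] \<eta>]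
    unfolding \<mu>s_def by (rule order_trans)
  have g: "gauss_pot t (empirical n y) z = (\<Sum>i<n. gauss t (y i - z)) / n"
    unfolding gauss_pot_def by (rule integral_empirical[OF n]) measurable
  have "ennreal EE + ennreal (- L\<mu> - ln \<eta> / 2) + ennreal ?X
    \<le> log_energy \<eta> (empirical n y) (empirical n y) + log_energy \<eta> \<mu>s \<mu>s + ennreal ?X"
    unfolding EE using M by (intro add_mono) auto
  also have "\<dots> \<le> 2 * log_energy \<eta> (empirical n y) \<mu>s"
    using log_energy_discrepancy[OF e \<mu>s \<eta> \<theta>, of z] unfolding g \<eta>_def .
  also have "\<dots> \<le> 2 * ennreal A" by (intro mult_left_mono A) simp
  also have "\<dots> = ennreal (2 * A)" by (simp add: ennreal_mult')
  finally have le: "ennreal EE + ennreal (- L\<mu> - ln \<eta> / 2) + ennreal ?X \<le> ennreal (2 * A)" .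
  \<comment> \<open>Return to the reals: \<open>ennreal\<close> has replaced negative summands by 0,
    and the maxima with 0 are upper bounds for the original terms.\<close>
  have "EE + (- L\<mu> - ln \<eta> / 2) + ?X \<le> EE + max 0 (- L\<mu> - ln \<eta> / 2) + max 0 ?X" by simp
  also have "\<dots> \<le> 2 * A"
  proof -
    have pos: "ennreal b = ennreal (max 0 b)" for b by (simp add: max_def ennreal_neg)
    have "ennreal (EE + max 0 (- L\<mu> - ln \<eta> / 2) + max 0 ?X) \<le> ennreal (2 * A)"
      using le EE0 unfolding pos[of "- L\<mu> - ln \<eta> / 2"] pos[of ?X] by simp
    then show ?thesis using A0 by (simp only: ennreal_le_iff mult_nonneg_nonneg zero_le_numeral)
  qed
  finally have main: "?X \<le> 2 * A - EE + L\<mu> + ln \<eta> / 2" by simp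
  define S where "S = (\<Sum>i<n. \<Sum>j\<in>{..<n}-{i}. log_ker (y i) (y j))"
  define SQ where "SQ = (\<Sum>i<n. Q (y i))"
  have SQ0: "SQ \<ge> 0" unfolding SQ_def by (intro sum_nonneg Q_nonneg)
  \<comment> \<open>A lower bound for EE. Diagonal terms are nonnegative and dropped, leaving n (n -
    1) ordered pairs; injectivity makes the points of each pair distinct, where the truncated kernel
    is comparable to \<open>log_ker\<close>.\<close>
  have "- S - N * (N - 1) * (ln \<eta> / 2) = (\<Sum>i<n. \<Sum>j\<in>{..<n}-{i}. - log_ker (y i) (y j) - ln \<eta> / 2)"
    using n by (simp add: S_def N_def sum_subtractf sum_negf of_nat_diff)
  also have "\<dots> \<le> (\<Sum>i<n. \<Sum>j\<in>{..<n}-{i}. k (y i) (y j))"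
    unfolding k_def using inj \<eta> by (intro sum_mono regularized_log_ge) (auto simp: inj_on_def)
  also have "\<dots> \<le> (\<Sum>i<n. \<Sum>j<n. k (y i) (y j))" by (intro sum_mono sum_mono2) (auto simp: k0)
  also have "\<dots> = EE * N\<^sup>2" using N by (simp add: EE_def sum_divide_distrib[symmetric] power2_eq_square)
  finally have 1: "- S - N * (N - 1) * (ln \<eta> / 2) \<le> EE * N\<^sup>2" .
  have "(\<Sum>i<n. 2 * L\<mu> + q\<mu> - Q (y i) - \<delta> * (1 + Q (y i))) \<le> (\<Sum>i<n. 2 * pot (y i))"
    by (intro sum_mono euler_lagrange)
  then have 2: "N * (2 * L\<mu> + q\<mu>) - SQ - \<delta> * (N + SQ) \<le> 2 * (\<Sum>i<n. pot (y i))"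
    by (simp add: N_def SQ_def sum_subtractf sum.distrib sum_distrib_left[symmetric])
  have 3: "2 * A * N = - 2 * (\<Sum>i<n. pot (y i)) - N * ln \<eta> + 4 * N * \<rho> * Bs"
  proof -
    have "A * N = (\<Sum>i<n. a (y i))" using N by (simp add: A_def)
    also have "\<dots> = - (\<Sum>i<n. pot (y i)) - N * (ln \<eta> / 2) + N * (2 * \<rho> * Bs)"
      by (simp add: a_def N_def sum_subtractf sum.distrib sum_negf)
    finally have "2 * (A * N) = 2 * (- (\<Sum>i<n. pot (y i)) - N * (ln \<eta> / 2) + N * (2 * \<rho> * Bs))" by simp
    then show ?thesis by (simp add: algebra_simps)
  qed
  have H: "hamiltonian n y = S + (N - 1) * SQ" unfolding hamiltonian_split S_def SQ_def N_def ..
  have "?X * N\<^sup>2 \<le> (2 * A - EE + L\<mu> + ln \<eta> / 2) * N\<^sup>2" using main by (intro mult_right_mono) auto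
  also have "\<dots> = (2 * A * N) * N - EE * N\<^sup>2 + L\<mu> * N\<^sup>2 + ln \<eta> / 2 * N\<^sup>2"
    by (simp add: algebra_simps power2_eq_square)
  also have "\<dots> \<le> (- (N * (2 * L\<mu> + q\<mu>) - SQ - \<delta> * (N + SQ)) - N * ln \<eta> + 4 * N * \<rho> * Bs) * N
      + (S + N * (N - 1) * (ln \<eta> / 2)) + L\<mu> * N\<^sup>2 + ln \<eta> / 2 * N\<^sup>2"
  proof -
    have "2 * A * N * N \<le> (- (N * (2 * L\<mu> + q\<mu>) - SQ - \<delta> * (N + SQ)) - N * ln \<eta> + 4 * N * \<rho> * Bs) * N"
      using 2 N unfolding 3 by (intro mult_right_mono) auto
    moreover have "- (EE * N\<^sup>2) \<le> S + N * (N - 1) * (ln \<eta> / 2)" using 1 by linarith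
    ultimately show ?thesis by linarith
  qed
  \<comment> \<open>The coefficients of ln \<eta> add up to - N^2 + N (N - 1) / 2 + N^2 / 2 = - N /
    2, the trace of the missing diagonal. The 1 in \<delta> N + 1 is the gap between the N copies of
    the field in the Euler--Lagrange bound and the N - 1 copies in the hamiltonian.\<close>
  also have "\<dots> = (S + (N - 1) * SQ) - (L\<mu> + q\<mu>) * N\<^sup>2 + \<delta> * N\<^sup>2 + (\<delta> * N + 1) * SQ + 4 * \<rho> * Bs * N\<^sup>2 - ln \<eta> / 2 * N"
    by (simp add: field_simps power2_eq_square)
  finally have *: "?X * N\<^sup>2 \<le> (S + (N - 1) * SQ) - (L\<mu> + q\<mu>) * N\<^sup>2 + \<delta> * N\<^sup>2 + (\<delta> * N + 1) * SQ + 4 * \<rho> * Bs * N\<^sup>2 - ln \<eta> / 2 * N" .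
  have "?X \<le> ((S + (N - 1) * SQ) - (L\<mu> + q\<mu>) * N\<^sup>2 + \<delta> * N\<^sup>2 + (\<delta> * N + 1) * SQ + 4 * \<rho> * Bs * N\<^sup>2 - ln \<eta> / 2 * N) / N\<^sup>2"
    using * N by (subst pos_le_divide_eq) auto
  also have "\<dots> = hamiltonian n y / N\<^sup>2 - (L\<mu> + q\<mu>) + \<delta> + (\<delta> + 1 / N) * (SQ / N) + 4 * \<rho> * Bs - ln \<eta> / (2 * N)"
    unfolding H using N by (simp add: field_simps power2_eq_square)
  finally show ?thesis by (simp add: N_def SQ_def \<eta>_def)
qed

end

section \<open>The partition function\<close>

lemma distr_PiM_pair:
  assumes M: "prob_space M" and I: "finite I" "i \<in> I" "j \<in> I" "i \<noteq> j"
  shows "distr (PiM I (\<lambda>_. M)) (M \<Otimes>\<^sub>M M) (\<lambda>y. (y i, y j)) = M \<Otimes>\<^sub>M M"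
proof -
  interpret M: prob_space M by fact
  interpret pp: pair_prob_space M M ..
  interpret product_prob_space "\<lambda>_. M" I ..
  interpret finite_product_prob_space "\<lambda>_. M" I by unfold_locales fact
  have "M \<Otimes>\<^sub>M M = distr (PiM I (\<lambda>_. M)) (M \<Otimes>\<^sub>M M) (\<lambda>y. (y i, y j))"
  proof (rule pair_measure_eqI)
    fix A B assume [measurable]: "A \<in> sets M" "B \<in> sets M"
    define C where "C k = (if k = i then A else if k = j then B else space M)" for k
    have C[measurable]: "C k \<in> sets M" for k by (simp add: C_def)
    have "(\<lambda>y. (y i, y j)) -` (A \<times> B) \<inter> space (PiM I (\<lambda>_. M)) = PiE I C"
    proof (intro set_eqI iffI)
      fix y assume "y \<in> (\<lambda>y. (y i, y j)) -` (A \<times> B) \<inter> space (PiM I (\<lambda>_. M))"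
      then show "y \<in> PiE I C" by (auto simp: space_PiM C_def PiE_iff)
    next
      fix y assume y: "y \<in> PiE I C"
      have "y i \<in> C i" "y j \<in> C j" using y I by (auto simp: PiE_iff)
      moreover have "y k \<in> space M" if "k \<in> I" for k
        using y that sets.sets_into_space[OF C[of k]] by (auto simp: PiE_iff)
      ultimately show "y \<in> (\<lambda>y. (y i, y j)) -` (A \<times> B) \<inter> space (PiM I (\<lambda>_. M))"
        using y I by (auto simp: space_PiM PiE_iff C_def)
    qed
    then have "emeasure (distr (PiM I (\<lambda>_. M)) (M \<Otimes>\<^sub>M M) (\<lambda>y. (y i, y j))) (A \<times> B) = emeasure (PiM I (\<lambda>_. M)) (PiE I C)"
      using I by (subst emeasure_distr) auto
    also have "\<dots> = (\<Prod>k\<in>I. emeasure M (C k))" by (rule emeasure_PiM) (auto simp: I C)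
    also have "\<dots> = (\<Prod>k\<in>{i,j}. emeasure M (C k))"
      using I by (intro prod.mono_neutral_right) (auto simp: C_def M.emeasure_space_1)
    also have "\<dots> = emeasure M A * emeasure M B" using I by (simp add: C_def)
    finally show "emeasure M A * emeasure M B = emeasure (distr (PiM I (\<lambda>_. M)) (M \<Otimes>\<^sub>M M) (\<lambda>y. (y i, y j))) (A \<times> B)" ..
  qed (auto intro: M.sigma_finite_measure_axioms)
  then show ?thesis ..
qed

text \<open>A density bound passes to product measures with one factor c per coordinate. The bound
  is known only through integrals, so the induction integrates out one coordinate at a time.\<close>

lemma nn_integral_PiM_le:
  assumes M: "sigma_finite_measure M" and N: "sigma_finite_measure N" and sets: "sets M = sets N"
    and le: "\<And>f. f \<in> borel_measurable N \<Longrightarrow> (\<integral>\<^sup>+x. f x \<partial>M) \<le> c * (\<integral>\<^sup>+x. f x \<partial>N)"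
    and I: "finite I" and G: "G \<in> borel_measurable (PiM I (\<lambda>_. N))"
  shows "(\<integral>\<^sup>+y. G y \<partial>PiM I (\<lambda>_. M)) \<le> c ^ card I * (\<integral>\<^sup>+y. G y \<partial>PiM I (\<lambda>_. N))"
  using I G
proof (induction I arbitrary: G rule: finite_induct)
  case empty
  have "PiM {} (\<lambda>_. M) = PiM {} (\<lambda>_. N)"
    using sets sets_eq_imp_space_eq[OF sets] by (simp add: PiM_empty)
  then have "(\<integral>\<^sup>+y. G y \<partial>PiM {} (\<lambda>_. M)) = (\<integral>\<^sup>+y. G y \<partial>PiM {} (\<lambda>_. N))" by (rule arg_cong)
  then show ?case by simp
next
  case (insert i I)
  interpret M: product_sigma_finite "\<lambda>_. M" using M by (auto simp: product_sigma_finite_def)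
  interpret N: product_sigma_finite "\<lambda>_. N" using N by (auto simp: product_sigma_finite_def)
  interpret Ni: sigma_finite_measure N by fact
  have s: "sets (PiM J (\<lambda>_. M)) = sets (PiM J (\<lambda>_. N))" for J by (intro sets_PiM_cong) (auto simp: sets)
  have [measurable]: "G \<in> borel_measurable (PiM (insert i I) (\<lambda>_. N))" by fact
  have GM: "G \<in> borel_measurable (PiM (insert i I) (\<lambda>_. M))"
    using insert.prems by (simp cong: measurable_cong_sets add: s)
  have "(\<integral>\<^sup>+y. G y \<partial>PiM (insert i I) (\<lambda>_. M)) = (\<integral>\<^sup>+x. \<integral>\<^sup>+u. G (x(i := u)) \<partial>M \<partial>PiM I (\<lambda>_. M))"
    by (rule M.product_nn_integral_insert) (use insert GM in auto)
  also have "\<dots> \<le> (\<integral>\<^sup>+x. c * (\<integral>\<^sup>+u. G (x(i := u)) \<partial>N) \<partial>PiM I (\<lambda>_. M))"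
  proof (rule nn_integral_mono, rule le)
    fix x assume "x \<in> space (PiM I (\<lambda>_. M))"
    then have x: "x \<in> space (PiM I (\<lambda>_. N))" using sets_eq_imp_space_eq[OF s] by blast
    have "(\<lambda>u. x(i := u)) \<in> measurable N (PiM (insert i I) (\<lambda>_. N))"
      using x by (intro measurable_fun_upd[where J=I]) auto
    then show "(\<lambda>u. G (x(i := u))) \<in> borel_measurable N" by measurable
  qed
  also have "\<dots> \<le> c ^ card I * (\<integral>\<^sup>+x. c * (\<integral>\<^sup>+u. G (x(i := u)) \<partial>N) \<partial>PiM I (\<lambda>_. N))"
    by (rule insert.IH) measurable
  also have "\<dots> = c ^ card (insert i I) * (\<integral>\<^sup>+x. \<integral>\<^sup>+u. G (x(i := u)) \<partial>N \<partial>PiM I (\<lambda>_. N))"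
    using insert by (subst nn_integral_cmult) (auto simp: mult_ac)
  also have "(\<integral>\<^sup>+x. \<integral>\<^sup>+u. G (x(i := u)) \<partial>N \<partial>PiM I (\<lambda>_. N)) = (\<integral>\<^sup>+y. G y \<partial>PiM (insert i I) (\<lambda>_. N))"
    by (rule N.product_nn_integral_insert[symmetric]) (use insert in auto)
  finally show ?case .
qed

interpretation lborel_product: product_sigma_finite "\<lambda>_::nat. lborel :: 'a::euclidean_space measure"
  by unfold_locales

context log_field
begin

text \<open>The one copy of the field per point that \<open>hamiltonian\<close> leaves over. It
  gives the product reference measure the finite mass \<open>W ^ n\<close>.\<close>

definition weight :: "nat \<Rightarrow> (nat \<Rightarrow> 'a) \<Rightarrow> real" where
  "weight n y = (\<Prod>i<n. exp (- Q (y i)))"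

definition W :: real where "W = (\<integral>x. exp (- Q x) \<partial>lborel)"

text \<open>\<open>Q_growth\<close> at 1 / (2 d) makes exp(Q) dominate a multiple of (1 + |x|)^(2
  d), which is exactly the decay required by \<open>integrable_norm_bounded\<close>.\<close>

lemma exp_Q_integrable: "integrable lborel (\<lambda>x. exp (- Q x))"
proof -
  let ?d = "real (2 * DIM('a))"
  have d: "?d > 0" by simp
  obtain C where C: "\<And>x. ln (1 + norm x) \<le> (1 / ?d) * Q x + C" using Q_growth[of "1 / ?d"] d by auto
  show ?thesis
  proof (rule integrable_norm_bounded[where C="exp (?d * C)"])
    fix x :: 'a
    have p: "1 + norm x > 0" by (simp add: add_pos_nonneg)
    have "(1 + norm x) ^ (2 * DIM('a)) = exp (?d * ln (1 + norm x))"
      using p by (subst exp_of_nat_mult) simp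
    also have "\<dots> \<le> exp (?d * ((1 / ?d) * Q x + C))" using C[of x] d by (intro iffD2[OF exp_le_cancel_iff] mult_left_mono) auto
    also have "\<dots> = exp (Q x) * exp (?d * C)" using d by (simp add: distrib_left exp_add)
    finally have "exp (- Q x) * (1 + norm x) ^ (2 * DIM('a)) \<le> exp (- Q x) * (exp (Q x) * exp (?d * C))"
      by (intro mult_left_mono) auto
    also have "\<dots> = exp (?d * C)" by (simp add: mult.assoc[symmetric] flip: exp_add)
    finally show "\<bar>exp (- Q x)\<bar> * (1 + norm x) ^ (2 * DIM('a)) \<le> exp (?d * C)" by simp
  qed measurable
qed

lemma weight_integrable: "integrable (PiM {..<n} (\<lambda>_. lborel)) (weight n)"
  "(\<integral>y. weight n y \<partial>PiM {..<n} (\<lambda>_. lborel)) = W ^ n"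
  unfolding weight_def W_def using exp_Q_integrable
    lborel_product.product_integrable_prod[of "{..<n}" "\<lambda>_ x. exp (- Q x)"]
    lborel_product.product_integral_prod[of "{..<n}" "\<lambda>_ x. exp (- Q x)"] by auto

lemma W_pos: "W > 0"
proof -
  have "W \<noteq> 0"
  proof
    assume "W = 0"
    then have "AE x::'a in lborel. exp (- Q x) = 0"
      using integral_nonneg_eq_0_iff_AE[OF exp_Q_integrable] by (simp add: W_def)
    then have "AE x::'a in lborel. False" by simp
    then show False using ae_filter_eq_bot_iff[of "lborel::'a measure"] by (simp add: trivial_limit_def)
  qed
  moreover have "W \<ge> 0" unfolding W_def by (rule Bochner_Integration.integral_nonneg) simp
  ultimately show ?thesis by linarith
qed

lemma weight_pos: "weight n y > 0" unfolding weight_def by (intro prod_pos) auto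

lemma weight_eq: "weight n y = exp (- (\<Sum>i<n. Q (y i)))"
  by (simp add: weight_def exp_sum[symmetric] sum_negf)

lemma measurable_hamiltonian [measurable]: "hamiltonian n \<in> borel_measurable (PiM {..<n} (\<lambda>_. lborel))"
  unfolding hamiltonian_def by (intro borel_measurable_sum measurable_wker) (auto intro!: measurable_component_singleton)

lemma measurable_jdens [measurable]: "jdens Q n \<in> borel_measurable (PiM {..<n} (\<lambda>_. lborel))"
  unfolding jdens_def by measurable

lemma jdens_nonneg: "jdens Q n y \<ge> 0"
  unfolding jdens_def by (intro mult_nonneg_nonneg prod_nonneg) auto

text \<open>Distinctness is essential: at coinciding points \<open>jdens\<close> vanishes, whereas
  \<open>hamiltonian\<close> stays finite because of the conventional diagonal value of
  \<open>log_ker\<close>.\<close>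

lemma jdens_inj:
  assumes inj: "inj_on y {..<n}"
  shows "jdens Q n y = exp (- hamiltonian n y) * weight n y"
proof -
  have "(\<Prod>i<n. \<Prod>j\<in>{i<..<n}. (norm (y i - y j))\<^sup>2) = (\<Prod>i<n. \<Prod>j\<in>{i<..<n}. exp (- (2 * log_ker (y i) (y j))))"
  proof (intro prod.cong refl)
    fix i j assume "i \<in> {..<n}" "j \<in> {i<..<n}"
    then have "y i \<noteq> y j" using inj by (auto simp: inj_on_def)
    then have "norm (y i - y j) > 0" by simp
    then have "(norm (y i - y j))\<^sup>2 = exp (ln (norm (y i - y j)))^2" by simp
    also have "\<dots> = exp (2 * ln (norm (y i - y j)))" by (simp add: power2_eq_square flip: exp_add)
    finally show "(norm (y i - y j))\<^sup>2 = exp (- (2 * log_ker (y i) (y j)))" by (simp add: log_ker_def)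
  qed
  also have "\<dots> = exp (- (\<Sum>i<n. \<Sum>j\<in>{..<n}-{i}. log_ker (y i) (y j)))"
    by (subst sum_offdiag_sym) (auto simp: log_ker_sym exp_sum sum_negf[symmetric])
  finally show ?thesis unfolding jdens_def hamiltonian_split weight_eq
    by (simp add: algebra_simps flip: exp_add)
qed

lemma jdens_not_inj: "\<not> inj_on y {..<n} \<Longrightarrow> jdens Q n y = 0"
proof -
  assume "\<not> inj_on y {..<n}"
  then obtain i j where ij: "i < n" "j < n" "i < j" "y i = y j"
    unfolding inj_on_def by (metis lessThan_iff linorder_neqE_nat)
  then have "(\<Prod>j\<in>{i<..<n}. (norm (y i - y j))\<^sup>2) = 0" by (intro prod_zero) auto
  then have "\<exists>i\<in>{..<n}. (\<Prod>j\<in>{i<..<n}. (norm (y i - y j))\<^sup>2) = 0" using ij by (intro bexI[of _ i]) auto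
  from prod_zero[OF finite_lessThan this] have "(\<Prod>i<n. \<Prod>j\<in>{i<..<n}. (norm (y i - y j))\<^sup>2) = 0" .
  then show ?thesis by (simp add: jdens_def)
qed

lemma hamiltonian_ge: "n \<ge> 1 \<Longrightarrow> - (offset * (real n * (real n - 1))) \<le> hamiltonian n y"
proof -
  assume n: "n \<ge> 1"
  have "0 \<le> (real n - 1) / 2 * (\<Sum>i<n. Q (y i))" using n by (intro mult_nonneg_nonneg sum_nonneg Q_nonneg) auto
  then show ?thesis using sum_Q_le_hamiltonian[OF n, of y] by linarith
qed

lemma jdens_le: "n \<ge> 1 \<Longrightarrow> jdens Q n y \<le> exp (offset * (real n * (real n - 1))) * weight n y"
  using jdens_inj[of y n] jdens_not_inj[of y n] hamiltonian_ge[of n y] weight_pos[of n y]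
  by (cases "inj_on y {..<n}") (auto intro!: mult_right_mono less_imp_le)

lemma jdens_integrable: "integrable (PiM {..<n} (\<lambda>_. lborel)) (jdens Q n)"
proof (cases "n = 0")
  case True
  have "integrable (count_space {\<lambda>x. undefined}) (jdens Q 0)" by (rule integrable_count_space) simp
  then show ?thesis using True by (simp add: PiM_empty)
next
  case False
  then have n: "n \<ge> 1" by simp
  show ?thesis
  proof (rule Bochner_Integration.integrable_bound)
    show "integrable (PiM {..<n} (\<lambda>_. lborel)) (\<lambda>y. exp (offset * (real n * (real n - 1))) * weight n y)"
      using weight_integrable by simp
    show "AE y in PiM {..<n} (\<lambda>_. lborel). norm (jdens Q n y) \<le> norm (exp (offset * (real n * (real n - 1))) * weight n y)"
      using jdens_le[OF n] jdens_nonneg weight_pos by (intro AE_I2) (auto simp: abs_mult abs_of_pos)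
  qed measurable
qed

definition Z :: "nat \<Rightarrow> real" where "Z n = (\<integral>y. jdens Q n y \<partial>PiM {..<n} (\<lambda>_. lborel))"

lemma Dn_Z: "Dn Q n = 1 / Z n"
  by (simp add: Dn_def Z_def)

lemma nn_Z: "(\<integral>\<^sup>+y. ennreal (jdens Q n y) \<partial>PiM {..<n} (\<lambda>_. lborel)) = ennreal (Z n)"
  unfolding Z_def by (rule nn_integral_eq_integral[OF jdens_integrable]) (simp add: jdens_nonneg)

end

lemma AE_PiM_pair:
  assumes M: "prob_space M" and I: "finite I" "i \<in> I" "j \<in> I" "i \<noteq> j"
    and AE: "AE z in M \<Otimes>\<^sub>M M. P (fst z) (snd z)"
  shows "AE y in PiM I (\<lambda>_. M). P (y i) (y j)"
proof -
  have "AE z in distr (PiM I (\<lambda>_. M)) (M \<Otimes>\<^sub>M M) (\<lambda>y. (y i, y j)). P (fst z) (snd z)"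
    unfolding distr_PiM_pair[OF M I] by fact
  then have "AE y in PiM I (\<lambda>_. M). P (fst (y i, y j)) (snd (y i, y j))"
    by (rule AE_distrD[rotated]) (use I in measurable)
  then show ?thesis by simp
qed

lemma PiM_pair_integral:
  fixes f :: "'a \<times> 'a \<Rightarrow> real"
  assumes M: "prob_space M" and I: "finite I" "i \<in> I" "j \<in> I" "i \<noteq> j"
    and f: "integrable (M \<Otimes>\<^sub>M M) f"
  shows "integrable (PiM I (\<lambda>_. M)) (\<lambda>y. f (y i, y j))"
    "(\<integral>y. f (y i, y j) \<partial>PiM I (\<lambda>_. M)) = (\<integral>z. f z \<partial>(M \<Otimes>\<^sub>M M))"
proof -
  have [measurable]: "(\<lambda>y. (y i, y j)) \<in> measurable (PiM I (\<lambda>_. M)) (M \<Otimes>\<^sub>M M)" using I by measurable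
  have [measurable]: "f \<in> borel_measurable (M \<Otimes>\<^sub>M M)" using f by auto
  show "integrable (PiM I (\<lambda>_. M)) (\<lambda>y. f (y i, y j))"
    using f by (subst (asm) distr_PiM_pair[OF M I, symmetric], subst (asm) integrable_distr_eq) auto
  show "(\<integral>y. f (y i, y j) \<partial>PiM I (\<lambda>_. M)) = (\<integral>z. f z \<partial>(M \<Otimes>\<^sub>M M))"
    by (subst distr_PiM_pair[OF M I, symmetric], subst integral_distr) auto
qed

lemma PiM_single_integral:
  fixes f :: "'a \<Rightarrow> real"
  assumes M: "prob_space M" and I: "finite I" "i \<in> I" and f: "integrable M f"
  shows "integrable (PiM I (\<lambda>_. M)) (\<lambda>y. f (y i))" "(\<integral>y. f (y i) \<partial>PiM I (\<lambda>_. M)) = (\<integral>x. f x \<partial>M)"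
proof -
  have d: "distr (PiM I (\<lambda>_. M)) M (\<lambda>y. y i) = M" by (rule distr_PiM_component) (use M I in auto)
  have [measurable]: "(\<lambda>y. y i) \<in> measurable (PiM I (\<lambda>_. M)) M" using I by measurable
  show "integrable (PiM I (\<lambda>_. M)) (\<lambda>y. f (y i))"
    using f by (subst (asm) d[symmetric], subst (asm) integrable_distr_eq) auto
  show "(\<integral>y. f (y i) \<partial>PiM I (\<lambda>_. M)) = (\<integral>x. f x \<partial>M)"
    using f by (subst (2) d[symmetric], subst integral_distr) auto
qed

context smoothed_equilibrium
begin

definition Jbound :: real where "Jbound = L\<mu> + q\<mu> + \<delta> * (1 + q\<mu>)"

text \<open>Jensen's inequality with the product of smoothed equilibrium measures as trial state.\<close>

lemma Z_lower:
  assumes n: "n \<ge> 1"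
  defines "v \<equiv> measure lborel (cball (0::'a) s)"
  shows "v ^ n * exp (- (real n * (real n - 1) * Jbound + real n * (q\<mu> + \<delta> * (1 + q\<mu>)))) \<le> Z n"
proof -
  have v: "v > 0" unfolding v_def using emeasure_cball_finite_pos(2)[OF s] .
  note pr = \<mu>s.p.prob_space_axioms
  let ?P = "PiM {..<n} (\<lambda>_. \<mu>s)"
  interpret P: prob_space ?P by (rule prob_space_PiM) (rule pr)
  have setsP: "sets ?P = sets (PiM {..<n} (\<lambda>_. lborel :: 'a measure))"
    by (intro sets_PiM_cong) (auto simp: borel_probD(2)[OF \<mu>s])
  \<comment> \<open>On injective configurations \<open>jdens Q n y = exp (- V y)\<close>.\<close>
  define V where "V y = hamiltonian n y + (\<Sum>i<n. Q (y i))" for y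
  have [measurable]: "jdens Q n \<in> borel_measurable ?P"
    using measurable_jdens[of n] by (simp cong: measurable_cong_sets add: setsP)
  have wker_int: "integrable (\<mu>s \<Otimes>\<^sub>M \<mu>s) (\<lambda>z. wker (fst z) (snd z))"
    "(\<integral>z. wker (fst z) (snd z) \<partial>(\<mu>s \<Otimes>\<^sub>M \<mu>s)) \<le> Jbound"
  proof -
    note m = pair_marginals[OF pr pr]
    show "integrable (\<mu>s \<Otimes>\<^sub>M \<mu>s) (\<lambda>z. wker (fst z) (snd z))"
      unfolding wker_def using \<mu>s.energy_integrable m(1,3)[OF \<mu>s.Q_int] by auto
    have "(\<integral>z. wker (fst z) (snd z) \<partial>(\<mu>s \<Otimes>\<^sub>M \<mu>s)) = (\<integral>z. log_ker (fst z) (snd z) \<partial>(\<mu>s \<Otimes>\<^sub>M \<mu>s)) + (\<integral>x. Q x \<partial>\<mu>s)"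
      unfolding wker_def using \<mu>s.energy_integrable m(1,3)[OF \<mu>s.Q_int] m(2,4)[OF \<mu>s.Q_int] by simp
    also have "\<dots> \<le> Jbound" unfolding Jbound_def using energy_\<mu>s_le Q_\<mu>s_le by linarith
    finally show "(\<integral>z. wker (fst z) (snd z) \<partial>(\<mu>s \<Otimes>\<^sub>M \<mu>s)) \<le> Jbound" .
  qed
  have pairs: "integrable ?P (\<lambda>y. wker (y i) (y j))" "(\<integral>y. wker (y i) (y j) \<partial>?P) \<le> Jbound"
    if "i < n" "j \<in> {..<n} - {i}" for i j
    using PiM_pair_integral[OF pr _ _ _ _ wker_int(1), of "{..<n}" i j] that wker_int(2) by auto
  have singles: "integrable ?P (\<lambda>y. Q (y i))" "(\<integral>y. Q (y i) \<partial>?P) \<le> q\<mu> + \<delta> * (1 + q\<mu>)"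
    if "i < n" for i
    using PiM_single_integral[OF pr _ _ \<mu>s.Q_int, of "{..<n}" i] that Q_\<mu>s_le by auto
  have Vint: "integrable ?P V"
    unfolding V_def hamiltonian_def using pairs(1) singles(1)
    by (intro Bochner_Integration.integrable_add Bochner_Integration.integrable_sum) auto
  have "(\<integral>y. V y \<partial>?P) = (\<Sum>i<n. \<Sum>j\<in>{..<n}-{i}. (\<integral>y. wker (y i) (y j) \<partial>?P)) + (\<Sum>i<n. (\<integral>y. Q (y i) \<partial>?P))"
  proof -
    have "(\<integral>y. hamiltonian n y \<partial>?P) = (\<Sum>i<n. (\<integral>y. (\<Sum>j\<in>{..<n}-{i}. wker (y i) (y j)) \<partial>?P))"
      unfolding hamiltonian_def
      by (rule Bochner_Integration.integral_sum, rule Bochner_Integration.integrable_sum, rule pairs(1)) auto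
    also have "\<dots> = (\<Sum>i<n. \<Sum>j\<in>{..<n}-{i}. (\<integral>y. wker (y i) (y j) \<partial>?P))"
      by (intro sum.cong refl Bochner_Integration.integral_sum) (use pairs(1) in auto)
    finally have 1: "(\<integral>y. hamiltonian n y \<partial>?P) = (\<Sum>i<n. \<Sum>j\<in>{..<n}-{i}. (\<integral>y. wker (y i) (y j) \<partial>?P))" .
    have 2: "(\<integral>y. (\<Sum>i<n. Q (y i)) \<partial>?P) = (\<Sum>i<n. (\<integral>y. Q (y i) \<partial>?P))"
      by (rule Bochner_Integration.integral_sum) (use singles(1) in auto)
    have "integrable ?P (hamiltonian n)" unfolding hamiltonian_def
      by (intro Bochner_Integration.integrable_sum pairs(1)) auto
    then show ?thesis unfolding V_def 1[symmetric] 2[symmetric]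
      by (intro Bochner_Integration.integral_add) (auto intro!: Bochner_Integration.integrable_sum singles(1))
  qed
  also have "\<dots> \<le> (\<Sum>i<n. \<Sum>j\<in>{..<n}-{i}. Jbound) + (\<Sum>i<n. q\<mu> + \<delta> * (1 + q\<mu>))"
    using pairs(2) singles(2) by (intro add_mono sum_mono) auto
  also have "\<dots> = real n * (real n - 1) * Jbound + real n * (q\<mu> + \<delta> * (1 + q\<mu>))"
    using n by (simp add: of_nat_diff)
  finally have EV: "(\<integral>y. V y \<partial>?P) \<le> real n * (real n - 1) * Jbound + real n * (q\<mu> + \<delta> * (1 + q\<mu>))" .
  define m where "m = - (\<integral>y. V y \<partial>?P)"
  have inj: "AE y in ?P. inj_on y {..<n}"
  proof -
    have ne: "AE y in \<mu>s. x \<noteq> y" for x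
      using density_le_AE_neq[OF \<mu>s density_le_\<mu>s, of x] by eventually_elim auto
    have "AE z in \<mu>s \<Otimes>\<^sub>M \<mu>s. fst z \<noteq> snd z"
      by (rule \<mu>s.pp.AE_pair_measure) (auto simp: ne)
    then have "AE y in ?P. y i \<noteq> y j" if "i < n" "j < n" "i \<noteq> j" for i j
      using AE_PiM_pair[OF pr _ _ _ _, of "{..<n}" i j "(\<noteq>)"] that by auto
    then have "AE y in ?P. \<forall>i\<in>{..<n}. \<forall>j\<in>{..<n}. i \<noteq> j \<longrightarrow> y i \<noteq> y j"
      by (intro AE_finite_allI) auto
    then show ?thesis by eventually_elim (auto simp: inj_on_def)
  qed
  \<comment> \<open>Jensen's inequality through the tangent of exp at the mean m of - V: the tangent
    has integral exp m and lies below exp(- V), which agrees with \<open>jdens\<close> almost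
    everywhere.\<close>
  have "ennreal (exp m) = ennreal (\<integral>y. exp m * (1 + (- V y - m)) \<partial>?P)"
    using Vint by (simp add: m_def P.prob_space)
  also have "\<dots> \<le> (\<integral>\<^sup>+y. ennreal (exp m * (1 + (- V y - m))) \<partial>?P)"
    by (rule ennreal_integral_le_nn_integral) (use Vint in simp)
  also have "\<dots> \<le> (\<integral>\<^sup>+y. ennreal (jdens Q n y) \<partial>?P)"
  proof (rule nn_integral_mono_AE, use inj in eventually_elim, rule ennreal_leI)
    fix y :: "nat \<Rightarrow> 'a" assume inj: "inj_on y {..<n}"
    have "exp m * (1 + (- V y - m)) \<le> exp m * exp (- V y - m)"
      by (intro mult_left_mono exp_ge_add_one_self) auto
    also have "\<dots> = exp (- V y)" by (simp flip: exp_add)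
    also have "\<dots> = jdens Q n y" unfolding jdens_inj[OF inj] weight_eq V_def by (simp flip: exp_add)
    finally show "exp m * (1 + (- V y - m)) \<le> jdens Q n y" .
  qed
  \<comment> \<open>Passing from the trial law to Lebesgue measure by its density bound stands in
    for the entropy of the trial law; the price is only exponential in n, against energies of order
    n^2.\<close>
  also have "\<dots> \<le> ennreal (1 / v) ^ card {..<n} * (\<integral>\<^sup>+y. ennreal (jdens Q n y) \<partial>PiM {..<n} (\<lambda>_. lborel))"
  proof (rule nn_integral_PiM_le)
    show "f \<in> borel_measurable lborel \<Longrightarrow> (\<integral>\<^sup>+x. f x \<partial>\<mu>s) \<le> ennreal (1 / v) * (\<integral>\<^sup>+x. f x \<partial>lborel)" for f
      unfolding v_def by (rule density_leD[OF density_le_\<mu>s]) simp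
  qed (auto simp: borel_probD(2)[OF \<mu>s] intro: \<mu>s.p.sigma_finite_measure_axioms lborel.sigma_finite_measure_axioms)
  also have "\<dots> = ennreal ((1 / v) ^ n * Z n)"
    using v by (simp add: nn_Z ennreal_power ennreal_mult')
  finally have "exp m \<le> (1 / v) ^ n * Z n"
    using v by (subst (asm) ennreal_le_iff) (auto intro!: mult_nonneg_nonneg simp: Z_def jdens_nonneg Bochner_Integration.integral_nonneg)
  then have "v ^ n * exp m \<le> v ^ n * ((1 / v) ^ n * Z n)" using v by (intro mult_left_mono) auto
  also have "\<dots> = Z n" using v by (simp add: mult.assoc[symmetric] flip: power_mult_distrib)
  finally have "v ^ n * exp m \<le> Z n" .
  moreover have "exp (- (real n * (real n - 1) * Jbound + real n * (q\<mu> + \<delta> * (1 + q\<mu>)))) \<le> exp m"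
    unfolding m_def using EV by simp
  ultimately show ?thesis using v by (meson mult_left_mono order_trans zero_le_power less_imp_le)
qed

end

section \<open>Concentration of empirical averages\<close>

text \<open>With radii r \<le> r' and d = r' - r \<le> 1, the exponent changes by t d (2 r + d), at
  most t d (2 + r^2). Multiplied by exp(-t r^2), the two parts are at most 2 t d and d, whence 2 t +
  1.\<close>

lemma gauss_lipschitz:
  assumes t: "t > 0" and h: "norm h \<le> 1"
  shows "\<bar>gauss t (x + h) - gauss t x\<bar> \<le> (2 * t + 1) * norm h"
proof -
  have *: "exp (- t * r\<^sup>2) - exp (- t * r'\<^sup>2) \<le> (2 * t + 1) * (r' - r)"
    if r: "0 \<le> r" "r \<le> r'" "r' - r \<le> 1" for r r' :: real
  proof -
    define d where "d = r' - r"
    have d: "0 \<le> d" "d \<le> 1" using r by (auto simp: d_def)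
    have "1 - exp (- (t * (r'\<^sup>2 - r\<^sup>2))) \<le> t * (r'\<^sup>2 - r\<^sup>2)"
      using exp_ge_add_one_self[of "- (t * (r'\<^sup>2 - r\<^sup>2))"] by linarith
    also have "\<dots> = t * (d * (2 * r + d))" by (simp add: d_def power2_eq_square algebra_simps)
    also have "\<dots> \<le> t * (d * (2 + r\<^sup>2))"
    proof -
      have "2 * r \<le> 1 + r\<^sup>2" using zero_le_power2[of "r - 1"] by (simp add: power2_eq_square algebra_simps)
      then show ?thesis using t d by (intro mult_left_mono) auto
    qed
    finally have 1: "1 - exp (- (t * (r'\<^sup>2 - r\<^sup>2))) \<le> t * (d * (2 + r\<^sup>2))" .
    have "exp (- t * r\<^sup>2) - exp (- t * r'\<^sup>2) = exp (- t * r\<^sup>2) * (1 - exp (- (t * (r'\<^sup>2 - r\<^sup>2))))"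
      by (simp add: algebra_simps flip: exp_add)
    also have "\<dots> \<le> exp (- t * r\<^sup>2) * (t * (d * (2 + r\<^sup>2)))" by (intro mult_left_mono 1) auto
    also have "\<dots> = d * (2 * t * exp (- t * r\<^sup>2) + (t * r\<^sup>2) * exp (- (t * r\<^sup>2)))"
      by (simp add: algebra_simps)
    also have "\<dots> \<le> d * (2 * t * 1 + 1)"
    proof (intro mult_left_mono add_mono)
      show "exp (- t * r\<^sup>2) \<le> 1" using t by simp
      have "t * r\<^sup>2 \<le> exp (t * r\<^sup>2)" using exp_ge_add_one_self[of "t * r\<^sup>2"] by linarith
      then show "(t * r\<^sup>2) * exp (- (t * r\<^sup>2)) \<le> 1" by (simp add: exp_minus field_simps)
    qed (use t d in auto)
    finally show ?thesis by (simp add: d_def mult.commute)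
  qed
  have tri: "norm (x + h) - norm x \<le> norm h" "norm x - norm (x + h) \<le> norm h"
    using norm_triangle_ineq[of x h] norm_triangle_ineq4[of "x + h" h] by auto
  have mono: "exp (- t * b\<^sup>2) \<le> exp (- t * a\<^sup>2)" if "0 \<le> a" "a \<le> b" for a b :: real
    using that t by (simp add: power_mono)
  show ?thesis
  proof (cases "norm x \<le> norm (x + h)")
    case True
    have "gauss t x - gauss t (x + h) \<le> (2 * t + 1) * (norm (x + h) - norm x)"
      unfolding gauss_def by (rule *) (use True tri h in auto)
    also have "\<dots> \<le> (2 * t + 1) * norm h" using tri t by (intro mult_left_mono) auto
    finally show ?thesis using mono[OF _ True] by (simp add: gauss_def)
  next
    case False
    have "gauss t (x + h) - gauss t x \<le> (2 * t + 1) * (norm x - norm (x + h))"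
      unfolding gauss_def by (rule *) (use False tri h in auto)
    also have "\<dots> \<le> (2 * t + 1) * norm h" using tri t by (intro mult_left_mono) auto
    finally show ?thesis using mono[of "norm (x + h)" "norm x"] False by (simp add: gauss_def)
  qed
qed

context log_field
begin

text \<open>The Gibbs law of the n points, whose k-point marginal has density
  \<open>Rkn Q k n\<close>.\<close>

definition PN :: "nat \<Rightarrow> (nat \<Rightarrow> 'a) measure" where
  "PN n = density (PiM {..<n} (\<lambda>_. lborel)) (\<lambda>y. ennreal (jdens Q n y / Z n))"

lemma sets_PN [measurable_cong]: "sets (PN n) = sets (PiM {..<n} (\<lambda>_. lborel))"
  by (simp add: PN_def)

context
  fixes n :: nat
  assumes Zpos: "Z n > 0"
begin

lemma prob_space_PN: "prob_space (PN n)"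
proof
  have "emeasure (PN n) (space (PN n)) = (\<integral>\<^sup>+y. ennreal (1 / Z n) * ennreal (jdens Q n y) \<partial>PiM {..<n} (\<lambda>_. lborel))"
    unfolding PN_def using Zpos
    by (simp add: emeasure_density ennreal_mult'[symmetric] cong: nn_integral_cong)
  also have "\<dots> = ennreal (1 / Z n) * ennreal (Z n)"
    by (subst nn_integral_cmult) (auto simp: nn_Z)
  also have "\<dots> = 1" using Zpos by (simp add: ennreal_mult'[symmetric])
  finally show "emeasure (PN n) (space (PN n)) = 1" .
qed

lemma PN_integral:
  assumes [measurable]: "f \<in> borel_measurable (PiM {..<n} (\<lambda>_. lborel))"
  shows "integrable (PN n) f \<longleftrightarrow> integrable (PiM {..<n} (\<lambda>_. lborel)) (\<lambda>y. jdens Q n y * f y)"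
    "(\<integral>y. f y \<partial>PN n) = (\<integral>y. jdens Q n y * f y \<partial>PiM {..<n} (\<lambda>_. lborel)) / Z n"
proof -
  have "integrable (PN n) f \<longleftrightarrow> integrable (PiM {..<n} (\<lambda>_. lborel)) (\<lambda>y. (jdens Q n y / Z n) *\<^sub>R f y)"
    unfolding PN_def using Zpos jdens_nonneg by (intro integrable_density) auto
  also have "\<dots> \<longleftrightarrow> integrable (PiM {..<n} (\<lambda>_. lborel)) (\<lambda>y. (1 / Z n) * (jdens Q n y * f y))" by simp
  finally show "integrable (PN n) f \<longleftrightarrow> integrable (PiM {..<n} (\<lambda>_. lborel)) (\<lambda>y. jdens Q n y * f y)"
    using Zpos by (subst (asm) integrable_mult_left_iff) auto
  have "(\<integral>y. f y \<partial>PN n) = (\<integral>y. (jdens Q n y / Z n) *\<^sub>R f y \<partial>PiM {..<n} (\<lambda>_. lborel))"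
    unfolding PN_def using Zpos jdens_nonneg by (intro integral_density) auto
  also have "\<dots> = (\<integral>y. (jdens Q n y * f y) / Z n \<partial>PiM {..<n} (\<lambda>_. lborel))" by simp
  finally show "(\<integral>y. f y \<partial>PN n) = (\<integral>y. jdens Q n y * f y \<partial>PiM {..<n} (\<lambda>_. lborel)) / Z n" by simp
qed

lemma AE_PN_inj: "AE y in PN n. inj_on y {..<n}"
proof -
  have "AE y in PN n. ennreal (jdens Q n y / Z n) \<noteq> 0"
    unfolding PN_def by (subst AE_density) auto
  then show ?thesis by eventually_elim (use jdens_not_inj in \<open>force simp: ennreal_eq_0_iff\<close>)
qed

text \<open>Nonnegativity of the relative entropy of \<open>PN n\<close> with respect to the product weight.\<close>

lemma PN_hamiltonian:
  assumes n: "n \<ge> 1"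
  shows "integrable (PN n) (hamiltonian n)" "(\<integral>y. hamiltonian n y \<partial>PN n) \<le> ln (W ^ n / Z n)"
proof -
  interpret P: prob_space "PN n" by (rule prob_space_PN)
  let ?L = "PiM {..<n} (\<lambda>_. lborel :: 'a measure)"
  \<comment> \<open>The tangent inequality 1 + u \<le> exp u at u = H - k, multiplied by exp(- H)
    and the weight, H being the hamiltonian. For k = 0 it yields integrability of the energy, for
    the later choice of k the entropy bound.\<close>
  have key: "jdens Q n y * (hamiltonian n y - k + 1) \<le> exp (- k) * weight n y" for y k
  proof (cases "inj_on y {..<n}")
    case True
    have "exp (- hamiltonian n y) * (hamiltonian n y - k + 1) \<le> exp (- hamiltonian n y) * exp (hamiltonian n y - k)"
      using exp_ge_add_one_self[of "hamiltonian n y - k"] by (intro mult_left_mono) (auto simp: add.commute)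
    also have "\<dots> = exp (- k)" by (simp flip: exp_add)
    finally have "weight n y * (exp (- hamiltonian n y) * (hamiltonian n y - k + 1)) \<le> weight n y * exp (- k)"
      using weight_pos by (intro mult_left_mono) (auto simp: less_imp_le)
    then show ?thesis unfolding jdens_inj[OF True] by (simp add: mult_ac)
  next
    case False
    then show ?thesis using weight_pos[of n y] by (simp add: jdens_not_inj)
  qed
  define K where "K = offset * (real n * (real n - 1))"
  have K: "K \<ge> 0" using n offset(1) by (simp add: K_def)
  have bd: "\<bar>jdens Q n y * hamiltonian n y\<bar> \<le> weight n y + K * jdens Q n y" for y
  proof -
    have "jdens Q n y * hamiltonian n y \<le> weight n y" using key[of y 0] jdens_nonneg[of n y] by (simp add: distrib_left)
    moreover have "jdens Q n y * (- K) \<le> jdens Q n y * hamiltonian n y"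
      using hamiltonian_ge[OF n, of y] by (intro mult_left_mono jdens_nonneg) (simp add: K_def)
    moreover have "0 \<le> K * jdens Q n y" using K jdens_nonneg[of n y] by simp
    ultimately show ?thesis using weight_pos[of n y] unfolding abs_le_iff by (simp add: mult.commute)
  qed
  have i: "integrable ?L (\<lambda>y. jdens Q n y * hamiltonian n y)"
  proof (rule Bochner_Integration.integrable_bound)
    show "integrable ?L (\<lambda>y. weight n y + K * jdens Q n y)"
      using weight_integrable(1) jdens_integrable by auto
    show "AE y in ?L. norm (jdens Q n y * hamiltonian n y) \<le> norm (weight n y + K * jdens Q n y)"
      using bd by (intro AE_I2) (auto intro: order_trans[OF _ abs_ge_self])
  qed measurable
  then show iH: "integrable (PN n) (hamiltonian n)" by (subst PN_integral) auto
  \<comment> \<open>This value makes the integral of exp(- k) times the weight equal to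
    \<open>Z n\<close>, so that after normalization the inequality reads: mean energy minus k plus 1
    is at most 1.\<close>
  define k where "k = ln (W ^ n / Z n)"
  have ek: "exp (- k) * W ^ n = Z n" using Zpos W_pos by (simp add: k_def exp_minus)
  have "(\<integral>y. jdens Q n y * (hamiltonian n y - k + 1) \<partial>?L) \<le> (\<integral>y. exp (- k) * weight n y \<partial>?L)"
  proof (rule integral_mono)
    have "integrable ?L (\<lambda>y. jdens Q n y * hamiltonian n y - jdens Q n y * (k - 1))"
      using i jdens_integrable by auto
    then show "integrable ?L (\<lambda>y. jdens Q n y * (hamiltonian n y - k + 1))" by (simp add: algebra_simps)
  qed (use weight_integrable(1) key in auto)
  also have "\<dots> = Z n" using weight_integrable(2)[of n] ek by simp
  finally have "(\<integral>y. hamiltonian n y - k + 1 \<partial>PN n) \<le> 1"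
    using Zpos by (subst PN_integral(2)) auto
  moreover have "(\<integral>y. hamiltonian n y - k + 1 \<partial>PN n) = (\<integral>y. hamiltonian n y \<partial>PN n) - k + 1"
    using iH by (simp add: P.prob_space)
  ultimately show "(\<integral>y. hamiltonian n y \<partial>PN n) \<le> ln (W ^ n / Z n)" by (simp add: k_def)
qed

lemma PN_sum_Q:
  assumes n: "n \<ge> 2"
  shows "integrable (PN n) (\<lambda>y. \<Sum>i<n. Q (y i))"
    "(\<integral>y. (\<Sum>i<n. Q (y i)) \<partial>PN n) \<le> 2 / (real n - 1) * (\<integral>y. hamiltonian n y \<partial>PN n) + 2 * offset * real n"
proof -
  interpret P: prob_space "PN n" by (rule prob_space_PN)
  note H = PN_hamiltonian(1)
  let ?b = "\<lambda>y. 2 / (real n - 1) * hamiltonian n y + 2 * offset * real n"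
  have le: "(\<Sum>i<n. Q (y i)) \<le> ?b y" for y
  proof -
    have "(\<Sum>i<n. Q (y i)) = 2 / (real n - 1) * ((real n - 1) / 2 * (\<Sum>i<n. Q (y i)))" using n by simp
    also have "\<dots> \<le> 2 / (real n - 1) * (hamiltonian n y + offset * (real n * (real n - 1)))"
      using n by (intro mult_left_mono sum_Q_le_hamiltonian) auto
    also have "\<dots> = ?b y" using n by (simp add: field_simps)
    finally show ?thesis .
  qed
  have ib: "integrable (PN n) ?b" using H n by auto
  show i: "integrable (PN n) (\<lambda>y. \<Sum>i<n. Q (y i))"
  proof (rule Bochner_Integration.integrable_bound[OF ib])
    show "AE y in PN n. norm (\<Sum>i<n. Q (y i)) \<le> norm (?b y)"
      using le by (intro AE_I2) (auto simp: abs_of_nonneg sum_nonneg Q_nonneg intro: order_trans[OF _ abs_ge_self])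
  qed measurable
  have "(\<integral>y. (\<Sum>i<n. Q (y i)) \<partial>PN n) \<le> (\<integral>y. ?b y \<partial>PN n)" by (rule integral_mono[OF i ib le])
  also have "\<dots> = 2 / (real n - 1) * (\<integral>y. hamiltonian n y \<partial>PN n) + 2 * offset * real n"
    using H n by (simp add: P.prob_space)
  finally show "(\<integral>y. (\<Sum>i<n. Q (y i)) \<partial>PN n) \<le> 2 / (real n - 1) * (\<integral>y. hamiltonian n y \<partial>PN n) + 2 * offset * real n" .
qed

end

end

context smoothed_equilibrium
begin

lemma Z_pos: "n \<ge> 1 \<Longrightarrow> Z n > 0"
  by (rule less_le_trans[OF _ Z_lower]) (use emeasure_cball_finite_pos(2)[OF s, where 'a='a] in \<open>auto intro!: mult_pos_pos\<close>)

text \<open>Upper bound by entropy and lower bound by Jensen meet. The masses W^n and v^n and the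
  extra copy of the field contribute terms linear in n; these are collected in K, which may depend
  on s.\<close>

lemma PN_hamiltonian_le:
  "\<exists>K\<ge>0. \<forall>n\<ge>1. (\<integral>y. hamiltonian n y \<partial>PN n) \<le> real n * (real n - 1) * Jbound + real n * K"
proof -
  define v where "v = measure lborel (cball (0::'a) s)"
  have v: "v > 0" unfolding v_def using emeasure_cball_finite_pos(2)[OF s] .
  define c where "c = q\<mu> + \<delta> * (1 + q\<mu>)"
  have "(\<integral>y. hamiltonian n y \<partial>PN n) \<le> real n * (real n - 1) * Jbound + real n * \<bar>ln W - ln v + c\<bar>" if n: "n \<ge> 1" for n
  proof -
    let ?E = "real n * (real n - 1) * Jbound + real n * c"
    have "ln (v ^ n * exp (- ?E)) \<le> ln (Z n)"
      using Z_lower[OF n] v Z_pos[OF n] unfolding v_def[symmetric] c_def by (subst ln_le_cancel_iff) auto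
    then have "real n * ln v - ?E \<le> ln (Z n)" using v by (simp add: ln_mult ln_realpow)
    moreover have "(\<integral>y. hamiltonian n y \<partial>PN n) \<le> real n * ln W - ln (Z n)"
      using PN_hamiltonian(2)[OF Z_pos[OF n] n] W_pos Z_pos[OF n] by (simp add: ln_div ln_realpow)
    ultimately have "(\<integral>y. hamiltonian n y \<partial>PN n) \<le> real n * (real n - 1) * Jbound + real n * (ln W - ln v + c)"
      by (simp add: algebra_simps)
    also have "\<dots> \<le> real n * (real n - 1) * Jbound + real n * \<bar>ln W - ln v + c\<bar>"
      by (intro add_left_mono mult_left_mono) auto
    finally show ?thesis .
  qed
  then show ?thesis by (intro exI[of _ "\<bar>ln W - ln v + c\<bar>"]) auto
qed

text \<open>\<open>configuration_bound\<close> in the mean. The leading energy cancels against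
  \<open>L\<mu> + q\<mu>\<close> up to \<delta> (1 + \<open>q\<mu>\<close>), and 2
  (\<open>Jbound\<close> + \<open>offset\<close>) bounds the limiting mean field per point. All
  other errors vanish as n grows with the remaining parameters fixed.\<close>

lemma PN_discrepancy_eventually:
  assumes \<rho>: "0 < \<rho>" "\<rho> \<le> 1" and \<theta>: "0 < \<theta>" "\<theta> \<le> t" and r: "r > 0"
  shows "\<forall>\<^sub>F n in sequentially. (\<integral>y. \<theta> * (exp (- (2 * t * \<rho>^4)) / (4 * t) *
      (((\<Sum>i<n. gauss t (y i - z)) / n - gauss_pot t \<mu>s z)\<^sup>2 / 2 - (2 * \<theta> / t)\<^sup>2)) \<partial>PN n)
     \<le> \<delta> * (2 + q\<mu> + 2 * (Jbound + offset)) + 4 * \<rho> * Bs + r"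
proof -
  obtain K where K: "K \<ge> 0" "\<And>n. n \<ge> 1 \<Longrightarrow> (\<integral>y. hamiltonian n y \<partial>PN n) \<le> real n * (real n - 1) * Jbound + real n * K"
    using PN_hamiltonian_le by blast
  define b where "b n = \<delta> * (2 + q\<mu>) + (\<delta> + 1 / real n) * (2 * (Jbound + offset) + 2 * K / (real n - 1))
     + 4 * \<rho> * Bs + (K + \<bar>Jbound\<bar> - ln (\<rho>^4) / 2) / real n" for n
  have c0: "(\<lambda>n. c / real n) \<longlonglongrightarrow> 0" for c by real_asymp
  have "b \<longlonglongrightarrow> \<delta> * (2 + q\<mu>) + (\<delta> + 0) * (2 * (Jbound + offset) + 0) + 4 * \<rho> * Bs + 0"
    unfolding b_def
    by (intro tendsto_add tendsto_mult tendsto_const c0) real_asymp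
  then have "\<forall>\<^sub>F n in sequentially. b n < (\<delta> * (2 + q\<mu>) + (\<delta> + 0) * (2 * (Jbound + offset) + 0) + 4 * \<rho> * Bs + 0) + r"
    by (rule order_tendstoD) (use r in simp)
  then have "\<forall>\<^sub>F n in sequentially. b n \<le> \<delta> * (2 + q\<mu> + 2 * (Jbound + offset)) + 4 * \<rho> * Bs + r"
    by eventually_elim (simp add: algebra_simps)
  moreover have "\<forall>\<^sub>F n in sequentially. n \<ge> (2::nat)" by (rule eventually_ge_at_top)
  ultimately show ?thesis
  proof eventually_elim
    case (elim n)
    have n: "n \<ge> 2" "n \<ge> 1" "n > 0" using elim by auto
    note Zp = Z_pos[OF n(2)]
    interpret P: prob_space "PN n" by (rule prob_space_PN[OF Zp])
    note H = PN_hamiltonian[OF Zp n(2)] and SQ = PN_sum_Q[OF Zp n(1)]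
    let ?X = "\<lambda>y. \<theta> * (exp (- (2 * t * \<rho>^4)) / (4 * t) *
      (((\<Sum>i<n. gauss t (y i - z)) / n - gauss_pot t \<mu>s z)\<^sup>2 / 2 - (2 * \<theta> / t)\<^sup>2))"
    let ?R = "\<lambda>y. hamiltonian n y / (real n)\<^sup>2 - (L\<mu> + q\<mu>) + \<delta> + (\<delta> + 1 / n) * ((\<Sum>i<n. Q (y i)) / n)
      + 4 * \<rho> * Bs - ln (\<rho>^4) / (2 * n)"
    define EH where "EH = (\<integral>y. hamiltonian n y \<partial>PN n)"
    define ES where "ES = (\<integral>y. (\<Sum>i<n. Q (y i)) \<partial>PN n)"
    have iR: "integrable (PN n) ?R"
      using H(1) SQ(1) by (intro Bochner_Integration.integrable_add Bochner_Integration.integrable_diff integrable_mult_right integrable_divide) auto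
    have EH: "EH / (real n)\<^sup>2 \<le> Jbound + (K + \<bar>Jbound\<bar>) / n"
    proof -
      have "EH \<le> real n * (real n - 1) * Jbound + real n * K" unfolding EH_def by (rule K(2)[OF n(2)])
      also have "\<dots> = (Jbound + (K - Jbound) / n) * (real n)\<^sup>2" using n by (simp add: field_simps power2_eq_square)
      also have "\<dots> \<le> (Jbound + (K + \<bar>Jbound\<bar>) / n) * (real n)\<^sup>2"
        using n by (intro mult_right_mono add_left_mono divide_right_mono) auto
      finally show ?thesis using n by (subst pos_divide_le_eq) auto
    qed
    have ES: "ES / n \<le> 2 * (Jbound + offset) + 2 * K / (real n - 1)"
    proof -
      have "ES \<le> 2 / (real n - 1) * EH + 2 * offset * real n" unfolding ES_def EH_def by (rule SQ(2))
      also have "\<dots> \<le> 2 / (real n - 1) * (real n * (real n - 1) * Jbound + real n * K) + 2 * offset * real n"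
        unfolding EH_def using n by (intro add_right_mono mult_left_mono K(2)) auto
      also have "\<dots> = (2 * (Jbound + offset) + 2 * K / (real n - 1)) * n"
        using n by (simp add: field_simps)
      finally show ?thesis using n by (subst pos_divide_le_eq) auto
    qed
    have iX: "integrable (PN n) ?X"
    proof (rule P.integrable_const_bound)
      define B where "B = \<theta> * (exp (- (2 * t * \<rho>^4)) / (4 * t) * (1 + (2 * \<theta> / t)\<^sup>2))"
      show "AE y in PN n. norm (?X y) \<le> B"
      proof (rule AE_I2)
        fix y
        define A where "A = (\<Sum>i<n. gauss t (y i - z)) / n - gauss_pot t \<mu>s z"
        have a1: "0 \<le> (\<Sum>i<n. gauss t (y i - z)) / n" by (intro divide_nonneg_nonneg sum_nonneg) auto
        have "(\<Sum>i<n. gauss t (y i - z)) \<le> (\<Sum>i<n. 1)" using \<theta> by (intro sum_mono gauss_le_1) auto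
        then have a2: "(\<Sum>i<n. gauss t (y i - z)) / n \<le> 1" using n by (simp add: field_simps)
        have "\<bar>A\<bar> \<le> 1" unfolding A_def using a1 a2 gauss_pot_props(2,3)[OF \<mu>s, of t z] \<theta> by (simp add: abs_le_iff)
        then have "A\<^sup>2 \<le> 1" by (simp add: abs_square_le_1)
        then have "\<bar>A\<^sup>2 / 2 - (2 * \<theta> / t)\<^sup>2\<bar> \<le> 1 + (2 * \<theta> / t)\<^sup>2"
          using zero_le_power2[of A] zero_le_power2[of "2 * \<theta> / t"] by linarith
        then have "\<theta> * (exp (- (2 * t * \<rho>^4)) / (4 * t) * \<bar>A\<^sup>2 / 2 - (2 * \<theta> / t)\<^sup>2\<bar>) \<le> B"
          unfolding B_def using \<theta> by (intro mult_left_mono) auto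
        then show "norm (?X y) \<le> B" unfolding A_def[symmetric] using \<theta> by (simp add: abs_mult)
      qed
    qed measurable
    have "(\<integral>y. ?X y \<partial>PN n) \<le> (\<integral>y. ?R y \<partial>PN n)"
    proof (rule integral_mono_AE[OF iX iR])
      show "AE y in PN n. ?X y \<le> ?R y"
        using AE_PN_inj[OF Zp]
      proof eventually_elim
        case (elim y)
        show ?case using configuration_bound[OF n(3) elim \<rho> \<theta>, of z] by simp
      qed
    qed
    also have "(\<integral>y. ?R y \<partial>PN n) = EH / (real n)\<^sup>2 - (L\<mu> + q\<mu>) + \<delta> + (\<delta> + 1 / n) * (ES / n) + 4 * \<rho> * Bs - ln (\<rho>^4) / (2 * n)"
      unfolding EH_def ES_def using H(1) SQ(1) by (simp add: P.prob_space)
    also have "\<dots> \<le> (Jbound + (K + \<bar>Jbound\<bar>) / n) - (L\<mu> + q\<mu>) + \<delta> + (\<delta> + 1 / n) * (2 * (Jbound + offset) + 2 * K / (real n - 1)) + 4 * \<rho> * Bs - ln (\<rho>^4) / (2 * n)"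
    proof -
      have "(\<delta> + 1 / n) * (ES / n) \<le> (\<delta> + 1 / n) * (2 * (Jbound + offset) + 2 * K / (real n - 1))"
        using ES \<delta> by (intro mult_left_mono) auto
      then show ?thesis using EH by linarith
    qed
    also have "\<dots> = b n" unfolding b_def Jbound_def by (simp add: algebra_simps add_divide_distrib diff_divide_distrib)
    also have "\<dots> \<le> \<delta> * (2 + q\<mu> + 2 * (Jbound + offset)) + 4 * \<rho> * Bs + r" by (rule elim)
    finally show ?case .
  qed
qed

text \<open>Couple x with x + h under one law, where |h| \<le> s, and apply the Lipschitz bound of
  the Gaussian.\<close>

lemma gauss_pot_smear_close:
  assumes t: "t > 0" and s1: "s \<le> 1"
  shows "\<bar>gauss_pot t \<mu>s z - gauss_pot t \<mu> z\<bar> \<le> (2 * t + 1) * s"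
proof -
  let ?P = "\<mu> \<Otimes>\<^sub>M (unif_ball s :: 'a measure)"
  interpret u: prob_space "unif_ball s :: 'a measure" using borel_prob_unif_ball[OF s] by (rule borel_probD)
  interpret pair_prob_space \<mu> "unif_ball s :: 'a measure" ..
  have [measurable_cong]: "sets (unif_ball s :: 'a measure) = sets borel" by (simp add: unif_ball_def)
  have b: "\<bar>gauss t x\<bar> \<le> 1" for x :: 'a using gauss_le_1[of t x] t by simp
  have i1: "integrable ?P (\<lambda>z'. gauss t (fst z' - z + snd z'))"
    by (rule integrable_const_bound[where B=1]) (use b in auto)
  have i2: "integrable ?P (\<lambda>z'. gauss t (fst z' - z))"
    by (rule integrable_const_bound[where B=1]) (use b in auto)
  have "gauss_pot t \<mu>s z = (\<integral>z'. gauss t (fst z' - z + snd z') \<partial>?P)"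
    unfolding gauss_pot_def \<mu>s_def smear_def
    by (subst integral_distr) (auto simp: case_prod_unfold algebra_simps)
  moreover have "gauss_pot t \<mu> z = (\<integral>z'. gauss t (fst z' - z) \<partial>?P)"
    unfolding gauss_pot_def
    using pair_marginals(2)[OF \<mu>.prob_space_axioms u.prob_space_axioms gauss_pot_props(1)[OF \<mu>], of t z] t by simp
  ultimately have "\<bar>gauss_pot t \<mu>s z - gauss_pot t \<mu> z\<bar> = \<bar>\<integral>z'. gauss t (fst z' - z + snd z') - gauss t (fst z' - z) \<partial>?P\<bar>"
    using i1 i2 by simp
  also have "\<dots> \<le> (\<integral>z'. \<bar>gauss t (fst z' - z + snd z') - gauss t (fst z' - z)\<bar> \<partial>?P)"
    by (rule integral_abs_bound)
  also have "\<dots> \<le> (\<integral>z'. (2 * t + 1) * s \<partial>?P)"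
  proof (rule integral_mono_AE)
    have AEs: "AE z in ?P. norm (snd z) \<le> s"
      using AE_unif_ball[OF s] by (intro AE_pair_measure) auto
    then show "AE z' in ?P. \<bar>gauss t (fst z' - z + snd z') - gauss t (fst z' - z)\<bar> \<le> (2 * t + 1) * s"
    proof eventually_elim
      case (elim z')
      have "\<bar>gauss t (fst z' - z + snd z') - gauss t (fst z' - z)\<bar> \<le> (2 * t + 1) * norm (snd z')"
        using elim s1 t by (intro gauss_lipschitz) auto
      also have "\<dots> \<le> (2 * t + 1) * s" using elim t by (intro mult_left_mono) auto
      finally show ?case .
    qed
  qed (use i1 i2 in auto)
  finally show ?thesis by (simp add: prob_space)
qed

end

context log_equilibrium
begin

lemma Z_pos: "n \<ge> 1 \<Longrightarrow> Z n > 0"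
proof -
  assume n: "n \<ge> 1"
  obtain s where "s > 0" "\<And>x h. norm h \<le> s \<Longrightarrow> \<bar>Q (x + h) - Q x\<bar> \<le> 1 * (1 + Q x)"
    using Q_slow[of 1] by auto
  then interpret smoothed_equilibrium Q \<mu> s 1 by unfold_locales auto
  show ?thesis using Z_pos[OF n] .
qed

text \<open>The parameters are fixed in the order \<theta>, \<delta>, s, \<rho>, and n comes last.
  Each choice must leave the earlier ones valid, which is why bounds uniform in the later parameters
  are prepared in advance.\<close>

lemma PN_gauss_discrepancy:
  assumes t: "t > 0"
  shows "(\<lambda>n. \<integral>y. ((\<Sum>i<n. gauss t (y i - z)) / n - gauss_pot t \<mu> z)\<^sup>2 \<partial>PN n) \<longlonglongrightarrow> 0"
proof (rule tendstoI)
  fix e :: real assume e: "e > 0"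
  define \<theta> where "\<theta> = t * min 1 (sqrt e / 8)"
  have \<theta>: "0 < \<theta>" "\<theta> \<le> t" using t e by (auto simp: \<theta>_def intro!: mult_pos_pos)
  have c: "4 * (2 * \<theta> / t)\<^sup>2 \<le> e / 4"
  proof -
    have "\<theta> / t \<le> sqrt e / 8" using t by (simp add: \<theta>_def)
    then have "(\<theta> / t)\<^sup>2 \<le> (sqrt e / 8)\<^sup>2" using \<theta> t by (intro power_mono) auto
    then show ?thesis using e by (simp add: power_divide power_mult_distrib mult.commute)
  qed
  \<comment> \<open>A lower bound for the Gaussian weight valid for every \<rho> \<le> 1, so that
    the tolerance R and with it \<delta> can be fixed before \<rho>.\<close>
  define w0 where "w0 = \<theta> * (exp (- (2 * t)) / (4 * t))"
  have w0: "w0 > 0" using \<theta> t by (simp add: w0_def)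
  define R where "R = e * w0 / 16"
  have R: "R > 0" using e w0 by (simp add: R_def)
  \<comment> \<open>A bound for the factor multiplying \<delta> in the error that holds for all
    \<delta> \<le> 1; \<open>Jbound\<close> itself depends on \<delta>, so defining \<delta> through
    it would be circular.\<close>
  define C where "C = 2 + q\<mu> + 2 * (\<bar>L\<mu>\<bar> + 2 * q\<mu> + 1 + offset)"
  have C: "C > 0" using q\<mu>_nonneg offset(1) by (simp add: C_def add_pos_nonneg)
  define \<delta> where "\<delta> = min 1 (R / (3 * C))"
  have \<delta>: "0 < \<delta>" "\<delta> \<le> 1" "\<delta> * C \<le> R / 3"
    using R C by (auto simp: \<delta>_def min_def field_simps)
  obtain s1 where s1: "s1 > 0" "\<And>x h. norm h \<le> s1 \<Longrightarrow> \<bar>Q (x + h) - Q x\<bar> \<le> \<delta> * (1 + Q x)"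
    using Q_slow[OF \<delta>(1)] by auto
  define s where "s = min s1 (min 1 (sqrt e / (4 * (2 * t + 1))))"
  have s: "s > 0" "s \<le> 1" "s \<le> s1" using s1 e t by (auto simp: s_def)
  have st: "2 * ((2 * t + 1) * s)\<^sup>2 \<le> e / 8"
  proof -
    have "s \<le> sqrt e / (4 * (2 * t + 1))" by (simp add: s_def)
    then have "(2 * t + 1) * s \<le> (2 * t + 1) * (sqrt e / (4 * (2 * t + 1)))" using t by (intro mult_left_mono) auto
    also have "\<dots> = sqrt e / 4" using t by (simp add: field_simps)
    finally have "((2 * t + 1) * s)\<^sup>2 \<le> (sqrt e / 4)\<^sup>2" using s t by (intro power_mono) auto
    then show ?thesis using e by (simp add: power_divide)
  qed
  interpret sm: smoothed_equilibrium Q \<mu> s \<delta>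
    by unfold_locales (use s s1 \<delta> in auto)
  \<comment> \<open>Chosen after s, because the singularity bound \<open>Bs\<close> belongs to the
    smoothing scale. Adding 1 keeps the denominator positive.\<close>
  define \<rho> where "\<rho> = min 1 (R / (12 * (sm.Bs + 1)))"
  have Bs: "sm.Bs \<ge> 0" using sm.Bs by simp
  have \<rho>: "0 < \<rho>" "\<rho> \<le> 1" using R Bs by (auto simp: \<rho>_def)
  have \<rho>B: "4 * \<rho> * sm.Bs \<le> R / 3"
  proof -
    have "\<rho> * sm.Bs \<le> (R / (12 * (sm.Bs + 1))) * (sm.Bs + 1)"
      using \<rho> Bs R by (intro mult_mono) (auto simp: \<rho>_def)
    also have "\<dots> = R / 12" using Bs by (simp add: field_simps)
    finally show ?thesis by simp
  qed
  have dJ: "\<delta> * (2 + q\<mu> + 2 * (sm.Jbound + offset)) \<le> R / 3"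
  proof -
    have "\<delta> * (1 + q\<mu>) \<le> 1 * (1 + q\<mu>)" using \<delta> q\<mu>_nonneg by (intro mult_right_mono) auto
    then have "2 + q\<mu> + 2 * (sm.Jbound + offset) \<le> C" unfolding sm.Jbound_def C_def by (simp add: abs_if)
    then have "\<delta> * (2 + q\<mu> + 2 * (sm.Jbound + offset)) \<le> \<delta> * C" using \<delta> by (intro mult_left_mono) auto
    then show ?thesis using \<delta> by linarith
  qed
  define w where "w = \<theta> * (exp (- (2 * t * \<rho>^4)) / (4 * t))"
  have w: "w0 \<le> w"
  proof -
    have "\<rho>^4 \<le> 1" using \<rho> by (simp add: power_le_one)
    then show ?thesis unfolding w_def w0_def using \<theta> t by (intro mult_left_mono divide_right_mono) (auto simp: mult_left_le)
  qed
  have "\<forall>\<^sub>F n in sequentially. (\<integral>y. \<theta> * (exp (- (2 * t * \<rho>^4)) / (4 * t) *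
      (((\<Sum>i<n. gauss t (y i - z)) / n - gauss_pot t sm.\<mu>s z)\<^sup>2 / 2 - (2 * \<theta> / t)\<^sup>2)) \<partial>PN n)
     \<le> \<delta> * (2 + q\<mu> + 2 * (sm.Jbound + offset)) + 4 * \<rho> * sm.Bs + R / 3"
    by (rule sm.PN_discrepancy_eventually[OF \<rho> \<theta>]) (use R in simp)
  moreover have "\<forall>\<^sub>F n in sequentially. n \<ge> (1::nat)" by (rule eventually_ge_at_top)
  ultimately show "\<forall>\<^sub>F n in sequentially. dist (\<integral>y. ((\<Sum>i<n. gauss t (y i - z)) / n - gauss_pot t \<mu> z)\<^sup>2 \<partial>PN n) 0 < e"
  proof eventually_elim
    case (elim n)
    then have n: "n \<ge> 1" "n > 0" by auto
    interpret P: prob_space "PN n" by (rule prob_space_PN[OF Z_pos[OF n(1)]])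
    define A where "A y = (\<Sum>i<n. gauss t (y i - z)) / n - gauss_pot t sm.\<mu>s z" for y
    define D where "D y = (\<Sum>i<n. gauss t (y i - z)) / n - gauss_pot t \<mu> z" for y
    have m[measurable]: "A \<in> borel_measurable (PN n)" "D \<in> borel_measurable (PN n)"
      unfolding A_def D_def by measurable
    have bnd: "\<bar>(\<Sum>i<n. gauss t (y i - z)) / n - gauss_pot t p z\<bar> \<le> 1" if "borel_prob p" for y p
    proof -
      have a1: "0 \<le> (\<Sum>i<n. gauss t (y i - z)) / n" by (intro divide_nonneg_nonneg sum_nonneg) auto
      have "(\<Sum>i<n. gauss t (y i - z)) \<le> (\<Sum>i<n. 1)" using t by (intro sum_mono gauss_le_1) auto
      then have a2: "(\<Sum>i<n. gauss t (y i - z)) / n \<le> 1" using n by (simp add: field_simps)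
      show ?thesis using a1 a2 gauss_pot_props(2,3)[OF that, of t z] t by (simp add: abs_le_iff)
    qed
    have iA: "integrable (PN n) (\<lambda>y. (A y)\<^sup>2)"
      by (rule P.integrable_const_bound[where B=1]) (use bnd[OF sm.\<mu>s] in \<open>auto simp: A_def abs_square_le_1\<close>)
    have iD: "integrable (PN n) (\<lambda>y. (D y)\<^sup>2)"
      by (rule P.integrable_const_bound[where B=1]) (use bnd[OF \<mu>] in \<open>auto simp: D_def abs_square_le_1\<close>)
    define EA where "EA = (\<integral>y. (A y)\<^sup>2 \<partial>PN n)"
    have "w * (EA / 2 - (2 * \<theta> / t)\<^sup>2) = (\<integral>y. w * ((A y)\<^sup>2 / 2 - (2 * \<theta> / t)\<^sup>2) \<partial>PN n)"
      unfolding EA_def using iA by (simp add: P.prob_space)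
    also have "\<dots> = (\<integral>y. \<theta> * (exp (- (2 * t * \<rho>^4)) / (4 * t) *
      (((\<Sum>i<n. gauss t (y i - z)) / n - gauss_pot t sm.\<mu>s z)\<^sup>2 / 2 - (2 * \<theta> / t)\<^sup>2)) \<partial>PN n)"
      unfolding A_def w_def by (simp only: mult.assoc)
    also have "\<dots> \<le> \<delta> * (2 + q\<mu> + 2 * (sm.Jbound + offset)) + 4 * \<rho> * sm.Bs + R / 3"
      by (rule elim(1))
    also have "\<dots> \<le> R" using dJ \<rho>B by linarith
    finally have "EA / 2 - (2 * \<theta> / t)\<^sup>2 \<le> R / w" using w w0 by (simp add: field_simps)
    also have "\<dots> \<le> R / w0" using w w0 R by (intro divide_left_mono) auto
    also have "\<dots> = e / 16" using w0 by (simp add: R_def)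
    finally have EA: "EA \<le> e / 8 + 2 * (2 * \<theta> / t)\<^sup>2" by simp
    have "(\<integral>y. (D y)\<^sup>2 \<partial>PN n) \<le> (\<integral>y. 2 * (A y)\<^sup>2 + 2 * ((2 * t + 1) * s)\<^sup>2 \<partial>PN n)"
    proof (rule integral_mono[OF iD])
      fix y
      define g where "g = gauss_pot t sm.\<mu>s z - gauss_pot t \<mu> z"
      have "\<bar>g\<bar> \<le> (2 * t + 1) * s" unfolding g_def by (rule sm.gauss_pot_smear_close[OF t s(2)])
      then have g: "g\<^sup>2 \<le> ((2 * t + 1) * s)\<^sup>2" by (metis abs_ge_zero power2_abs power_mono)
      have "D y = A y + g" by (simp add: D_def A_def g_def)
      then have "(D y)\<^sup>2 \<le> 2 * (A y)\<^sup>2 + 2 * g\<^sup>2"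
        using zero_le_power2[of "A y - g"] by (simp add: power2_eq_square algebra_simps)
      then show "(D y)\<^sup>2 \<le> 2 * (A y)\<^sup>2 + 2 * ((2 * t + 1) * s)\<^sup>2" using g by linarith
    qed (use iA in auto)
    also have "\<dots> = 2 * EA + 2 * ((2 * t + 1) * s)\<^sup>2"
      unfolding EA_def using iA by (simp add: P.prob_space)
    also have "\<dots> \<le> e / 4 + e / 4 + e / 8" using EA c st by linarith
    also have "\<dots> < e" using e by simp
    finally have "(\<integral>y. (D y)\<^sup>2 \<partial>PN n) < e" .
    moreover have "0 \<le> (\<integral>y. (D y)\<^sup>2 \<partial>PN n)" by (rule Bochner_Integration.integral_nonneg) simp
    ultimately show ?case by (simp add: D_def)
  qed
qed

end

section \<open>Weak convergence from Gaussian products\<close>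

abbreviation (input) lebesgue_prod :: "nat \<Rightarrow> (nat \<Rightarrow> 'a::euclidean_space) measure" where
  "lebesgue_prod k \<equiv> PiM {..<k} (\<lambda>_. lborel)"

abbreviation (input) config_space :: "nat \<Rightarrow> (nat \<Rightarrow> 'a) set" where
  "config_space k \<equiv> (\<Pi>\<^sub>E j\<in>{..<k}. UNIV)"

lemma space_lebesgue_prod: "space (lebesgue_prod k) = config_space k"
  by (simp add: space_PiM)

text \<open>Restriction to the first k indices is a continuous retraction of the full function space
  onto \<open>config_space k\<close>, so \<phi> extends continuously and the extension is Borel. The
  identity is measurable from the product \<sigma>-algebra to the Borel sets because this can be
  checked coordinate by coordinate.\<close>

lemma continuous_on_config_measurable:
  fixes \<phi> :: "(nat \<Rightarrow> 'a::euclidean_space) \<Rightarrow> real"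
  assumes "continuous_on (config_space k) \<phi>"
  shows "\<phi> \<in> borel_measurable (lebesgue_prod k)"
proof -
  have r: "continuous_on UNIV (\<lambda>y::nat \<Rightarrow> 'a. restrict y {..<k})"
  proof (rule continuous_on_coordinatewise_then_product)
    fix i
    show "continuous_on UNIV (\<lambda>y::nat \<Rightarrow> 'a. restrict y {..<k} i)"
      by (cases "i < k") auto
  qed
  have "continuous_on UNIV (\<lambda>y. \<phi> (restrict y {..<k}))"
    by (rule continuous_on_compose2[OF assms r]) (auto simp: PiE_def extensional_def)
  then have [measurable]: "(\<lambda>y. \<phi> (restrict y {..<k})) \<in> borel_measurable borel"
    by (rule borel_measurable_continuous_onI)
  have id: "(\<lambda>y. y) \<in> borel_measurable (lebesgue_prod k :: (nat \<Rightarrow> 'a) measure)"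
  proof (rule measurable_coordinatewise_then_product)
    fix i
    show "(\<lambda>y. y i) \<in> borel_measurable (lebesgue_prod k :: (nat \<Rightarrow> 'a) measure)"
    proof (cases "i < k")
      case True
      then have "(\<lambda>y::nat \<Rightarrow> 'a. y i) \<in> measurable (lebesgue_prod k) (lborel :: 'a measure)"
        by (intro measurable_component_singleton) auto
      then show ?thesis by simp
    next
      case False
      have "(\<lambda>y::nat \<Rightarrow> 'a. y i) \<in> borel_measurable (lebesgue_prod k) \<longleftrightarrow> (\<lambda>y. undefined :: 'a) \<in> borel_measurable (lebesgue_prod k :: (nat \<Rightarrow> 'a) measure)"
        by (rule measurable_cong) (use False in \<open>auto simp: space_PiM PiE_def extensional_def\<close>)
      then show ?thesis by (simp only: measurable_const space_borel UNIV_I)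
    qed
  qed
  have "(\<lambda>y. \<phi> (restrict y {..<k})) \<in> borel_measurable (lebesgue_prod k)"
    by (rule measurable_compose[OF id]) measurable
  then show ?thesis
    by (subst measurable_cong[where g="\<lambda>y. \<phi> (restrict y {..<k})"]) (auto simp: space_PiM PiE_restrict)
qed

text \<open>The sum form is suited to Gaussian smoothing: its mean splits into first moments of
  single coordinates.\<close>

definition config_dist :: "nat \<Rightarrow> (nat \<Rightarrow> 'a::euclidean_space) \<Rightarrow> (nat \<Rightarrow> 'a) \<Rightarrow> real" where
  "config_dist k x y = (\<Sum>i<k. norm (x i - y i))"

lemma config_dist_nonneg: "0 \<le> config_dist k x y"
  unfolding config_dist_def by (intro sum_nonneg) auto

lemma config_dist_triangle: "config_dist k x z \<le> config_dist k x y + config_dist k y z"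
  unfolding config_dist_def sum.distrib[symmetric] by (intro sum_mono) (metis norm_triangle_ineq diff_add_cancel add_diff_eq)

lemma lipschitz_config_continuous:
  fixes \<psi> :: "(nat \<Rightarrow> 'a::euclidean_space) \<Rightarrow> real"
  assumes L: "\<And>x y. x \<in> config_space k \<Longrightarrow> y \<in> config_space k \<Longrightarrow> \<bar>\<psi> x - \<psi> y\<bar> \<le> L * config_dist k x y"
  shows "continuous_on (config_space k) \<psi>"
  unfolding continuous_on_def
proof
  fix x :: "nat \<Rightarrow> 'a" assume x: "x \<in> config_space k"
  have "continuous_on UNIV (\<lambda>y. L * config_dist k y x)" unfolding config_dist_def
    by (intro continuous_intros) auto
  then have "continuous_on (config_space k) (\<lambda>y. L * config_dist k y x)"
    by (rule continuous_on_subset) simp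
  then have "((\<lambda>y. L * config_dist k y x) \<longlongrightarrow> L * config_dist k x x) (at x within config_space k)"
    unfolding continuous_on_def using x by (rule bspec)
  then have "((\<lambda>y. L * config_dist k y x) \<longlongrightarrow> 0) (at x within config_space k)" by (simp add: config_dist_def)
  then have "((\<lambda>y. \<psi> y - \<psi> x) \<longlongrightarrow> 0) (at x within config_space k)"
    by (rule Lim_null_comparison[rotated]) (auto simp: eventually_at_filter intro!: always_eventually L x)
  then show "(\<psi> \<longlongrightarrow> \<psi> x) (at x within config_space k)" by (rule LIM_zero_cancel)
qed

text \<open>The Lipschitz regularization from below (Pasch--Hausdorff envelope). A bounded
  continuous function need not be uniformly continuous on this noncompact space, whereas the
  smoothing estimate needs a Lipschitz constant.\<close>

definition inf_convolution :: "nat \<Rightarrow> ((nat \<Rightarrow> 'a::euclidean_space) \<Rightarrow> real) \<Rightarrow> nat \<Rightarrow> (nat \<Rightarrow> 'a) \<Rightarrow> real" where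
  "inf_convolution k \<phi> m x = (INF y\<in>config_space k. \<phi> y + real m * config_dist k x y)"

context
  fixes k :: nat and \<phi> :: "(nat \<Rightarrow> 'a::euclidean_space) \<Rightarrow> real" and B :: real
  assumes cont: "continuous_on (config_space k) \<phi>"
    and bdd: "\<And>x. x \<in> config_space k \<Longrightarrow> \<bar>\<phi> x\<bar> \<le> B"
begin

lemma inf_convolution_bdd: "bdd_below ((\<lambda>y. \<phi> y + real m * config_dist k x y) ` config_space k)"
proof (rule bdd_belowI2)
  fix y :: "nat \<Rightarrow> 'a" assume y: "y \<in> config_space k"
  have "0 \<le> real m * config_dist k x y" using config_dist_nonneg[of k x y] by simp
  then show "- B \<le> \<phi> y + real m * config_dist k x y" using bdd[OF y] by linarith
qed

lemma config_space_nonempty: "config_space k \<noteq> ({} :: (nat \<Rightarrow> 'a) set)"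
  by (simp add: PiE_eq_empty_iff)

lemma inf_convolution_le: "x \<in> config_space k \<Longrightarrow> inf_convolution k \<phi> m x \<le> \<phi> x"
  unfolding inf_convolution_def
  using cINF_lower[OF inf_convolution_bdd, of x m x] by (simp add: config_dist_def)

lemma inf_convolution_ge: "- B \<le> inf_convolution k \<phi> m x"
  unfolding inf_convolution_def
proof (rule cINF_greatest[OF config_space_nonempty])
  fix y :: "nat \<Rightarrow> 'a" assume y: "y \<in> config_space k"
  have "0 \<le> real m * config_dist k x y" using config_dist_nonneg[of k x y] by simp
  then show "- B \<le> \<phi> y + real m * config_dist k x y" using bdd[OF y] by linarith
qed

lemma inf_convolution_lipschitz:
  "\<bar>inf_convolution k \<phi> m x - inf_convolution k \<phi> m x'\<bar> \<le> real m * config_dist k x x'"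
proof -
  have *: "inf_convolution k \<phi> m a - real m * config_dist k a b \<le> inf_convolution k \<phi> m b" for a b
    unfolding inf_convolution_def[of k \<phi> m b]
  proof (rule cINF_greatest[OF config_space_nonempty])
    fix y :: "nat \<Rightarrow> 'a" assume y: "y \<in> config_space k"
    have "inf_convolution k \<phi> m a \<le> \<phi> y + real m * config_dist k a y"
      unfolding inf_convolution_def by (rule cINF_lower[OF inf_convolution_bdd y])
    also have "\<dots> \<le> \<phi> y + real m * (config_dist k a b + config_dist k b y)"
      by (intro add_left_mono mult_left_mono config_dist_triangle) auto
    finally show "inf_convolution k \<phi> m a - real m * config_dist k a b \<le> \<phi> y + real m * config_dist k b y"
      by (simp add: algebra_simps)
  qed
  have "config_dist k x x' = config_dist k x' x" by (simp add: config_dist_def norm_minus_commute)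
  then show ?thesis using *[of x x'] *[of x' x] by (simp add: abs_le_iff)
qed

lemma inf_convolution_tendsto:
  assumes x: "x \<in> config_space k"
  shows "(\<lambda>m. inf_convolution k \<phi> m x) \<longlonglongrightarrow> \<phi> x"
proof (rule tendstoI)
  fix e :: real assume e: "e > 0"
  \<comment> \<open>Continuity is given for the product topology. It is translated to
    \<open>config_dist\<close> by a sequence of counterexamples, which converges in every
    coordinate, trivially in those from k on, where all configurations agree.\<close>
  have "\<exists>\<eta>>0. \<forall>y\<in>config_space k. config_dist k x y < \<eta> \<longrightarrow> \<bar>\<phi> y - \<phi> x\<bar> < e / 2"
  proof (rule ccontr)
    assume "\<not> ?thesis"
    then have "\<forall>j::nat. \<exists>y\<in>config_space k. config_dist k x y < 1 / Suc j \<and> \<not> \<bar>\<phi> y - \<phi> x\<bar> < e / 2"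
      by (metis of_nat_0_less_iff zero_less_Suc zero_less_divide_1_iff)
    then obtain Y where Y: "\<And>j. Y j \<in> config_space k" "\<And>j. config_dist k x (Y j) < 1 / Suc j" "\<And>j. \<not> \<bar>\<phi> (Y j) - \<phi> x\<bar> < e / 2"
      by metis
    have "(\<lambda>j. Y j i) \<longlonglongrightarrow> x i" for i
    proof (cases "i < k")
      case True
      have b: "norm (Y j i - x i) \<le> 1 / real (Suc j)" for j
      proof -
        have "norm (x i - Y j i) \<le> config_dist k x (Y j)"
          unfolding config_dist_def using True by (intro member_le_sum) auto
        then show ?thesis using Y(2)[of j] by (simp add: norm_minus_commute)
      qed
      have l: "(\<lambda>j. 1 / real (Suc j)) \<longlonglongrightarrow> 0" by real_asymp
      have "(\<lambda>j. Y j i - x i) \<longlonglongrightarrow> 0"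
        by (rule Lim_null_comparison[OF always_eventually[OF allI[OF b]] l])
      then show ?thesis by (rule LIM_zero_cancel)
    next
      case False
      then have "Y j i = x i" for j using Y(1)[of j] x by (auto simp: PiE_def extensional_def)
      then show ?thesis by simp
    qed
    then have "limitin (product_topology (\<lambda>_. euclidean) UNIV) Y x sequentially"
      unfolding limitin_componentwise by simp
    then have "Y \<longlonglongrightarrow> x" unfolding euclidean_product_topology by simp
    then have "(\<lambda>j. \<phi> (Y j)) \<longlonglongrightarrow> \<phi> x"
      by (rule continuous_on_tendsto_compose[OF cont]) (use Y x in auto)
    then have "\<forall>\<^sub>F j in sequentially. dist (\<phi> (Y j)) (\<phi> x) < e / 2" using e by (intro tendstoD) auto
    then show False using Y(3) by (auto simp: dist_real_def eventually_sequentially)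
  qed
  then obtain \<eta> where \<eta>: "\<eta> > 0" "\<And>y. y \<in> config_space k \<Longrightarrow> config_dist k x y < \<eta> \<Longrightarrow> \<bar>\<phi> y - \<phi> x\<bar> < e / 2" by blast
  \<comment> \<open>At distance at least \<eta> the penalty is at least 2 B, which outweighs the
    largest possible drop of \<phi>, so such points cannot undercut the value at x.\<close>
  obtain M :: nat where M: "2 * B / \<eta> < real M" using reals_Archimedean2 by blast
  have "dist (inf_convolution k \<phi> m x) (\<phi> x) < e" if m: "m \<ge> M" for m
  proof -
    have "\<phi> x - e / 2 \<le> inf_convolution k \<phi> m x" unfolding inf_convolution_def
    proof (rule cINF_greatest[OF config_space_nonempty])
      fix y :: "nat \<Rightarrow> 'a" assume y: "y \<in> config_space k"
      show "\<phi> x - e / 2 \<le> \<phi> y + real m * config_dist k x y"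
      proof (cases "config_dist k x y < \<eta>")
        case True
        then have "\<bar>\<phi> y - \<phi> x\<bar> < e / 2" using \<eta>(2)[OF y] by blast
        moreover have "0 \<le> real m * config_dist k x y" using config_dist_nonneg by (intro mult_nonneg_nonneg) auto
        ultimately show ?thesis by linarith
      next
        case False
        have "2 * B \<le> real M * \<eta>" using M \<eta>(1) by (simp add: field_simps)
        also have "\<dots> \<le> real m * config_dist k x y" using False m \<eta>(1) by (intro mult_mono) auto
        finally show ?thesis using bdd[OF x] bdd[OF y] e by linarith
      qed
    qed
    then show ?thesis using inf_convolution_le[OF x, of m] e by (simp add: dist_real_def)
  qed
  then show "\<forall>\<^sub>F m in sequentially. dist (inf_convolution k \<phi> m x) (\<phi> x) < e"
    unfolding eventually_sequentially by blast
qed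

end

section \<open>Gaussian smoothing of laws of configurations\<close>

definition gauss_prod :: "nat \<Rightarrow> real \<Rightarrow> (nat \<Rightarrow> 'a::euclidean_space) \<Rightarrow> (nat \<Rightarrow> 'a) \<Rightarrow> real" where
  "gauss_prod k t y z = (\<Prod>i<k. gauss t (y i - z i))"

lemma gauss_prod_nonneg [simp]: "0 \<le> gauss_prod k t y z"
  unfolding gauss_prod_def by (intro prod_nonneg) auto

lemma gauss_prod_le_1: "t \<ge> 0 \<Longrightarrow> gauss_prod k t y z \<le> 1"
  unfolding gauss_prod_def by (intro prod_le_1) (auto simp: gauss_le_1)

lemma measurable_gauss_prod [measurable]:
  assumes f: "f \<in> measurable M (lebesgue_prod k)" and g: "g \<in> measurable M (lebesgue_prod k)"
  shows "(\<lambda>w. gauss_prod k t (f w) (g w)) \<in> borel_measurable M"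
proof -
  have "(\<lambda>w. f w i) \<in> borel_measurable M" "(\<lambda>w. g w i) \<in> borel_measurable M" if "i < k" for i
    using measurable_compose[OF f measurable_component_singleton[of i]]
      measurable_compose[OF g measurable_component_singleton[of i]] that by auto
  then show ?thesis unfolding gauss_prod_def
    by (intro borel_measurable_prod measurable_compose[OF borel_measurable_diff measurable_gauss]) auto
qed

lemma sigma_finite_lebesgue_prod: "sigma_finite_measure (lebesgue_prod k :: (nat \<Rightarrow> 'a::euclidean_space) measure)"
proof -
  interpret finite_product_sigma_finite "\<lambda>_. lborel :: 'a measure" "{..<k}" by unfold_locales auto
  show ?thesis ..
qed

lemma nn_gauss_prod:
  fixes y :: "nat \<Rightarrow> 'a::euclidean_space"
  assumes t: "t > 0"
  shows "(\<integral>\<^sup>+z. ennreal (gauss_prod k t y z) \<partial>lebesgue_prod k) = ennreal (gauss_mass TYPE('a) t ^ k)"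
proof -
  have "(\<integral>\<^sup>+z. ennreal (gauss_prod k t y z) \<partial>lebesgue_prod k) = (\<integral>\<^sup>+z. (\<Prod>i<k. ennreal (gauss t (z i - y i))) \<partial>lebesgue_prod k)"
    unfolding gauss_prod_def by (simp add: prod_ennreal gauss_minus[of t "_ :: 'a"])
  also have "\<dots> = (\<Prod>i<k. \<integral>\<^sup>+x. ennreal (gauss t (x - y i)) \<partial>lborel)"
    by (rule lborel_product.product_nn_integral_prod) auto
  also have "\<dots> = ennreal (gauss_mass TYPE('a) t ^ k)"
    using t gauss_mass_pos[OF t, where 'a='a] by (simp add: gauss_shift ennreal_power)
  finally show ?thesis .
qed

lemma gauss_prod_integrable:
  fixes y :: "nat \<Rightarrow> 'a::euclidean_space"
  assumes t: "t > 0" and y: "y \<in> config_space k"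
  shows "integrable (lebesgue_prod k) (gauss_prod k t y)"
    "(\<integral>z. gauss_prod k t y z \<partial>lebesgue_prod k) = gauss_mass TYPE('a) t ^ k"
proof -
  have "y \<in> space (lebesgue_prod k)" using y by (simp add: space_PiM)
  then have [measurable]: "(\<lambda>z. gauss_prod k t y z) \<in> borel_measurable (lebesgue_prod k)"
    by measurable
  have "has_bochner_integral (lebesgue_prod k) (gauss_prod k t y) (gauss_mass TYPE('a) t ^ k)"
    using gauss_mass_pos[OF t, where 'a='a] nn_gauss_prod[OF t, of k y]
    by (intro has_bochner_integral_nn_integral) (auto intro!: zero_le_power less_imp_le)
  then show "integrable (lebesgue_prod k) (gauss_prod k t y)"
    "(\<integral>z. gauss_prod k t y z \<partial>lebesgue_prod k) = gauss_mass TYPE('a) t ^ k"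
    by (auto simp: has_bochner_integral_iff)
qed

definition gauss_moment :: "'a::euclidean_space itself \<Rightarrow> real \<Rightarrow> real" where
  "gauss_moment _ t = (\<integral>x. norm (x::'a) * gauss t x \<partial>lborel)"

text \<open>Substitution x -> m x: the mean displacement under the normalized Gaussian of parameter
  m^2 is 1/m times that of parameter 1, so it can be made arbitrarily small.\<close>

lemma gauss_moment_scaling:
  assumes m: "m > 0"
  shows "gauss_moment TYPE('a::euclidean_space) (m\<^sup>2) / gauss_mass TYPE('a) (m\<^sup>2)
    = (gauss_moment TYPE('a) 1 / gauss_mass TYPE('a) 1) / m"
proof -
  have sc: "(\<integral>x. f (m *\<^sub>R x) \<partial>lborel) * m ^ DIM('a) = (\<integral>x. f x \<partial>lborel)"
    if [measurable]: "f \<in> borel_measurable borel" for f :: "'a \<Rightarrow> real"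
  proof -
    have "(\<integral>x. f x \<partial>lborel) = (\<integral>x. f x \<partial>density (distr lborel borel (\<lambda>x. 0 + m *\<^sub>R x)) (\<lambda>_. ennreal (\<bar>m\<bar> ^ DIM('a))))"
      using m by (subst lborel_affine[of m 0]) (auto simp: ennreal_power)
    also have "\<dots> = (\<integral>x. f (m *\<^sub>R x) \<partial>lborel) * m ^ DIM('a)"
      using m by (subst integral_density) (auto simp: integral_distr)
    finally show ?thesis ..
  qed
  have g: "gauss 1 (m *\<^sub>R x) = gauss (m\<^sup>2) x" for x :: 'a
    using m by (simp add: gauss_def power_mult_distrib)
  have 1: "gauss_mass TYPE('a) (m\<^sup>2) * m ^ DIM('a) = gauss_mass TYPE('a) 1"
    using sc[of "gauss 1"] by (simp add: g gauss_mass_def)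
  have 2: "m * gauss_moment TYPE('a) (m\<^sup>2) * m ^ DIM('a) = gauss_moment TYPE('a) 1"
    using sc[of "\<lambda>x. norm x * gauss 1 x"] m by (simp add: g gauss_moment_def mult.assoc)
  show ?thesis unfolding 1[symmetric] 2[symmetric] using m by (simp add: field_simps)
qed

lemma gauss_prod_moment:
  fixes y :: "nat \<Rightarrow> 'a::euclidean_space"
  assumes t: "t > 0" and i: "i < k"
  shows "integrable (lebesgue_prod k) (\<lambda>z. norm (z i - y i) * gauss_prod k t y z)"
    "(\<integral>z. norm (z i - y i) * gauss_prod k t y z \<partial>lebesgue_prod k) = gauss_moment TYPE('a) t * gauss_mass TYPE('a) t ^ (k - 1)"
proof -
  define f where "f j x = (if j = i then norm (x - y j) * gauss t (x - y j) else gauss t (x - y j))" for j x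
  have fi: "integrable lborel (f j)" for j
    using gauss_shift(1)[OF t, of "y j"] lborel_shift(2)[OF _ integrable_norm_gauss[OF t], of "- y j"]
    by (cases "j = i") (auto simp: f_def[abs_def])
  have fe: "integral\<^sup>L lborel (f j) = (if j = i then gauss_moment TYPE('a) t else gauss_mass TYPE('a) t)" for j
    using gauss_shift(2)[OF t, of "y j"] lborel_shift(1)[of "\<lambda>x. norm x * gauss t x" "- y j"]
    by (cases "j = i") (auto simp: f_def[abs_def] gauss_moment_def)
  have eq: "(\<Prod>j<k. f j (z j)) = norm (z i - y i) * gauss_prod k t y z" for z
  proof -
    have "(\<Prod>j<k. f j (z j)) = f i (z i) * (\<Prod>j\<in>{..<k}-{i}. f j (z j))" using i by (intro prod.remove) auto
    also have "(\<Prod>j\<in>{..<k}-{i}. f j (z j)) = (\<Prod>j\<in>{..<k}-{i}. gauss t (y j - z j))"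
      by (intro prod.cong) (auto simp: f_def gauss_minus)
    also have "f i (z i) * \<dots> = norm (z i - y i) * (gauss t (y i - z i) * (\<Prod>j\<in>{..<k}-{i}. gauss t (y j - z j)))"
      by (simp add: f_def gauss_minus)
    also have "gauss t (y i - z i) * (\<Prod>j\<in>{..<k}-{i}. gauss t (y j - z j)) = gauss_prod k t y z"
      unfolding gauss_prod_def using i by (intro prod.remove[symmetric]) auto
    finally show ?thesis .
  qed
  show "integrable (lebesgue_prod k) (\<lambda>z. norm (z i - y i) * gauss_prod k t y z)"
    unfolding eq[symmetric] by (rule lborel_product.product_integrable_prod) (use fi in auto)
  have "(\<integral>z. norm (z i - y i) * gauss_prod k t y z \<partial>lebesgue_prod k) = (\<Prod>j<k. integral\<^sup>L lborel (f j))"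
    unfolding eq[symmetric] by (rule lborel_product.product_integral_prod) (use fi in auto)
  also have "\<dots> = (\<Prod>j<k. if j = i then gauss_moment TYPE('a) t else gauss_mass TYPE('a) t)" unfolding fe ..
  also have "\<dots> = gauss_moment TYPE('a) t * (\<Prod>j\<in>{..<k}-{i}. if j = i then gauss_moment TYPE('a) t else gauss_mass TYPE('a) t)"
    using i by (subst prod.remove[of _ i]) auto
  also have "(\<Prod>j\<in>{..<k}-{i}. if j = i then gauss_moment TYPE('a) t else gauss_mass TYPE('a) t) = gauss_mass TYPE('a) t ^ (k - 1)"
    using i by (subst prod.cong[OF refl, of _ _ "\<lambda>_. gauss_mass TYPE('a) t"]) auto
  finally show "(\<integral>z. norm (z i - y i) * gauss_prod k t y z \<partial>lebesgue_prod k) = gauss_moment TYPE('a) t * gauss_mass TYPE('a) t ^ (k - 1)" .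
qed

text \<open>The Lebesgue density of P convolved with an unnormalized product Gaussian. Its total
  mass is the same for every probability law P, and its value at z is a Gaussian test integral, for
  which convergence is known.\<close>

definition smoothed_density :: "nat \<Rightarrow> (nat \<Rightarrow> 'a::euclidean_space) measure \<Rightarrow> real \<Rightarrow> (nat \<Rightarrow> 'a) \<Rightarrow> real" where
  "smoothed_density k P t z = (\<integral>y. gauss_prod k t y z \<partial>P)"

locale config_measure =
  fixes k :: nat and P :: "(nat \<Rightarrow> 'a::euclidean_space) measure"
  assumes prob: "prob_space P" and sets_P: "sets P = sets (lebesgue_prod k)"
begin

sublocale prob_space P by (rule prob)

lemmas sets_P_cong [measurable_cong] = sets_P

lemma space_P: "space P = config_space k"
  using sets_eq_imp_space_eq[OF sets_P] by (simp add: space_lebesgue_prod)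

lemma measurable_smoothed_density [measurable]:
  "smoothed_density k P t \<in> borel_measurable (lebesgue_prod k)"
  unfolding smoothed_density_def by measurable

lemma gauss_prod_integrable_P:
  assumes "t > 0" "z \<in> config_space k"
  shows "integrable P (\<lambda>y. gauss_prod k t y z)"
proof (rule integrable_const_bound[where B=1])
  show "AE y in P. norm (gauss_prod k t y z) \<le> 1" using gauss_prod_le_1[of t] assms by auto
  have "z \<in> space (lebesgue_prod k)" using assms by (simp add: space_PiM)
  then show "(\<lambda>y. gauss_prod k t y z) \<in> borel_measurable P" by measurable
qed

lemma smoothed_density_nonneg: "0 \<le> smoothed_density k P t z"
  unfolding smoothed_density_def by (intro Bochner_Integration.integral_nonneg) auto

lemma nn_smoothed_density:
  assumes t: "t > 0"
  shows "(\<integral>\<^sup>+z. ennreal (smoothed_density k P t z) \<partial>lebesgue_prod k) = ennreal (gauss_mass TYPE('a) t ^ k)"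
proof -
  interpret L: sigma_finite_measure "lebesgue_prod k :: (nat \<Rightarrow> 'a) measure" by (rule sigma_finite_lebesgue_prod)
  interpret pair_sigma_finite P "lebesgue_prod k :: (nat \<Rightarrow> 'a) measure" ..
  have "(\<integral>\<^sup>+z. ennreal (smoothed_density k P t z) \<partial>lebesgue_prod k)
    = (\<integral>\<^sup>+z. \<integral>\<^sup>+y. ennreal (gauss_prod k t y z) \<partial>P \<partial>lebesgue_prod k)"
    unfolding smoothed_density_def
    by (intro nn_integral_cong nn_integral_eq_integral[symmetric] gauss_prod_integrable_P t) (auto simp: space_PiM)
  also have "\<dots> = (\<integral>\<^sup>+y. \<integral>\<^sup>+z. ennreal (gauss_prod k t y z) \<partial>lebesgue_prod k \<partial>P)"
    by (rule Fubini') measurable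
  also have "\<dots> = ennreal (gauss_mass TYPE('a) t ^ k)"
    using t by (simp add: nn_gauss_prod emeasure_space_1)
  finally show ?thesis .
qed

lemma integrable_smoothed_density:
  assumes t: "t > 0" shows "integrable (lebesgue_prod k) (smoothed_density k P t)"
  using nn_smoothed_density[OF t] by (intro integrableI_bounded) (auto simp: smoothed_density_nonneg)

lemma smoothed_density_fubini:
  fixes \<phi> :: "(nat \<Rightarrow> 'a) \<Rightarrow> real"
  assumes t: "t > 0" and [measurable]: "\<phi> \<in> borel_measurable (lebesgue_prod k)"
    and bdd: "\<And>x. x \<in> config_space k \<Longrightarrow> \<bar>\<phi> x\<bar> \<le> B"
  shows "integrable P (\<lambda>y. \<integral>z. \<phi> z * gauss_prod k t y z \<partial>lebesgue_prod k)"
    "(\<integral>y. (\<integral>z. \<phi> z * gauss_prod k t y z \<partial>lebesgue_prod k) \<partial>P) = (\<integral>z. \<phi> z * smoothed_density k P t z \<partial>lebesgue_prod k)"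
proof -
  interpret L: sigma_finite_measure "lebesgue_prod k :: (nat \<Rightarrow> 'a) measure" by (rule sigma_finite_lebesgue_prod)
  interpret pair_sigma_finite P "lebesgue_prod k :: (nat \<Rightarrow> 'a) measure" ..
  let ?PL = "P \<Otimes>\<^sub>M (lebesgue_prod k :: (nat \<Rightarrow> 'a) measure)"
  have "(\<integral>\<^sup>+w. ennreal (gauss_prod k t (fst w) (snd w)) \<partial>?PL) = (\<integral>\<^sup>+y. \<integral>\<^sup>+z. ennreal (gauss_prod k t y z) \<partial>lebesgue_prod k \<partial>P)"
    by (subst L.nn_integral_fst[symmetric]) auto
  also have "\<dots> = ennreal (gauss_mass TYPE('a) t ^ k)" using t by (simp add: nn_gauss_prod emeasure_space_1)
  finally have "integrable ?PL (\<lambda>w. gauss_prod k t (fst w) (snd w))"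
    by (intro integrableI_bounded) auto
  then have iB: "integrable ?PL (\<lambda>w. B * gauss_prod k t (fst w) (snd w))" by simp
  have i: "integrable ?PL (\<lambda>(y, z). \<phi> z * gauss_prod k t y z)"
  proof (rule Bochner_Integration.integrable_bound[OF iB])
    show "AE w in ?PL. norm (case w of (y, z) \<Rightarrow> \<phi> z * gauss_prod k t y z) \<le> norm (B * gauss_prod k t (fst w) (snd w))"
    proof (rule AE_I2)
      fix w assume "w \<in> space ?PL"
      then have "snd w \<in> config_space k" by (auto simp: space_pair_measure space_PiM)
      then have "\<bar>\<phi> (snd w)\<bar> \<le> \<bar>B\<bar>" using bdd[of "snd w"] by linarith
      then show "norm (case w of (y, z) \<Rightarrow> \<phi> z * gauss_prod k t y z) \<le> norm (B * gauss_prod k t (fst w) (snd w))"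
        by (auto simp: case_prod_unfold abs_mult intro!: mult_right_mono)
    qed
  qed measurable
  show "integrable P (\<lambda>y. \<integral>z. \<phi> z * gauss_prod k t y z \<partial>lebesgue_prod k)"
    using integrable_fst[OF i] by simp
  have "(\<integral>y. (\<integral>z. \<phi> z * gauss_prod k t y z \<partial>lebesgue_prod k) \<partial>P) = (\<integral>z. (\<integral>y. \<phi> z * gauss_prod k t y z \<partial>P) \<partial>lebesgue_prod k)"
    by (rule Fubini_integral[OF i, symmetric])
  then show "(\<integral>y. (\<integral>z. \<phi> z * gauss_prod k t y z \<partial>lebesgue_prod k) \<partial>P) = (\<integral>z. \<phi> z * smoothed_density k P t z \<partial>lebesgue_prod k)"
    by (simp add: smoothed_density_def)
qed

lemma bounded_integrable_P:
  fixes \<phi> :: "(nat \<Rightarrow> 'a) \<Rightarrow> real"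
  assumes "\<phi> \<in> borel_measurable (lebesgue_prod k)" "\<And>x. x \<in> config_space k \<Longrightarrow> \<bar>\<phi> x\<bar> \<le> B"
  shows "integrable P \<phi>"
  using assms by (intro integrable_const_bound[where B=B]) (auto simp: space_P)

text \<open>Normalized Gaussian smoothing displaces a configuration by k times the mean displacement
  of one coordinate, and \<phi> changes by at most L times that. The bound does not involve P, so it
  holds along the whole sequence.\<close>

lemma smoothing_error:
  fixes \<phi> :: "(nat \<Rightarrow> 'a) \<Rightarrow> real"
  assumes t: "t > 0" and meas[measurable]: "\<phi> \<in> borel_measurable (lebesgue_prod k)"
    and bdd: "\<And>x. x \<in> config_space k \<Longrightarrow> \<bar>\<phi> x\<bar> \<le> B"
    and L: "0 \<le> L" "\<And>x y. x \<in> config_space k \<Longrightarrow> y \<in> config_space k \<Longrightarrow> \<bar>\<phi> x - \<phi> y\<bar> \<le> L * config_dist k x y"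
  shows "\<bar>(\<integral>z. \<phi> z * smoothed_density k P t z \<partial>lebesgue_prod k) / gauss_mass TYPE('a) t ^ k - (\<integral>y. \<phi> y \<partial>P)\<bar>
    \<le> L * k * (gauss_moment TYPE('a) t / gauss_mass TYPE('a) t)"
proof -
  define G where "G = gauss_mass TYPE('a) t"
  have G: "G > 0" unfolding G_def by (rule gauss_mass_pos[OF t])
  define M where "M = gauss_moment TYPE('a) t"
  define E where "E = L * k * (M * G ^ (k - 1))"
  have pt: "\<bar>(\<integral>z. \<phi> z * gauss_prod k t y z \<partial>lebesgue_prod k) - G ^ k * \<phi> y\<bar> \<le> E" if y: "y \<in> config_space k" for y
  proof -
    have "y \<in> space (lebesgue_prod k)" using y by (simp add: space_PiM)
    then have [measurable]: "(\<lambda>z. gauss_prod k t y z) \<in> borel_measurable (lebesgue_prod k)" by measurable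
    note gi = gauss_prod_integrable[OF t y, folded G_def]
    have i1: "integrable (lebesgue_prod k) (\<lambda>z. \<phi> z * gauss_prod k t y z)"
    proof (rule Bochner_Integration.integrable_bound)
      show "integrable (lebesgue_prod k) (\<lambda>z. B * gauss_prod k t y z)" using gi(1) by simp
      show "AE z in lebesgue_prod k. norm (\<phi> z * gauss_prod k t y z) \<le> norm (B * gauss_prod k t y z)"
      proof (rule AE_I2)
        fix z :: "nat \<Rightarrow> 'a" assume "z \<in> space (lebesgue_prod k)"
        then have "\<bar>\<phi> z\<bar> \<le> \<bar>B\<bar>" using bdd[of z] by (auto simp: space_PiM)
        then show "norm (\<phi> z * gauss_prod k t y z) \<le> norm (B * gauss_prod k t y z)"
          by (auto simp: abs_mult intro!: mult_right_mono)
      qed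
    qed measurable
    have i2: "integrable (lebesgue_prod k) (\<lambda>z. L * (\<Sum>i<k. norm (z i - y i) * gauss_prod k t y z))"
      by (intro integrable_mult_right Bochner_Integration.integrable_sum gauss_prod_moment(1)[OF t]) auto
    have "(\<integral>z. \<phi> z * gauss_prod k t y z \<partial>lebesgue_prod k) - G ^ k * \<phi> y
      = (\<integral>z. \<phi> z * gauss_prod k t y z - \<phi> y * gauss_prod k t y z \<partial>lebesgue_prod k)"
      using i1 gi by (simp add: mult.commute)
    also have "\<bar>\<dots>\<bar> \<le> (\<integral>z. \<bar>\<phi> z * gauss_prod k t y z - \<phi> y * gauss_prod k t y z\<bar> \<partial>lebesgue_prod k)"
      by (rule integral_abs_bound)
    also have "\<dots> \<le> (\<integral>z. L * (\<Sum>i<k. norm (z i - y i) * gauss_prod k t y z) \<partial>lebesgue_prod k)"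
    proof (rule integral_mono)
      show "integrable (lebesgue_prod k) (\<lambda>z. \<bar>\<phi> z * gauss_prod k t y z - \<phi> y * gauss_prod k t y z\<bar>)"
        using i1 gi(1) by auto
      fix z :: "nat \<Rightarrow> 'a" assume "z \<in> space (lebesgue_prod k)"
      then have z: "z \<in> config_space k" by (simp add: space_PiM)
      have "\<bar>\<phi> z * gauss_prod k t y z - \<phi> y * gauss_prod k t y z\<bar> = \<bar>\<phi> z - \<phi> y\<bar> * gauss_prod k t y z"
        by (simp add: abs_mult left_diff_distrib[symmetric])
      also have "\<dots> \<le> (L * config_dist k z y) * gauss_prod k t y z"
        by (intro mult_right_mono L(2) z y) auto
      finally show "\<bar>\<phi> z * gauss_prod k t y z - \<phi> y * gauss_prod k t y z\<bar> \<le> L * (\<Sum>i<k. norm (z i - y i) * gauss_prod k t y z)"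
        by (simp add: config_dist_def sum_distrib_right mult.assoc)
    qed (rule i2)
    also have "\<dots> = L * (\<Sum>i<k. (\<integral>z. norm (z i - y i) * gauss_prod k t y z \<partial>lebesgue_prod k))"
      by (subst integral_mult_right_zero, subst Bochner_Integration.integral_sum) (auto intro!: gauss_prod_moment(1)[OF t])
    also have "\<dots> = E" unfolding E_def using t by (simp add: gauss_prod_moment(2) M_def G_def)
    finally show ?thesis .
  qed
  have ik: "integrable P \<phi>" by (rule bounded_integrable_P[OF meas bdd])
  have "(\<integral>z. \<phi> z * smoothed_density k P t z \<partial>lebesgue_prod k) - G ^ k * (\<integral>y. \<phi> y \<partial>P)
    = (\<integral>y. (\<integral>z. \<phi> z * gauss_prod k t y z \<partial>lebesgue_prod k) - G ^ k * \<phi> y \<partial>P)"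
    using smoothed_density_fubini[OF t meas bdd] ik by simp
  also have "\<bar>\<dots>\<bar> \<le> (\<integral>y. \<bar>(\<integral>z. \<phi> z * gauss_prod k t y z \<partial>lebesgue_prod k) - G ^ k * \<phi> y\<bar> \<partial>P)"
    by (rule integral_abs_bound)
  also have "\<dots> \<le> (\<integral>y. E \<partial>P)"
    using smoothed_density_fubini(1)[OF t meas bdd] ik pt by (intro integral_mono) (auto simp: space_P)
  also have "\<dots> = E" by (simp add: prob_space)
  finally have "\<bar>(\<integral>z. \<phi> z * smoothed_density k P t z \<partial>lebesgue_prod k) - G ^ k * (\<integral>y. \<phi> y \<partial>P)\<bar> / G ^ k \<le> E / G ^ k"
    using G by (intro divide_right_mono) auto
  also have "E / G ^ k = L * k * (M / G)"
    \<comment> \<open>For k = 0 the truncated exponent k - 1 is harmless, since both sides carry the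
      factor k.\<close>
    using G by (cases k) (auto simp: E_def field_simps)
  also have "\<bar>(\<integral>z. \<phi> z * smoothed_density k P t z \<partial>lebesgue_prod k) - G ^ k * (\<integral>y. \<phi> y \<partial>P)\<bar> / G ^ k
    = \<bar>(\<integral>z. \<phi> z * smoothed_density k P t z \<partial>lebesgue_prod k) / G ^ k - (\<integral>y. \<phi> y \<partial>P)\<bar>"
  proof -
    have gk: "G ^ k > 0" using G by simp
    have "\<bar>a - G ^ k * b\<bar> / G ^ k = \<bar>a / G ^ k - b\<bar>" for a b
    proof -
      have "\<bar>a - G ^ k * b\<bar> / G ^ k = \<bar>(a - G ^ k * b) / G ^ k\<bar>" using gk by (simp add: abs_divide)
      also have "(a - G ^ k * b) / G ^ k = a / G ^ k - b" using G by (simp add: diff_divide_distrib)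
      finally show ?thesis .
    qed
    then show ?thesis .
  qed
  finally show ?thesis by (simp add: G_def M_def)
qed

end

context
  fixes k :: nat and P :: "nat \<Rightarrow> (nat \<Rightarrow> 'a::euclidean_space) measure" and P' :: "(nat \<Rightarrow> 'a) measure"
  assumes P: "\<And>n. config_measure k (P n)" and P': "config_measure k P'"
    and conv: "\<And>t z. t > 0 \<Longrightarrow> (\<lambda>n. \<integral>y. gauss_prod k t y z \<partial>P n) \<longlonglongrightarrow> (\<integral>y. gauss_prod k t y z \<partial>P')"
begin

lemma smoothed_weak_convergence:
  fixes \<phi> :: "(nat \<Rightarrow> 'a) \<Rightarrow> real"
  assumes t: "t > 0" and meas[measurable]: "\<phi> \<in> borel_measurable (lebesgue_prod k)"
    and bdd: "\<And>x. x \<in> config_space k \<Longrightarrow> \<bar>\<phi> x\<bar> \<le> B"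
  shows "(\<lambda>n. \<integral>z. \<phi> z * smoothed_density k (P n) t z \<partial>lebesgue_prod k)
    \<longlonglongrightarrow> (\<integral>z. \<phi> z * smoothed_density k P' t z \<partial>lebesgue_prod k)"
proof -
  define F where "F n = smoothed_density k (P n) t" for n
  define F' where "F' = smoothed_density k P' t"
  note m[measurable] = config_measure.measurable_smoothed_density[OF P, where t=t, folded F_def]
    config_measure.measurable_smoothed_density[OF P', where t=t, folded F'_def]
  note i = config_measure.integrable_smoothed_density[OF P t, folded F_def]
    config_measure.integrable_smoothed_density[OF P' t, folded F'_def]
  have l1: "(\<lambda>n. \<integral>\<^sup>+z. ennreal (norm (F n z - F' z)) \<partial>lebesgue_prod k) \<longlonglongrightarrow> 0"
  proof (rule Scheffe_lemma2)
    show "AE z in lebesgue_prod k. (\<lambda>n. F n z) \<longlonglongrightarrow> F' z"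
      using conv[OF t] unfolding F_def F'_def smoothed_density_def
      by simp
    \<comment> \<open>Both sides equal \<open>gauss_mass TYPE('a) t ^ k\<close>, so no mass is lost
      in the limit.\<close>
    show "(\<integral>\<^sup>+z. ennreal (norm (F n z)) \<partial>lebesgue_prod k) \<le> (\<integral>\<^sup>+z. ennreal (norm (F' z)) \<partial>lebesgue_prod k)" for n
      using config_measure.nn_smoothed_density[OF P t] config_measure.nn_smoothed_density[OF P' t]
      by (simp add: F_def F'_def config_measure.smoothed_density_nonneg[OF P] config_measure.smoothed_density_nonneg[OF P'])
  qed (use i in auto)
  have nb: "ennreal (\<integral>z. norm (F n z - F' z) \<partial>lebesgue_prod k) = (\<integral>\<^sup>+z. ennreal (norm (F n z - F' z)) \<partial>lebesgue_prod k)" for n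
    using i by (intro nn_integral_eq_integral[symmetric]) auto
  have l2: "(\<lambda>n. \<integral>z. norm (F n z - F' z) \<partial>lebesgue_prod k) \<longlonglongrightarrow> 0"
    using l1 unfolding nb[symmetric] by (subst (asm) ennreal_tendsto_0_iff) (auto intro!: Bochner_Integration.integral_nonneg)
  have i\<phi>: "integrable (lebesgue_prod k) (\<lambda>z. \<phi> z * f z)" if "integrable (lebesgue_prod k) f" for f
  proof (rule Bochner_Integration.integrable_bound)
    show "integrable (lebesgue_prod k) (\<lambda>z. B * f z)" using that by simp
    show "AE z in lebesgue_prod k. norm (\<phi> z * f z) \<le> norm (B * f z)"
    proof (rule AE_I2)
      fix z :: "nat \<Rightarrow> 'a" assume "z \<in> space (lebesgue_prod k)"
      then have "\<bar>\<phi> z\<bar> \<le> \<bar>B\<bar>" using bdd[of z] by (auto simp: space_PiM)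
      then show "norm (\<phi> z * f z) \<le> norm (B * f z)" by (auto simp: abs_mult intro!: mult_right_mono)
    qed
    show "(\<lambda>z. \<phi> z * f z) \<in> borel_measurable (lebesgue_prod k)" using that by measurable
  qed
  have "(\<lambda>n. (\<integral>z. \<phi> z * F n z \<partial>lebesgue_prod k) - (\<integral>z. \<phi> z * F' z \<partial>lebesgue_prod k)) \<longlonglongrightarrow> 0"
  proof (rule Lim_null_comparison[OF always_eventually])
    show "(\<lambda>n. B * (\<integral>z. norm (F n z - F' z) \<partial>lebesgue_prod k)) \<longlonglongrightarrow> 0"
      using tendsto_mult_right_zero[OF l2] .
    show "\<forall>n. norm ((\<integral>z. \<phi> z * F n z \<partial>lebesgue_prod k) - (\<integral>z. \<phi> z * F' z \<partial>lebesgue_prod k)) \<le> B * (\<integral>z. norm (F n z - F' z) \<partial>lebesgue_prod k)"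
    proof
      fix n
      have "(\<integral>z. \<phi> z * F n z \<partial>lebesgue_prod k) - (\<integral>z. \<phi> z * F' z \<partial>lebesgue_prod k) = (\<integral>z. \<phi> z * F n z - \<phi> z * F' z \<partial>lebesgue_prod k)"
        using i\<phi>[OF i(1)] i\<phi>[OF i(2)] by simp
      also have "norm \<dots> \<le> (\<integral>z. norm (\<phi> z * F n z - \<phi> z * F' z) \<partial>lebesgue_prod k)" by (rule integral_norm_bound)
      also have "\<dots> \<le> (\<integral>z. B * norm (F n z - F' z) \<partial>lebesgue_prod k)"
      proof (rule integral_mono)
        fix z :: "nat \<Rightarrow> 'a" assume "z \<in> space (lebesgue_prod k)"
        then have "\<bar>\<phi> z\<bar> \<le> B" using bdd[of z] by (auto simp: space_PiM)
        then show "norm (\<phi> z * F n z - \<phi> z * F' z) \<le> B * norm (F n z - F' z)"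
          by (auto simp: abs_mult right_diff_distrib[symmetric] intro!: mult_right_mono)
      qed (use i\<phi>[OF i(1)] i\<phi>[OF i(2)] i in auto)
      finally show "norm ((\<integral>z. \<phi> z * F n z \<partial>lebesgue_prod k) - (\<integral>z. \<phi> z * F' z \<partial>lebesgue_prod k)) \<le> B * (\<integral>z. norm (F n z - F' z) \<partial>lebesgue_prod k)"
        by simp
    qed
  qed
  then show ?thesis unfolding F_def F'_def by (rule LIM_zero_cancel)
qed

lemma lipschitz_weak_convergence:
  fixes \<phi> :: "(nat \<Rightarrow> 'a) \<Rightarrow> real"
  assumes meas: "\<phi> \<in> borel_measurable (lebesgue_prod k)"
    and bdd: "\<And>x. x \<in> config_space k \<Longrightarrow> \<bar>\<phi> x\<bar> \<le> B"
    and L: "0 \<le> L" "\<And>x y. x \<in> config_space k \<Longrightarrow> y \<in> config_space k \<Longrightarrow> \<bar>\<phi> x - \<phi> y\<bar> \<le> L * config_dist k x y"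
  shows "(\<lambda>n. \<integral>y. \<phi> y \<partial>P n) \<longlonglongrightarrow> (\<integral>y. \<phi> y \<partial>P')"
proof (rule tendstoI)
  fix e :: real assume e: "e > 0"
  define c where "c = L * k * (gauss_moment TYPE('a) 1 / gauss_mass TYPE('a) 1)"
  \<comment> \<open>A Gaussian of width of order 1/m has smoothing error at most c / m, so this m
    brings it below e / 3 for all laws at once; the last third is left to the convergence of the
    smoothed integrals.\<close>
  obtain m :: nat where m: "3 * \<bar>c\<bar> / e < real m" using reals_Archimedean2 by blast
  have m0: "real m > 0" by (rule le_less_trans[OF _ m]) (use e in auto)
  have cm: "c / m < e / 3"
  proof -
    have "c \<le> \<bar>c\<bar>" by simp
    also have "3 * \<bar>c\<bar> < real m * e" using m e by (simp add: field_simps)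
    then have "\<bar>c\<bar> < real m * e / 3" by simp
    finally show ?thesis using m0 by (simp add: field_simps)
  qed
  define t where "t = (real m)\<^sup>2"
  have t: "t > 0" using m0 by (simp add: t_def)
  define G where "G = gauss_mass TYPE('a) t ^ k"
  have G: "G > 0" unfolding G_def using gauss_mass_pos[OF t, where 'a='a] by simp
  define S where "S R = (\<integral>z. \<phi> z * smoothed_density k R t z \<partial>lebesgue_prod k) / G" for R
  have err: "\<bar>S R - (\<integral>y. \<phi> y \<partial>R)\<bar> < e / 3" if "config_measure k R" for R
  proof -
    have "\<bar>S R - (\<integral>y. \<phi> y \<partial>R)\<bar> \<le> L * k * (gauss_moment TYPE('a) t / gauss_mass TYPE('a) t)"
      unfolding S_def G_def by (rule config_measure.smoothing_error[OF that t meas bdd L])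
    also have "\<dots> = c / m" unfolding t_def gauss_moment_scaling[OF m0] c_def by simp
    finally show ?thesis using cm by linarith
  qed
  have "(\<lambda>n. S (P n)) \<longlonglongrightarrow> S P'" unfolding S_def
    by (intro tendsto_divide smoothed_weak_convergence[OF t meas bdd] tendsto_const) (use G in auto)
  then have "\<forall>\<^sub>F n in sequentially. dist (S (P n)) (S P') < e / 3" using e by (intro tendstoD) auto
  then show "\<forall>\<^sub>F n in sequentially. dist (\<integral>y. \<phi> y \<partial>P n) (\<integral>y. \<phi> y \<partial>P') < e"
  proof eventually_elim
    case (elim n)
    then show ?case using err[OF P[of n]] err[OF P'] unfolding dist_real_def by linarith
  qed
qed

text \<open>One-sided, because the regularizations lie below \<phi>. One of them is fixed by
  dominated convergence under the limit law and then followed along the sequence; the opposite bound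
  comes from - \<phi>.\<close>

lemma weak_convergence_lower:
  fixes \<phi> :: "(nat \<Rightarrow> 'a) \<Rightarrow> real"
  assumes cont: "continuous_on (config_space k) \<phi>"
    and bdd: "\<And>x. x \<in> config_space k \<Longrightarrow> \<bar>\<phi> x\<bar> \<le> B" and e: "e > 0"
  shows "\<forall>\<^sub>F n in sequentially. (\<integral>y. \<phi> y \<partial>P') - e < (\<integral>y. \<phi> y \<partial>P n)"
proof -
  interpret P': config_measure k P' by (rule P')
  define \<psi> where "\<psi> = inf_convolution k \<phi>"
  have lip: "\<bar>\<psi> m x - \<psi> m y\<bar> \<le> real m * config_dist k x y" for m x y
    unfolding \<psi>_def by (rule inf_convolution_lipschitz[OF cont bdd])
  have le: "\<psi> m x \<le> \<phi> x" if "x \<in> config_space k" for m x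
    unfolding \<psi>_def by (rule inf_convolution_le[OF cont bdd that])
  have b: "\<bar>\<psi> m x\<bar> \<le> B" if "x \<in> config_space k" for m x
    using le[OF that, of m] inf_convolution_ge[OF cont bdd, of m x] bdd[OF that] unfolding \<psi>_def by (simp add: abs_le_iff)
  have m: "\<psi> m \<in> borel_measurable (lebesgue_prod k)" for m
    by (rule continuous_on_config_measurable[OF lipschitz_config_continuous[OF lip]])
  have m\<phi>: "\<phi> \<in> borel_measurable (lebesgue_prod k)" by (rule continuous_on_config_measurable[OF cont])
  have "(\<lambda>m. \<integral>y. \<psi> m y \<partial>P') \<longlonglongrightarrow> (\<integral>y. \<phi> y \<partial>P')"
  proof (rule integral_dominated_convergence[where w="\<lambda>_. B"])
    show "AE x in P'. (\<lambda>m. \<psi> m x) \<longlonglongrightarrow> \<phi> x"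
      unfolding \<psi>_def by (intro AE_I2 inf_convolution_tendsto[OF cont bdd]) (auto simp: P'.space_P)
    show "AE x in P'. norm (\<psi> m x) \<le> B" for m
      using b by (intro AE_I2) (auto simp: P'.space_P)
  qed (use m m\<phi> in \<open>auto simp: measurable_cong_sets[OF P'.sets_P refl]\<close>)
  then have "\<forall>\<^sub>F m in sequentially. (\<integral>y. \<phi> y \<partial>P') - e < (\<integral>y. \<psi> m y \<partial>P')"
    by (rule order_tendstoD) (use e in simp)
  then obtain m where mm: "(\<integral>y. \<phi> y \<partial>P') - e < (\<integral>y. \<psi> m y \<partial>P')"
    by (auto simp: eventually_sequentially)
  have "(\<lambda>n. \<integral>y. \<psi> m y \<partial>P n) \<longlonglongrightarrow> (\<integral>y. \<psi> m y \<partial>P')"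
    by (rule lipschitz_weak_convergence[OF m b _ lip]) auto
  then have "\<forall>\<^sub>F n in sequentially. (\<integral>y. \<phi> y \<partial>P') - e < (\<integral>y. \<psi> m y \<partial>P n)"
    by (rule order_tendstoD) (rule mm)
  then show ?thesis
  proof eventually_elim
    case (elim n)
    interpret Pn: config_measure k "P n" by (rule P)
    have "(\<integral>y. \<psi> m y \<partial>P n) \<le> (\<integral>y. \<phi> y \<partial>P n)"
      by (intro integral_mono Pn.bounded_integrable_P[OF m b] Pn.bounded_integrable_P[OF m\<phi> bdd] le) (auto simp: Pn.space_P)
    then show ?case using elim by linarith
  qed
qed

text \<open>Convolving with a Gaussian gives densities converging pointwise, hence in \<open>L\<^sup>1\<close> by Scheffe's lemma.\<close>

lemma gauss_prod_weak_convergence: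
  fixes \<phi> :: "(nat \<Rightarrow> 'a) \<Rightarrow> real"
  assumes cont: "continuous_on (config_space k) \<phi>"
    and bdd: "\<And>x. x \<in> config_space k \<Longrightarrow> \<bar>\<phi> x\<bar> \<le> B"
  shows "(\<lambda>n. \<integral>y. \<phi> y \<partial>P n) \<longlonglongrightarrow> (\<integral>y. \<phi> y \<partial>P')"
proof (rule tendstoI)
  fix e :: real assume e: "e > 0"
  have "\<forall>\<^sub>F n in sequentially. (\<integral>y. - \<phi> y \<partial>P') - e < (\<integral>y. - \<phi> y \<partial>P n)"
    by (rule weak_convergence_lower[where B=B]) (use cont bdd e in \<open>auto intro: continuous_on_minus\<close>)
  moreover have "\<forall>\<^sub>F n in sequentially. (\<integral>y. \<phi> y \<partial>P') - e < (\<integral>y. \<phi> y \<partial>P n)"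
    by (rule weak_convergence_lower[OF cont bdd e])
  ultimately show "\<forall>\<^sub>F n in sequentially. dist (\<integral>y. \<phi> y \<partial>P n) (\<integral>y. \<phi> y \<partial>P') < e"
    by eventually_elim (auto simp: dist_real_def abs_less_iff)
qed

end

section \<open>Marginals and propagation of chaos\<close>

lemma measurable_coordinate:
  "i < n \<Longrightarrow> (\<lambda>y. y i) \<in> borel_measurable (lebesgue_prod n :: (nat \<Rightarrow> 'a::euclidean_space) measure)"
  using measurable_component_singleton[of i "{..<n}" "\<lambda>_. lborel :: 'a measure"] by simp

text \<open>The restriction keeps the result undefined off {..<n}, hence inside the space of the
  product measure.\<close>

definition permute_config :: "nat \<Rightarrow> (nat \<Rightarrow> nat) \<Rightarrow> (nat \<Rightarrow> 'a) \<Rightarrow> (nat \<Rightarrow> 'a)" where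
  "permute_config n \<tau> y = (\<lambda>i\<in>{..<n}. y (\<tau> i))"

context
  fixes n :: nat and \<tau> :: "nat \<Rightarrow> nat"
  assumes \<tau>: "\<tau> permutes {..<n}"
begin

lemma perm_less: "i < n \<Longrightarrow> \<tau> i < n" "i < n \<Longrightarrow> inv \<tau> i < n"
  using permutes_in_image[OF \<tau>, of i] permutes_in_image[OF permutes_inv[OF \<tau>], of i] by auto

lemma measurable_permute_config [measurable]:
  "permute_config n \<tau> \<in> measurable (lebesgue_prod n) (lebesgue_prod n :: (nat \<Rightarrow> 'a::euclidean_space) measure)"
  unfolding permute_config_def
  by (rule measurable_restrict) (auto intro!: measurable_coordinate perm_less)

lemma distr_permute_config:
  "distr (lebesgue_prod n) (lebesgue_prod n) (permute_config n \<tau>) = (lebesgue_prod n :: (nat \<Rightarrow> 'a::euclidean_space) measure)"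
proof (rule lborel_product.PiM_eqI)
  fix A :: "nat \<Rightarrow> 'a set" assume A: "\<And>i. i \<in> {..<n} \<Longrightarrow> A i \<in> sets lborel"
  have iv: "\<tau> (inv \<tau> i) = i" "inv \<tau> (\<tau> i) = i" for i using permutes_inverses[OF \<tau>] by auto
  have "permute_config n \<tau> -` (PiE {..<n} A) \<inter> space (lebesgue_prod n) = PiE {..<n} (\<lambda>j. A (inv \<tau> j))"
  proof (intro set_eqI iffI)
    fix y assume y: "y \<in> permute_config n \<tau> -` (PiE {..<n} A) \<inter> space (lebesgue_prod n)"
    then have *: "\<And>i. i < n \<Longrightarrow> y (\<tau> i) \<in> A i" by (auto simp: permute_config_def PiE_iff)
    have "y j \<in> A (inv \<tau> j)" if "j < n" for j using *[OF perm_less(2)[OF that]] by (simp add: iv)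
    then show "y \<in> PiE {..<n} (\<lambda>j. A (inv \<tau> j))" using y by (auto simp: space_PiM PiE_iff)
  next
    fix y assume y: "y \<in> PiE {..<n} (\<lambda>j. A (inv \<tau> j))"
    then have *: "\<And>j. j < n \<Longrightarrow> y j \<in> A (inv \<tau> j)" by (auto simp: PiE_iff)
    have "y (\<tau> i) \<in> A i" if "i < n" for i using *[OF perm_less(1)[OF that]] by (simp add: iv)
    then show "y \<in> permute_config n \<tau> -` (PiE {..<n} A) \<inter> space (lebesgue_prod n)"
      using y by (auto simp: permute_config_def PiE_iff space_PiM)
  qed
  then have "emeasure (distr (lebesgue_prod n) (lebesgue_prod n) (permute_config n \<tau>)) (PiE {..<n} A) = emeasure (lebesgue_prod n) (PiE {..<n} (\<lambda>j. A (inv \<tau> j)))"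
    using A by (subst emeasure_distr) auto
  also have "\<dots> = (\<Prod>j<n. emeasure lborel (A (inv \<tau> j)))"
    by (rule lborel_product.emeasure_PiM) (use A perm_less in auto)
  also have "\<dots> = (\<Prod>i<n. emeasure lborel (A i))"
    by (rule prod.reindex_bij_betw[OF permutes_imp_bij[OF permutes_inv[OF \<tau>]]])
  finally show "emeasure (distr (lebesgue_prod n) (lebesgue_prod n) (permute_config n \<tau>)) (PiE {..<n} A) = (\<Prod>i<n. emeasure lborel (A i))" .
qed auto

end

context log_field
begin

text \<open>The product over i < j hides its symmetry, whereas \<open>hamiltonian\<close> runs over
  all ordered pairs and can be reindexed. Injective configurations are treated through it; on the
  others both densities vanish.\<close>

lemma jdens_permute:
  assumes \<tau>: "\<tau> permutes {..<n}"
  shows "jdens Q n (permute_config n \<tau> y) = jdens Q n y"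
proof -
  let ?y = "permute_config n \<tau> y"
  have bij: "bij_betw \<tau> {..<n} {..<n}" by (rule permutes_imp_bij[OF \<tau>])
  have inj: "inj_on ?y {..<n} \<longleftrightarrow> inj_on y {..<n}"
  proof -
    have "inj_on ?y {..<n} \<longleftrightarrow> inj_on (y \<circ> \<tau>) {..<n}" by (rule inj_on_cong) (simp add: permute_config_def)
    also have "\<dots> \<longleftrightarrow> inj_on y {..<n}"
      using comp_inj_on_iff[of \<tau> "{..<n}" y] bij by (auto simp: bij_betw_def)
    finally show ?thesis .
  qed
  have w: "weight n ?y = weight n y"
  proof -
    have "weight n ?y = (\<Prod>i<n. exp (- Q (y (\<tau> i))))" unfolding weight_def permute_config_def by (intro prod.cong) auto
    also have "\<dots> = weight n y" unfolding weight_def by (rule prod.reindex_bij_betw[OF bij])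
    finally show ?thesis .
  qed
  have h: "hamiltonian n ?y = hamiltonian n y"
  proof -
    have "hamiltonian n ?y = (\<Sum>i<n. \<Sum>j\<in>{..<n}-{i}. wker (y (\<tau> i)) (y (\<tau> j)))"
      unfolding hamiltonian_def permute_config_def by (intro sum.cong) auto
    also have "\<dots> = (\<Sum>i<n. \<Sum>j\<in>{..<n}-{\<tau> i}. wker (y (\<tau> i)) (y j))"
    proof (rule sum.cong[OF refl])
      fix i assume i: "i \<in> {..<n}"
      have "bij_betw \<tau> ({..<n}-{i}) ({..<n}-{\<tau> i})" 
        by (rule bij_betw_subset[OF bij]) (use i in \<open>auto simp: image_set_diff[OF permutes_inj[OF \<tau>]] permutes_image[OF \<tau>]\<close>)
      then show "(\<Sum>j\<in>{..<n}-{i}. wker (y (\<tau> i)) (y (\<tau> j))) = (\<Sum>j\<in>{..<n}-{\<tau> i}. wker (y (\<tau> i)) (y j))"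
        by (rule sum.reindex_bij_betw)
    qed
    also have "\<dots> = hamiltonian n y" unfolding hamiltonian_def
      by (rule sum.reindex_bij_betw[OF bij, of "\<lambda>i. \<Sum>j\<in>{..<n}-{i}. wker (y i) (y j)"])
    finally show ?thesis .
  qed
  show ?thesis using jdens_inj[of y n] jdens_inj[of ?y n] jdens_not_inj[of y n] jdens_not_inj[of ?y n] inj w h
    by (cases "inj_on y {..<n}") auto
qed

lemma PN_permute:
  fixes f :: "(nat \<Rightarrow> 'a) \<Rightarrow> real"
  assumes Z: "Z n > 0" and \<tau>: "\<tau> permutes {..<n}" and f[measurable]: "f \<in> borel_measurable (lebesgue_prod n)"
  shows "(\<integral>y. f (permute_config n \<tau> y) \<partial>PN n) = (\<integral>y. f y \<partial>PN n)"
proof -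
  note [measurable] = measurable_permute_config[OF \<tau>]
  have "(\<integral>y. jdens Q n y * f y \<partial>lebesgue_prod n) = (\<integral>y. jdens Q n y * f y \<partial>distr (lebesgue_prod n) (lebesgue_prod n) (permute_config n \<tau>))"
    by (simp add: distr_permute_config[OF \<tau>])
  also have "\<dots> = (\<integral>y. jdens Q n (permute_config n \<tau> y) * f (permute_config n \<tau> y) \<partial>lebesgue_prod n)"
    by (rule integral_distr) measurable
  also have "\<dots> = (\<integral>y. jdens Q n y * f (permute_config n \<tau> y) \<partial>lebesgue_prod n)"
    by (simp add: jdens_permute[OF \<tau>])
  finally show ?thesis by (simp add: PN_integral(2)[OF Z])
qed

end

lemma (in prob_space) expectation_abs_le_sqrt:
  fixes X :: "'a \<Rightarrow> real"
  assumes X: "integrable M X" and X2: "integrable M (\<lambda>x. (X x)\<^sup>2)"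
  shows "(\<integral>x. \<bar>X x\<bar> \<partial>M) \<le> sqrt (\<integral>x. (X x)\<^sup>2 \<partial>M)"
proof -
  have "0 \<le> variance (\<lambda>x. \<bar>X x\<bar>)" by simp
  also have "\<dots> = (\<integral>x. (\<bar>X x\<bar>)\<^sup>2 \<partial>M) - (\<integral>x. \<bar>X x\<bar> \<partial>M)\<^sup>2"
    by (rule variance_eq) (use X X2 in auto)
  finally show ?thesis by (intro real_le_rsqrt) simp
qed

context log_equilibrium
begin

context
  fixes t :: real and z :: "nat \<Rightarrow> 'a"
  assumes t: "t > 0"
begin

text \<open>By exchangeability the last factor may be replaced by its empirical average.\<close>

lemma PN_factor:
  assumes n: "n > k"
  shows "\<bar>(\<integral>y. (\<Prod>i<Suc k. gauss t (y i - z i)) \<partial>PN n) - gauss_pot t \<mu> (z k) * (\<integral>y. (\<Prod>i<k. gauss t (y i - z i)) \<partial>PN n)\<bar>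
    \<le> k / n + sqrt (\<integral>y. ((\<Sum>i<n. gauss t (y i - z k)) / n - gauss_pot t \<mu> (z k))\<^sup>2 \<partial>PN n)"
proof -
  have n0: "n \<ge> 1" "n > 0" using n by auto
  note Zp = Z_pos[OF n0(1)]
  interpret P: prob_space "PN n" by (rule prob_space_PN[OF Zp])
  define g where "g i x = gauss t (x - z i)" for i x
  have g: "0 \<le> g i x" "g i x \<le> 1" for i x using gauss_le_1[of t] t by (auto simp: g_def)
  define m where "m = gauss_pot t \<mu> (z k)"
  have m: "0 \<le> m" "m \<le> 1" using gauss_pot_props(2,3)[OF \<mu>] t by (auto simp: m_def)
  define \<pi> where "\<pi> y = (\<Prod>i<k. g i (y i))" for y
  have \<pi>: "0 \<le> \<pi> y" "\<pi> y \<le> 1" for y unfolding \<pi>_def using g by (auto intro!: prod_nonneg prod_le_1)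
  have comp[measurable]: "(\<lambda>y. y i) \<in> borel_measurable (lebesgue_prod n)" if "i < n" for i
    using that by (rule measurable_coordinate)
  have gm: "(\<lambda>y. g i (y j)) \<in> borel_measurable (lebesgue_prod n)" if "j < n" for i j
    unfolding g_def using comp[OF that] by measurable
  have \<pi>m[measurable]: "\<pi> \<in> borel_measurable (lebesgue_prod n)"
    unfolding \<pi>_def by (intro borel_measurable_prod gm) (use n in auto)
  have mc: "f \<in> borel_measurable (PN n) \<longleftrightarrow> f \<in> borel_measurable (lebesgue_prod n)" for f :: "(nat \<Rightarrow> 'a) \<Rightarrow> real"
    by (simp add: measurable_cong_sets[OF sets_PN refl])
  have int: "integrable (PN n) f" "(\<integral>y. f y \<partial>PN n) \<le> 1" "0 \<le> (\<integral>y. f y \<partial>PN n)"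
    if "f \<in> borel_measurable (lebesgue_prod n)" "\<And>y. 0 \<le> f y" "\<And>y. f y \<le> 1" for f :: "(nat \<Rightarrow> 'a) \<Rightarrow> real"
    using P.integrable_unit_bounded[of f] that mc by auto
  define E1 where "E1 = (\<integral>y. \<pi> y * g k (y k) \<partial>PN n)"
  define E0 where "E0 = (\<integral>y. \<pi> y \<partial>PN n)"
  define e where "e j = (\<integral>y. \<pi> y * g k (y j) \<partial>PN n)" for j
  have pm: "(\<lambda>y. \<pi> y * g k (y j)) \<in> borel_measurable (lebesgue_prod n)" if "j < n" for j
    using gm[OF that] by measurable
  have pb: "0 \<le> \<pi> y * g k (y j)" "\<pi> y * g k (y j) \<le> 1" for y j
    using \<pi>[of y] g[of k "y j"] by (auto intro: mult_le_one)
  have e_int: "integrable (PN n) (\<lambda>y. \<pi> y * g k (y j))" "e j \<le> 1" "0 \<le> e j" if "j < n" for j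
    unfolding e_def using int[OF pm[OF that] pb] by auto
  \<comment> \<open>Swapping k and j fixes every index below k and thus leaves \<pi> unchanged; this
    is where j \<ge> k enters.\<close>
  have ek: "e j = E1" if j: "k \<le> j" "j < n" for j
  proof -
    let ?\<tau> = "Transposition.transpose k j"
    have \<tau>: "?\<tau> permutes {..<n}" using j n by (intro permutes_swap_id) auto
    have "E1 = (\<integral>y. \<pi> (permute_config n ?\<tau> y) * g k (permute_config n ?\<tau> y k) \<partial>PN n)"
      unfolding E1_def by (rule PN_permute[OF Zp \<tau> pm[OF n], symmetric])
    also have "\<dots> = e j"
    proof -
      have "\<pi> (permute_config n ?\<tau> y) = \<pi> y" for y
        unfolding \<pi>_def using j n by (intro prod.cong) (auto simp: permute_config_def Transposition.transpose_def)
      moreover have "permute_config n ?\<tau> y k = y j" for y :: "nat \<Rightarrow> 'a" using n by (simp add: permute_config_def)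
      ultimately show ?thesis by (simp add: e_def)
    qed
    finally show ?thesis ..
  qed
  define A where "A y = (\<Sum>j<n. g k (y j)) / n" for y
  have Am: "A \<in> borel_measurable (lebesgue_prod n)" unfolding A_def
    by (intro borel_measurable_divide borel_measurable_sum gm) auto
  have A0: "0 \<le> A y" for y unfolding A_def using g by (intro divide_nonneg_nonneg sum_nonneg) auto
  have A1: "A y \<le> 1" for y
  proof -
    have "(\<Sum>j<n. g k (y j)) \<le> (\<Sum>j<n. 1)" using g by (intro sum_mono) auto
    then show ?thesis unfolding A_def using n0 by (simp add: field_simps)
  qed
  have \<pi>A: "(\<integral>y. \<pi> y * A y \<partial>PN n) = (\<Sum>j<n. e j) / n"
  proof -
    have "(\<integral>y. \<pi> y * A y \<partial>PN n) = (\<integral>y. (\<Sum>j<n. \<pi> y * g k (y j)) / n \<partial>PN n)"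
      by (simp add: A_def sum_distrib_left)
    also have "\<dots> = (\<integral>y. (\<Sum>j<n. \<pi> y * g k (y j)) \<partial>PN n) / n" by simp
    also have "(\<integral>y. (\<Sum>j<n. \<pi> y * g k (y j)) \<partial>PN n) = (\<Sum>j<n. e j)"
      unfolding e_def by (rule Bochner_Integration.integral_sum) (use e_int in auto)
    finally show ?thesis .
  qed
  \<comment> \<open>Only the k indices below k can deviate from E1, each by at most 1 as a
    difference of two numbers in [0, 1]; after division by n this is the error k / n.\<close>
  have "\<bar>(\<Sum>j<n. e j) - n * E1\<bar> = \<bar>\<Sum>j<n. e j - E1\<bar>" by (simp add: sum_subtractf)
  also have "(\<Sum>j<n. e j - E1) = (\<Sum>j<k. e j - E1)"
    using n ek by (intro sum.mono_neutral_right) auto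
  also have "\<bar>\<dots>\<bar> \<le> (\<Sum>j<k. \<bar>e j - E1\<bar>)" by (rule sum_abs)
  also have "\<dots> \<le> (\<Sum>j<k. 1)"
  proof (rule sum_mono)
    fix j assume "j \<in> {..<k}"
    then have "j < n" using n by auto
    then show "\<bar>e j - E1\<bar> \<le> 1" using e_int(2,3)[of j] e_int(2,3)[of k] ek[of k] n by (simp add: abs_le_iff)
  qed
  finally have 1: "\<bar>(\<integral>y. \<pi> y * A y \<partial>PN n) - E1\<bar> \<le> k / n"
  proof -
    assume *: "\<bar>(\<Sum>j<n. e j) - n * E1\<bar> \<le> (\<Sum>j<k. 1)"
    have "(\<integral>y. \<pi> y * A y \<partial>PN n) - E1 = ((\<Sum>j<n. e j) - n * E1) / n"
      unfolding \<pi>A using n0 by (simp add: field_simps)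
    then have "\<bar>(\<integral>y. \<pi> y * A y \<partial>PN n) - E1\<bar> = \<bar>(\<Sum>j<n. e j) - n * E1\<bar> / n" by simp
    also have "\<dots> \<le> k / n" using * by (intro divide_right_mono) auto
    finally show ?thesis .
  qed
  have iA: "integrable (PN n) A" by (rule int(1)[OF Am A0 A1])
  have i\<pi>: "integrable (PN n) \<pi>" by (rule int(1)[OF \<pi>m \<pi>])
  have i\<pi>A: "integrable (PN n) (\<lambda>y. \<pi> y * A y)"
    by (rule int(1)) (use Am \<pi> A0 A1 in \<open>auto intro: mult_le_one\<close>)
  have iAm: "integrable (PN n) (\<lambda>y. A y - m)" using iA by simp
  have iAm2: "integrable (PN n) (\<lambda>y. (A y - m)\<^sup>2)"
  proof (rule int(1))
    show "(A y - m)\<^sup>2 \<le> 1" for y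
      using A0[of y] A1[of y] m by (simp add: abs_square_le_1 abs_le_iff)
  qed (use Am in auto)
  have "\<bar>(\<integral>y. \<pi> y * A y \<partial>PN n) - m * E0\<bar> = \<bar>\<integral>y. \<pi> y * A y - m * \<pi> y \<partial>PN n\<bar>"
    using i\<pi>A i\<pi> by (simp add: E0_def)
  also have "\<dots> \<le> (\<integral>y. \<bar>\<pi> y * A y - m * \<pi> y\<bar> \<partial>PN n)" by (rule integral_abs_bound)
  also have "\<dots> \<le> (\<integral>y. \<bar>A y - m\<bar> \<partial>PN n)"
  proof (rule integral_mono)
    fix y
    have "\<bar>\<pi> y * A y - m * \<pi> y\<bar> = \<pi> y * \<bar>A y - m\<bar>"
      using \<pi>[of y] by (simp add: abs_mult right_diff_distrib[symmetric] mult.commute[of m])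
    also have "\<dots> \<le> 1 * \<bar>A y - m\<bar>" using \<pi> by (intro mult_right_mono) auto
    finally show "\<bar>\<pi> y * A y - m * \<pi> y\<bar> \<le> \<bar>A y - m\<bar>" by simp
  qed (use i\<pi>A i\<pi> iAm in auto)
  also have "\<dots> \<le> sqrt (\<integral>y. (A y - m)\<^sup>2 \<partial>PN n)" by (rule P.expectation_abs_le_sqrt[OF iAm iAm2])
  finally have 2: "\<bar>(\<integral>y. \<pi> y * A y \<partial>PN n) - m * E0\<bar> \<le> sqrt (\<integral>y. (A y - m)\<^sup>2 \<partial>PN n)" .
  have "\<bar>E1 - m * E0\<bar> \<le> k / n + sqrt (\<integral>y. (A y - m)\<^sup>2 \<partial>PN n)" using 1 2 by linarith
  then show ?thesis unfolding E1_def E0_def \<pi>_def A_def m_def g_def by (simp add: lessThan_Suc mult.commute)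
qed

text \<open>Factors are removed one at a time: \<open>PN_factor\<close> replaces the last one by a
  constant, and its error vanishes by \<open>PN_gauss_discrepancy\<close>.\<close>

lemma PN_gauss_prod_tendsto:
  "(\<lambda>n. \<integral>y. (\<Prod>i<k. gauss t (y i - z i)) \<partial>PN n) \<longlonglongrightarrow> (\<Prod>i<k. gauss_pot t \<mu> (z i))"
proof (induction k)
  case 0
  have "\<forall>\<^sub>F n in sequentially. (\<integral>y. (\<Prod>i<0. gauss t (y i - z i)) \<partial>PN n) = 1"
    using eventually_ge_at_top[of "1::nat"]
  proof eventually_elim
    case (elim n)
    interpret prob_space "PN n" by (rule prob_space_PN[OF Z_pos[OF elim]])
    show ?case by (simp add: prob_space)
  qed
  then show ?case by (intro tendsto_eventually) simp
next
  case (Suc k)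
  let ?V = "\<lambda>n. \<integral>y. ((\<Sum>i<n. gauss t (y i - z k)) / n - gauss_pot t \<mu> (z k))\<^sup>2 \<partial>PN n"
  have "(\<lambda>n. (\<integral>y. (\<Prod>i<Suc k. gauss t (y i - z i)) \<partial>PN n) - gauss_pot t \<mu> (z k) * (\<integral>y. (\<Prod>i<k. gauss t (y i - z i)) \<partial>PN n)) \<longlonglongrightarrow> 0"
  proof (rule Lim_null_comparison)
    show "\<forall>\<^sub>F n in sequentially. norm ((\<integral>y. (\<Prod>i<Suc k. gauss t (y i - z i)) \<partial>PN n) - gauss_pot t \<mu> (z k) * (\<integral>y. (\<Prod>i<k. gauss t (y i - z i)) \<partial>PN n))
      \<le> k / n + sqrt (?V n)"
      using eventually_gt_at_top[of k] by eventually_elim (use PN_factor in auto)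
    have "(\<lambda>n. real k / real n + sqrt (?V n)) \<longlonglongrightarrow> 0 + sqrt 0"
    proof (intro tendsto_add tendsto_real_sqrt PN_gauss_discrepancy t)
      show "(\<lambda>n. real k / real n) \<longlonglongrightarrow> 0" by real_asymp
    qed
    then show "(\<lambda>n. k / n + sqrt (?V n)) \<longlonglongrightarrow> 0" by simp
  qed
  from tendsto_add[OF this tendsto_mult[OF tendsto_const Suc.IH, of "gauss_pot t \<mu> (z k)"]]
  show ?case by (simp add: mult.commute)
qed

end

section \<open>Marginals and correlation functions\<close>

definition marginal :: "nat \<Rightarrow> nat \<Rightarrow> (nat \<Rightarrow> 'a) measure" where
  "marginal k n = distr (PN n) (lebesgue_prod k) (\<lambda>y. restrict y {..<k})"

lemma measurable_restrict_config:
  assumes "k \<le> n"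
  shows "(\<lambda>y. restrict y {..<k}) \<in> measurable (lebesgue_prod n) (lebesgue_prod k :: (nat \<Rightarrow> 'a) measure)"
  by (rule measurable_restrict) (use assms in \<open>auto intro!: measurable_coordinate\<close>)

lemma marginal_props:
  fixes f :: "(nat \<Rightarrow> 'a) \<Rightarrow> real"
  assumes n: "k \<le> n" "n \<ge> 1"
  shows "config_measure k (marginal k n)"
    "f \<in> borel_measurable (lebesgue_prod k) \<Longrightarrow> (\<integral>x. f x \<partial>marginal k n) = (\<integral>y. f (restrict y {..<k}) \<partial>PN n)"
proof -
  interpret P: prob_space "PN n" by (rule prob_space_PN[OF Z_pos[OF n(2)]])
  have m[measurable]: "(\<lambda>y. restrict y {..<k}) \<in> measurable (PN n) (lebesgue_prod k :: (nat \<Rightarrow> 'a) measure)"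
    using measurable_restrict_config[OF n(1)] by (simp add: measurable_cong_sets[OF sets_PN refl])
  show "config_measure k (marginal k n)"
    unfolding marginal_def by (rule config_measure.intro) (simp_all add: P.prob_space_distr[OF m])
  show "f \<in> borel_measurable (lebesgue_prod k) \<Longrightarrow> (\<integral>x. f x \<partial>marginal k n) = (\<integral>y. f (restrict y {..<k}) \<partial>PN n)"
    unfolding marginal_def by (rule integral_distr[OF m])
qed

lemma config_measure_PiM_\<mu>: "config_measure k (PiM {..<k} (\<lambda>_. \<mu>))"
proof (rule config_measure.intro)
  show "prob_space (PiM {..<k} (\<lambda>_. \<mu>))" by (rule prob_space_PiM) (rule \<mu>.prob_space_axioms)
  show "sets (PiM {..<k} (\<lambda>_. \<mu>)) = sets (lebesgue_prod k)"
    by (intro sets_PiM_cong) (auto simp: borel_probD(2)[OF \<mu>])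
qed

lemma marginal_weak_convergence:
  fixes \<phi> :: "(nat \<Rightarrow> 'a) \<Rightarrow> real"
  assumes cont: "continuous_on (config_space k) \<phi>"
    and bdd: "\<And>x. x \<in> config_space k \<Longrightarrow> \<bar>\<phi> x\<bar> \<le> B"
  shows "(\<lambda>n. \<integral>x. \<phi> x \<partial>marginal k n) \<longlonglongrightarrow> (\<integral>x. \<phi> x \<partial>PiM {..<k} (\<lambda>_. \<mu>))"
proof (rule LIMSEQ_offset[where k="Suc k"], rule gauss_prod_weak_convergence[OF _ config_measure_PiM_\<mu> _ cont bdd])
  \<comment> \<open>The index shift by k + 1 ensures k \<le> n and n \<ge> 1, so that every member
    of the sequence is a probability law, not only eventually.\<close>
  fix n
  show "config_measure k (marginal k (n + Suc k))" by (rule marginal_props) auto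
next
  fix t :: real and z :: "nat \<Rightarrow> 'a" assume t: "t > 0"
  interpret \<mu>p: product_sigma_finite "\<lambda>_::nat. \<mu>" by unfold_locales
  have m: "(\<lambda>y. gauss_prod k t y z) \<in> borel_measurable (lebesgue_prod k)"
  proof -
    have "(\<lambda>y. gauss t (y i - z i)) \<in> borel_measurable (lebesgue_prod k)" if "i < k" for i
      using measurable_coordinate[OF that] by measurable
    then show ?thesis unfolding gauss_prod_def by (intro borel_measurable_prod) auto
  qed
  have 1: "(\<integral>y. gauss_prod k t y z \<partial>marginal k (n + Suc k)) = (\<integral>y. (\<Prod>i<k. gauss t (y i - z i)) \<partial>PN (n + Suc k))" for n
    by (subst marginal_props(2)[OF _ _ m]) (auto simp: gauss_prod_def intro!: Bochner_Integration.integral_cong prod.cong)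
  have 2: "(\<integral>y. gauss_prod k t y z \<partial>PiM {..<k} (\<lambda>_. \<mu>)) = (\<Prod>i<k. gauss_pot t \<mu> (z i))"
    unfolding gauss_prod_def gauss_pot_def
    by (rule \<mu>p.product_integral_prod) (use gauss_pot_props(1)[OF \<mu>] t in auto)
  show "(\<lambda>n. \<integral>y. gauss_prod k t y z \<partial>marginal k (n + Suc k)) \<longlonglongrightarrow> (\<integral>y. gauss_prod k t y z \<partial>PiM {..<k} (\<lambda>_. \<mu>))"
    unfolding 1 2 by (rule LIMSEQ_ignore_initial_segment[OF PN_gauss_prod_tendsto[OF t]])
qed

text \<open>Fubini over the splitting of the n coordinates into the first k and the rest;
  restricting a merged configuration returns its first part, so \<phi> leaves the inner
  integral.\<close>

lemma Rkn_marginal: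
  fixes \<phi> :: "(nat \<Rightarrow> 'a) \<Rightarrow> real"
  assumes n: "k < n" and meas[measurable]: "\<phi> \<in> borel_measurable (lebesgue_prod k)"
    and bdd: "\<And>x. x \<in> config_space k \<Longrightarrow> \<bar>\<phi> x\<bar> \<le> B"
  shows "(\<integral>x. \<phi> x * Rkn Q k n x \<partial>lebesgue_prod k) = (\<integral>x. \<phi> x \<partial>marginal k n)"
proof -
  have n': "k \<le> n" "n \<ge> 1" using n by auto
  note Zp = Z_pos[OF n'(2)]
  have un: "{..<k} \<union> {k..<n} = {..<n}" using n by auto
  have rm[measurable]: "(\<lambda>y. restrict y {..<k}) \<in> measurable (lebesgue_prod n) (lebesgue_prod k :: (nat \<Rightarrow> 'a) measure)"
    by (rule measurable_restrict_config[OF n'(1)])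
  define f where "f y = jdens Q n y * \<phi> (restrict y {..<k})" for y
  have fm[measurable]: "f \<in> borel_measurable (lebesgue_prod n)" unfolding f_def by measurable
  have fi: "integrable (lebesgue_prod n) f"
  proof (rule Bochner_Integration.integrable_bound)
    show "integrable (lebesgue_prod n) (\<lambda>y. B * jdens Q n y)" using jdens_integrable by simp
    show "AE y in lebesgue_prod n. norm (f y) \<le> norm (B * jdens Q n y)"
    proof (rule AE_I2)
      fix y :: "nat \<Rightarrow> 'a"
      have "\<bar>\<phi> (restrict y {..<k})\<bar> \<le> \<bar>B\<bar>" using bdd[of "restrict y {..<k}"] by auto
      then have "\<bar>\<phi> (restrict y {..<k})\<bar> * \<bar>jdens Q n y\<bar> \<le> \<bar>B\<bar> * \<bar>jdens Q n y\<bar>" by (rule mult_right_mono) simp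
      then show "norm (f y) \<le> norm (B * jdens Q n y)" by (simp add: f_def abs_mult mult.commute)
    qed
  qed measurable
  have "(\<integral>x. \<phi> x \<partial>marginal k n) = (\<integral>y. \<phi> (restrict y {..<k}) \<partial>PN n)" by (rule marginal_props(2)[OF n' meas])
  also have "\<dots> = (\<integral>y. f y \<partial>lebesgue_prod n) / Z n" unfolding f_def by (rule PN_integral(2)[OF Zp]) measurable
  also have "(\<integral>y. f y \<partial>lebesgue_prod n) = (\<integral>x. (\<integral>z. f (merge {..<k} {k..<n} (x, z)) \<partial>PiM {k..<n} (\<lambda>_. lborel)) \<partial>lebesgue_prod k)"
  proof -
    have "{..<k} \<inter> {k..<n} = {}" by auto
    from lborel_product.product_integral_fold[OF this, of f] fi show ?thesis unfolding un by simp
  qed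
  also have "\<dots> / Z n = (\<integral>x. (\<integral>z. f (merge {..<k} {k..<n} (x, z)) \<partial>PiM {k..<n} (\<lambda>_. lborel)) / Z n \<partial>lebesgue_prod k)"
    by simp
  also have "\<dots> = (\<integral>x. \<phi> x * Rkn Q k n x \<partial>lebesgue_prod k)"
  proof (rule Bochner_Integration.integral_cong[OF refl])
    fix x :: "nat \<Rightarrow> 'a" assume "x \<in> space (lebesgue_prod k)"
    then have "restrict (merge {..<k} {k..<n} (x, z)) {..<k} = x" for z
      by (auto simp: merge_def restrict_def space_PiM PiE_def extensional_def fun_eq_iff)
    then show "(\<integral>z. f (merge {..<k} {k..<n} (x, z)) \<partial>PiM {k..<n} (\<lambda>_. lborel)) / Z n = \<phi> x * Rkn Q k n x"
      by (simp add: f_def Rkn_def Dn_Z)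
  qed
  finally show ?thesis ..
qed

end

section \<open>External fields of power growth\<close>

lemma log_field_power_growth:
  fixes Q :: "'a::euclidean_space \<Rightarrow> real"
  assumes cont: "continuous_on UNIV Q" and nonneg: "\<And>x. Q x \<ge> 0"
    and pos: "\<alpha> > 0" "\<gamma> > 0" "\<epsilon> > 0"
    and asymp: "(\<lambda>x. Q x - \<gamma> * norm x powr \<alpha>) \<in> O[at_infinity](\<lambda>x. norm x powr (\<alpha> - \<epsilon>))"
  shows "log_field Q"
proof
  \<comment> \<open>The error term is smaller than the main term by a factor of order
    |x|^(-\<epsilon>), so far out Q is within any prescribed proportion of \<gamma>
    |x|^\<alpha>.\<close>
  have close: "\<exists>R\<ge>1. \<forall>x. norm x \<ge> R \<longrightarrow> \<bar>Q x - \<gamma> * norm x powr \<alpha>\<bar> \<le> d * norm x powr \<alpha>" if d: "d > 0" for d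
  proof -
    obtain K where K: "K > 0" "\<forall>\<^sub>F x in at_infinity. norm (Q x - \<gamma> * norm x powr \<alpha>) \<le> K * norm (norm x powr (\<alpha> - \<epsilon>))"
      using landau_o.bigE[OF asymp] by blast
    obtain R1 where R1: "\<And>x. norm x \<ge> R1 \<Longrightarrow> norm (Q x - \<gamma> * norm x powr \<alpha>) \<le> K * norm (norm x powr (\<alpha> - \<epsilon>))"
      using K(2) unfolding eventually_at_infinity by blast
    have "((\<lambda>r::real. K * r powr (- \<epsilon>)) \<longlongrightarrow> K * 0) at_top"
      by (intro tendsto_mult tendsto_const tendsto_neg_powr) (use pos in \<open>auto simp: filterlim_ident\<close>)
    then have "\<forall>\<^sub>F r in at_top. K * r powr (- \<epsilon>) < d" by (rule order_tendstoD) (use d in simp)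
    then obtain R2 where R2: "\<And>r. r \<ge> R2 \<Longrightarrow> K * r powr (- \<epsilon>) < d" by (auto simp: eventually_at_top_linorder)
    have "\<bar>Q x - \<gamma> * norm x powr \<alpha>\<bar> \<le> d * norm x powr \<alpha>" if x: "norm x \<ge> max 1 (max R1 R2)" for x
    proof -
      have "\<bar>Q x - \<gamma> * norm x powr \<alpha>\<bar> \<le> K * norm x powr (\<alpha> - \<epsilon>)" using R1[of x] x by simp
      also have "\<dots> = (K * norm x powr (- \<epsilon>)) * norm x powr \<alpha>" by (simp add: powr_diff powr_minus divide_inverse mult_ac)
      also have "\<dots> \<le> d * norm x powr \<alpha>" using R2[of "norm x"] x by (intro mult_right_mono) auto
      finally show ?thesis .
    qed
    then show ?thesis by (intro exI[of _ "max 1 (max R1 R2)"]) auto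
  qed
  show "continuous_on UNIV Q" "\<And>x. 0 \<le> Q x" by fact+
  show "\<exists>C. \<forall>x. ln (1 + norm x) \<le> \<eta> * Q x + C" if \<eta>: "\<eta> > 0" for \<eta>
  proof -
    obtain R where R: "R \<ge> 1" "\<And>x. norm x \<ge> R \<Longrightarrow> \<bar>Q x - \<gamma> * norm x powr \<alpha>\<bar> \<le> (\<gamma> / 2) * norm x powr \<alpha>"
      using close[of "\<gamma> / 2"] pos by auto
    define c where "c = \<eta> * (\<gamma> / 2)"
    have c: "c > 0" using \<eta> pos by (simp add: c_def)
    \<comment> \<open>The logarithm is negligible against any positive power; with Q at least half
      of its leading term far out, any \<eta> > 0 is allowed.\<close>
    have "((\<lambda>r::real. ln (1 + r) / r powr \<alpha>) \<longlongrightarrow> 0) at_top" using pos(1) by real_asymp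
    then have "\<forall>\<^sub>F r in at_top. ln (1 + r) / r powr \<alpha> < c" by (rule order_tendstoD) (rule c)
    then obtain R2 where R2: "\<And>r. r \<ge> R2 \<Longrightarrow> ln (1 + r) / r powr \<alpha> < c" by (auto simp: eventually_at_top_linorder)
    define R3 where "R3 = max R R2"
    have "ln (1 + norm x) \<le> \<eta> * Q x + ln (1 + R3)" for x
    proof (cases "norm x \<ge> R3")
      case True
      then have x: "norm x > 0" "norm x \<ge> R" "norm x \<ge> R2" using R(1) by (auto simp: R3_def)
      then have "ln (1 + norm x) \<le> c * norm x powr \<alpha>" using R2[OF x(3)] by (simp add: field_simps)
      also have "\<dots> \<le> \<eta> * Q x"
      proof -
        have "\<gamma> / 2 * norm x powr \<alpha> \<le> Q x" using R(2)[OF x(2)] by linarith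
        then show ?thesis unfolding c_def mult.assoc using \<eta> by (intro mult_left_mono) auto
      qed
      finally show ?thesis using R(1) by (simp add: R3_def add_increasing2)
    next
      case False
      then have "ln (1 + norm x) \<le> ln (1 + R3)" using R(1) by (subst ln_le_cancel_iff) (auto simp: R3_def intro!: add_pos_nonneg)
      then show ?thesis using nonneg[of x] \<eta> by (simp add: add_increasing)
    qed
    then show ?thesis by blast
  qed
  show "\<exists>s>0. \<forall>x h. norm h \<le> s \<longrightarrow> \<bar>Q (x + h) - Q x\<bar> \<le> \<delta> * (1 + Q x)" if \<delta>: "\<delta> > 0" for \<delta>
  proof -
    \<comment> \<open>With a = |x|^\<alpha>, the increment of Q far out is at most d (3 + \<gamma>)
      a: 2 d a for Q (x + h), where |x + h|^\<alpha> \<le> 2 a, then \<gamma> d a for the change of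
      the power and d a for Q x. Since Q x \<ge> \<gamma> a / 2, it suffices that d (3 + \<gamma>)
      \<le> \<delta> \<gamma> / 2.\<close>
    define d where "d = min 1 (min (\<gamma> / 2) (\<delta> * \<gamma> / (2 * (3 + \<gamma>))))"
    have d: "d > 0" "d \<le> 1" "d \<le> \<gamma> / 2"
      using \<delta> pos unfolding d_def by (auto simp del: le_divide_eq_numeral1 intro: min.coboundedI2 min.coboundedI1)
    have "d * (3 + \<gamma>) \<le> \<delta> * \<gamma> / (2 * (3 + \<gamma>)) * (3 + \<gamma>)"
      using pos by (intro mult_right_mono) (auto simp: d_def)
    also have "\<dots> = \<delta> * \<gamma> / 2" using pos by (simp add: field_simps)
    finally have d4: "d * (3 + \<gamma>) \<le> \<delta> * \<gamma> / 2" .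
    obtain R where R: "R \<ge> 1" "\<And>x. norm x \<ge> R \<Longrightarrow> \<bar>Q x - \<gamma> * norm x powr \<alpha>\<bar> \<le> d * norm x powr \<alpha>"
      using close[OF d(1)] by auto
    have "((\<lambda>r::real. ((r + 1) / r) powr \<alpha>) \<longlongrightarrow> 1) at_top" by real_asymp
    then have "\<forall>\<^sub>F r in at_top. ((r + 1) / r) powr \<alpha> < 1 + d" by (rule order_tendstoD) (use d in simp)
    then obtain R2 where R2: "\<And>r. r \<ge> R2 \<Longrightarrow> ((r + 1) / r) powr \<alpha> < 1 + d" by (auto simp: eventually_at_top_linorder)
    have "((\<lambda>r::real. ((r - 1) / r) powr \<alpha>) \<longlongrightarrow> 1) at_top" by real_asymp
    then have "\<forall>\<^sub>F r in at_top. 1 - d < ((r - 1) / r) powr \<alpha>" by (rule order_tendstoD) (use d in simp)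
    then obtain R3 where R3: "\<And>r. r \<ge> R3 \<Longrightarrow> 1 - d < ((r - 1) / r) powr \<alpha>" by (auto simp: eventually_at_top_linorder)
    define S where "S = max (R + 1) (max R2 R3)"
    have far: "\<bar>Q (x + h) - Q x\<bar> \<le> \<delta> * (1 + Q x)" if x: "norm x \<ge> S" and h: "norm h \<le> 1" for x h
    proof -
      define r where "r = norm x"
      define r' where "r' = norm (x + h)"
      have r: "r \<ge> R + 1" "r \<ge> R2" "r \<ge> R3" "r \<ge> 2" "r > 0" using x R(1) by (auto simp: r_def S_def)
      have r': "r - 1 \<le> r'" "r' \<le> r + 1"
        using norm_triangle_ineq[of x h] norm_diff_ineq[of x h] h by (auto simp: r_def r'_def)
      have up: "r' powr \<alpha> \<le> (1 + d) * r powr \<alpha>"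
      proof -
        have "r' powr \<alpha> \<le> (r + 1) powr \<alpha>" using r r' pos by (intro powr_mono2) auto
        also have "\<dots> = ((r + 1) / r) powr \<alpha> * r powr \<alpha>" using r by (simp add: powr_divide)
        also have "\<dots> \<le> (1 + d) * r powr \<alpha>" using R2[OF r(2)] by (intro mult_right_mono) auto
        finally show ?thesis .
      qed
      have lo: "(1 - d) * r powr \<alpha> \<le> r' powr \<alpha>"
      proof -
        have "(1 - d) * r powr \<alpha> \<le> ((r - 1) / r) powr \<alpha> * r powr \<alpha>" using R3[OF r(3)] by (intro mult_right_mono) auto
        also have "\<dots> = (r - 1) powr \<alpha>" using r by (simp add: powr_divide)
        also have "\<dots> \<le> r' powr \<alpha>" using r r' pos by (intro powr_mono2) auto
        finally show ?thesis .
      qed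
      define a where "a = r powr \<alpha>"
      have a: "a \<ge> 0" by (simp add: a_def)
      have diff: "\<bar>r' powr \<alpha> - a\<bar> \<le> d * a" using up lo by (simp add: a_def abs_le_iff algebra_simps)
      have "(1 + d) * a \<le> 2 * a" using d a by (intro mult_right_mono) auto
      then have "r' powr \<alpha> \<le> 2 * a" using up by (simp add: a_def)
      then have "d * r' powr \<alpha> \<le> d * (2 * a)" using d by (intro mult_left_mono) auto
      moreover have "\<bar>Q (x + h) - \<gamma> * r' powr \<alpha>\<bar> \<le> d * r' powr \<alpha>"
        unfolding r'_def by (rule R(2)) (use r r' in \<open>simp add: r'_def\<close>)
      moreover have Qx: "\<bar>Q x - \<gamma> * a\<bar> \<le> d * a" unfolding a_def r_def by (rule R(2)) (use r in \<open>simp add: r_def\<close>)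
      moreover have "\<bar>\<gamma> * r' powr \<alpha> - \<gamma> * a\<bar> \<le> \<gamma> * (d * a)"
        unfolding right_diff_distrib[symmetric] abs_mult using diff pos by (simp add: mult_left_mono)
      ultimately have "\<bar>Q (x + h) - Q x\<bar> \<le> d * (2 * a) + \<gamma> * (d * a) + d * a" by linarith
      also have "\<dots> = d * (3 + \<gamma>) * a" by (simp add: algebra_simps)
      also have "\<dots> \<le> \<delta> * \<gamma> / 2 * a" using d4 a by (rule mult_right_mono)
      also have "\<dots> = \<delta> * (\<gamma> / 2 * a)" by simp
      also have "\<dots> \<le> \<delta> * (1 + Q x)"
      proof (rule mult_left_mono)
        have "d * a \<le> \<gamma> / 2 * a" using d(3) a by (rule mult_right_mono)
        then show "\<gamma> / 2 * a \<le> 1 + Q x" using Qx by (simp add: abs_le_iff)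
      qed (use \<delta> in simp)
      finally show ?thesis .
    qed
    \<comment> \<open>The bounded region: the margin 1 keeps x + h in the compact ball, and an
      increment below \<delta> is enough because Q is nonnegative.\<close>
    have "uniformly_continuous_on (cball 0 (S + 1)) Q"
      by (rule compact_uniformly_continuous) (auto intro: continuous_on_subset[OF cont])
    then obtain s where s: "s > 0" "\<And>x y. x \<in> cball 0 (S + 1) \<Longrightarrow> y \<in> cball 0 (S + 1) \<Longrightarrow> dist y x < s \<Longrightarrow> dist (Q y) (Q x) < \<delta>"
      using \<delta> unfolding uniformly_continuous_on_def by metis
    show ?thesis
    proof (intro exI[of _ "min 1 (s / 2)"] conjI allI impI)
      fix x h :: 'a assume h: "norm h \<le> min 1 (s / 2)"
      show "\<bar>Q (x + h) - Q x\<bar> \<le> \<delta> * (1 + Q x)"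
      proof (cases "norm x \<ge> S")
        case False
        have "norm (x + h) \<le> norm x + norm h" by (rule norm_triangle_ineq)
        then have "x \<in> cball 0 (S + 1)" "x + h \<in> cball 0 (S + 1)" "dist (x + h) x < s"
          using False h s(1) unfolding mem_cball_0 by (auto simp: dist_norm)
        from s(2)[OF this] have "\<bar>Q (x + h) - Q x\<bar> < \<delta>" by (simp add: dist_real_def)
        moreover have "\<delta> * 1 \<le> \<delta> * (1 + Q x)" using nonneg[of x] \<delta> by (intro mult_left_mono) auto
        ultimately show ?thesis by simp
      qed (use far h in auto)
    qed (use s in auto)
  qed
qed

theorem theorem3p9:
  fixes Q :: "'a::euclidean_space \<Rightarrow> real"
    and \<alpha> \<gamma> \<epsilon> :: real
    and \<mu> :: "'a measure"
    and k :: nat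
    and \<phi> :: "(nat \<Rightarrow> 'a) \<Rightarrow> real"
  assumes Q_cont: "continuous_on UNIV Q"
    and Q_nonneg: "\<And>x. Q x \<ge> 0"
    and pos: "\<alpha> > 0" "\<gamma> > 0" "\<epsilon> > 0"
    and Q_asymp: "(\<lambda>x. Q x - \<gamma> * norm x powr \<alpha>) \<in> O[at_infinity](\<lambda>x. norm x powr (\<alpha> - \<epsilon>))"
    and eq: "equilibrium_measure Q \<mu>"
    and phi_cont: "continuous_on (\<Pi>\<^sub>E j\<in>{..<k}. UNIV) \<phi>"
    and phi_bdd: "bounded (\<phi> ` (\<Pi>\<^sub>E j\<in>{..<k}. UNIV))"
  shows "(\<lambda>n. \<integral> y. \<phi> y * Rkn Q k n y \<partial>(\<Pi>\<^sub>M j\<in>{..<k}. (lborel :: 'a measure)))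
           \<longlonglongrightarrow> (\<integral> x. \<phi> x \<partial>(\<Pi>\<^sub>M j\<in>{..<k}. \<mu>))"
proof -
  interpret log_field Q
    by (rule log_field_power_growth[OF Q_cont Q_nonneg pos Q_asymp])
  interpret log_equilibrium Q \<mu> by unfold_locales (rule eq)
  obtain B where B: "\<And>x. x \<in> config_space k \<Longrightarrow> \<bar>\<phi> x\<bar> \<le> B"
    using phi_bdd by (auto simp: bounded_iff)
  have meas: "\<phi> \<in> borel_measurable (lebesgue_prod k)"
    by (rule continuous_on_config_measurable[OF phi_cont])
  have "(\<lambda>n. \<integral>x. \<phi> x \<partial>marginal k n) \<longlonglongrightarrow> (\<integral>x. \<phi> x \<partial>PiM {..<k} (\<lambda>_. \<mu>))"
    by (rule marginal_weak_convergence[OF phi_cont B])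
  moreover have "\<forall>\<^sub>F n in sequentially. (\<integral>x. \<phi> x \<partial>marginal k n) = (\<integral>x. \<phi> x * Rkn Q k n x \<partial>lebesgue_prod k)"
    using eventually_gt_at_top[of k]
  proof eventually_elim
    case (elim n)
    show ?case by (rule Rkn_marginal[OF elim meas B, symmetric])
  qed
  ultimately show ?thesis by (rule Lim_transform_eventually)
qed

end
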